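(* Let $N\ge 2$ and let $V\subset\mathbb{R}^{N-1}$ be the Sierpinski gasket with intrinsic boundary $V_0$. Let $r,s,q$ be fixed real numbers with $1<r<s<2<q$. For $\lambda,\eta\ge0$ let $(P_{\lambda,\eta})$ denote the Dirichlet problem $$-\Delta u(x)=\lambda|u(x)|^{s-2}u(x)-\eta|u(x)|^{r-2}u(x)+|u(x)|^{q-2}u(x)\ \ \forall x\in V\setminus V_0,\qquad u|_{V_0}=0.$$ Then there exists a real number $\Lambda>0$ with the following property: for every $\lambda\in\,]0,\Lambda[$ there exists $\eta_\lambda>0$ such that for each $\eta\in[0,\eta_\lambda[$ the problem $(P_{\lambda,\eta})$ has at least three (distinct) nonzero solutions $u\in H_0^1(V)$.
   Context: Sierpinski gasket: let $N\ge 2$ be a natural number and $p_1,\dots,p_N\in\mathbb{R}^{N-1}$ with $|p_i-p_j|=1$ for $i\ne j$ ($|\cdot|$ the Euclidean norm). Let $S_i(x)=\frac12x+\frac12p_i$ for $i=1,\dots,N$. The Sierpinski gasket $V\subset\mathbb{R}^{N-1}$ is the unique nonempty compact set with $V=\bigcup_{i=1}^N S_i(V)$. Put $V_0=\{p_1,\dots,p_N\}$ (the intrinsic boundary) and $V_m=\bigcup_{i=1}^N S_i(V_{m-1})$ for $m\ge1$; then $V=\overline{\bigcup_{m\ge0}V_m}$. Let $\mu$ be the restriction to $V$ of the $d$-dimensional Hausdorff measure, $d=\ln N/\ln 2$, normalized so that $\mu(V)=1$. The space $H_0^1(V)$: let $C_0(V)=\{u\in C(V): u|_{V_0}=0\}$.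 For $u\colon V\to\mathbb{R}$ and $m\in\mathbb{N}$ put $$W_m(u)=\left(\tfrac{N+2}{N}\right)^m\sum_{x,y\in V_m,\ |x-y|=2^{-m}}(u(x)-u(y))^2,\qquad W(u)=\lim_{m\to\infty}W_m(u)\in[0,\infty].$$ $H_0^1(V)=\{u\in C_0(V): W(u)<\infty\}$ is a real Hilbert space with norm $\|u\|=\sqrt{W(u)}$ and inner product $$\mathcal{W}(u,v)=\lim_{m\to\infty}\left(\tfrac{N+2}{N}\right)^m\sum_{x,y\in V_m,\ |x-y|=2^{-m}}(u(x)-u(y))(v(x)-v(y)).$$ Solutions: $\Delta$ is the weak Laplacian on $V$, the operator $\Delta\colon D\to L^2(V,\mu)$, $D\subset H_0^1(V)$, characterized by $-\mathcal{W}(u,v)=\int_V\Delta u\cdot v\,d\mu$ for $u\in D$, $v\in H_0^1(V)$. For continuous $h\colon V\times\mathbb{R}\to\mathbb{R}$, a solution (meaning weak solution) of the Dirichlet problem $-\Delta u(x)=h(x,u(x))$ on $V\setminus V_0$, $u|_{V_0}=0$, is a function $u\in H_0^1(V)$ with $\mathcal{W}(u,v)-\int_V h(x,u(x))v(x)\,d\mu=0$ for all $v\in H_0^1(V)$. Convention: $|0|^{\ell}\cdot 0:=0$ for every $\ell<0$. *)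

theory Defs
  imports "HOL-Analysis.Analysis"
begin

subsection \<open>Hausdorff measure\<close>

text \<open>
  The covering sets are required to be bounded because \<^const>\<open>diameter\<close> is unspecified on
  unbounded sets. Since \<open>0 powr 0 = 0\<close>, the definition is meant for dimensions \<open>d > 0\<close> only
  (the gasket with \<open>N \<ge> 2\<close> has \<open>d \<ge> 1\<close>). The usual dimension-dependent constant factor
  is omitted, as the measure is only used after normalization.
\<close>

definition hausdorff_pre :: "real \<Rightarrow> real \<Rightarrow> 'a::metric_space set \<Rightarrow> ennreal" where
  "hausdorff_pre d \<delta> A =
     (INF U \<in> {U :: nat \<Rightarrow> 'a set. (\<forall>i. bounded (U i) \<and> diameter (U i) \<le> \<delta>) \<and> A \<subseteq> (\<Union>i. U i)}.
        (\<Sum>i. ennreal (diameter (U i) powr d)))"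

definition hausdorff_outer :: "real \<Rightarrow> 'a::metric_space set \<Rightarrow> ennreal" where
  "hausdorff_outer d A = (SUP \<delta> \<in> {0<..}. hausdorff_pre d \<delta> A)"

text \<open>
  The Hausdorff outer measure is a metric outer measure, hence countably additive on the
  Borel sets, so that \<^const>\<open>measure_of\<close> does not collapse to the null measure here.
\<close>

definition hausdorff_measure :: "real \<Rightarrow> 'a::metric_space measure" where
  "hausdorff_measure d = measure_of UNIV (sets borel) (hausdorff_outer d)"


subsection \<open>The Sierpinski gasket\<close>

text \<open>
  The parameter \<open>p\<close> enumerates the vertices; only its values on \<open>{1..N}\<close> matter.
\<close>

definition simplex_vertices :: "nat \<Rightarrow> (nat \<Rightarrow> 'a::real_normed_vector) \<Rightarrow> bool" where
  "simplex_vertices N p \<longleftrightarrow> (\<forall>i\<in>{1..N}. \<forall>j\<in>{1..N}. i \<noteq> j \<longrightarrow> norm (p i - p j) = 1)"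

definition contr :: "(nat \<Rightarrow> 'a::real_normed_vector) \<Rightarrow> nat \<Rightarrow> 'a \<Rightarrow> 'a" where
  "contr p i x = (1 / 2) *\<^sub>R x + (1 / 2) *\<^sub>R p i"

definition gasket :: "nat \<Rightarrow> (nat \<Rightarrow> 'a::real_normed_vector) \<Rightarrow> 'a set" where
  "gasket N p = (THE V. compact V \<and> V \<noteq> {} \<and> V = (\<Union>i\<in>{1..N}. contr p i ` V))"

primrec gasket_level :: "nat \<Rightarrow> (nat \<Rightarrow> 'a::real_normed_vector) \<Rightarrow> nat \<Rightarrow> 'a set" where
  "gasket_level N p 0 = p ` {1..N}"
| "gasket_level N p (Suc m) = (\<Union>i\<in>{1..N}. contr p i ` gasket_level N p m)"

definition gasket_measure :: "nat \<Rightarrow> (nat \<Rightarrow> 'a::real_normed_vector) \<Rightarrow> 'a measure" where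
  "gasket_measure N p =
     (let H = hausdorff_measure (ln (real N) / ln 2); V = gasket N p
      in scale_measure (1 / emeasure H V) (restrict_space H V))"


subsection \<open>The energy and the space of finite-energy functions vanishing on the boundary\<close>

text \<open>The sums range over ordered pairs of neighbouring points.\<close>

definition neighbours :: "nat \<Rightarrow> (nat \<Rightarrow> 'a::real_normed_vector) \<Rightarrow> nat \<Rightarrow> ('a \<times> 'a) set" where
  "neighbours N p m =
     {(x, y). x \<in> gasket_level N p m \<and> y \<in> gasket_level N p m \<and> norm (x - y) = 1 / 2 ^ m}"

definition energy_level ::
    "nat \<Rightarrow> (nat \<Rightarrow> 'a::real_normed_vector) \<Rightarrow> nat \<Rightarrow> ('a \<Rightarrow> real) \<Rightarrow> real" where
  "energy_level N p m u =
     ((real N + 2) / real N) ^ m * (\<Sum>(x, y)\<in>neighbours N p m. (u x - u y)\<^sup>2)"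

definition energy ::
    "nat \<Rightarrow> (nat \<Rightarrow> 'a::real_normed_vector) \<Rightarrow> ('a \<Rightarrow> real) \<Rightarrow> ennreal" where
  "energy N p u = lim (\<lambda>m. ennreal (energy_level N p m u))"

definition energy_form ::
    "nat \<Rightarrow> (nat \<Rightarrow> 'a::real_normed_vector) \<Rightarrow> ('a \<Rightarrow> real) \<Rightarrow> ('a \<Rightarrow> real) \<Rightarrow> real" where
  "energy_form N p u v =
     lim (\<lambda>m. ((real N + 2) / real N) ^ m *
               (\<Sum>(x, y)\<in>neighbours N p m. (u x - u y) * (v x - v y)))"

text \<open>
  Functions on the gasket are extensional (\<^const>\<open>undefined\<close> outside it), so that HOL equality
  of functions is equality on the gasket.
\<close>

definition C0 :: "nat \<Rightarrow> (nat \<Rightarrow> 'a::real_normed_vector) \<Rightarrow> ('a \<Rightarrow> real) set" where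
  "C0 N p = {u \<in> extensional (gasket N p).
               continuous_on (gasket N p) u \<and> (\<forall>x\<in>gasket_level N p 0. u x = 0)}"

definition H01 :: "nat \<Rightarrow> (nat \<Rightarrow> 'a::real_normed_vector) \<Rightarrow> ('a \<Rightarrow> real) set" where
  "H01 N p = {u \<in> C0 N p. energy N p u < \<infinity>}"


subsection \<open>Weak solutions of the Dirichlet problem\<close>

definition weak_solution ::
    "nat \<Rightarrow> (nat \<Rightarrow> 'a::real_normed_vector) \<Rightarrow> ('a \<Rightarrow> real \<Rightarrow> real) \<Rightarrow> ('a \<Rightarrow> real) \<Rightarrow> bool" where
  "weak_solution N p h u \<longleftrightarrow>
     u \<in> H01 N p \<and>
     (\<forall>v\<in>H01 N p.
        energy_form N p u v - (LINT x|gasket_measure N p. h x (u x) * v x) = 0)"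

text \<open>
  As \<open>0 powr a = 0\<close> for all \<open>a\<close>, the products \<open>\<bar>t\<bar> powr (a - 2) * t\<close> below respect the convention
  that they vanish at \<open>t = 0\<close> also for negative exponents.
\<close>

definition rhs :: "real \<Rightarrow> real \<Rightarrow> real \<Rightarrow> real \<Rightarrow> real \<Rightarrow> 'a \<Rightarrow> real \<Rightarrow> real" where
  "rhs r s q lam eta x t =
     lam * (\<bar>t\<bar> powr (s - 2) * t) - eta * (\<bar>t\<bar> powr (r - 2) * t) + \<bar>t\<bar> powr (q - 2) * t"

end

theory Submission
  imports Defs "HOL-Complex_Analysis.Great_Picard"
begin

text \<open>
  The nonlinearity is odd, so solutions come in pairs \<open>u\<close>, \<open>- u\<close>, and two solutions of different
  energy suffice. For small \<open>\<lambda>\<close> there is a radius \<open>\<rho>\<close>, independent of \<open>\<eta>\<close>, such that the functional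
  strictly increases along rays at the sphere of radius \<open>\<rho>\<close>, and beyond this sphere each ray
  carries exactly one critical point, a maximum. Minimizing over the ball gives a solution of
  small energy, with negative critical value once \<open>\<eta>\<close> is small; minimizing the ray maxima gives a second
  one outside the ball. Both minima exist since bounded energy implies equicontinuity.

  The energy sums over all pairs at distance \<open>2 ^ - m\<close>, which include, near the junctions of
  cells, pairs that do not belong to a common \<open>m\<close>-cell. For harmonic functions these additional terms are,
  by symmetry, a multiple \<open>\<chi>\<close> of the usual cell energy; approximating by piecewise harmonic functions,
  the energy of every function is \<open>1 + \<chi>\<close> times the limit of the (monotone) cell energies.
\<close>

section \<open>Hausdorff measure\<close>

text \<open>The \<open>eta\<close> term works against the concave term that makes the minimum
  negative, yet it is harmless on and beyond the sphere: there it increases the outward derivative,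
  and after division by \<open>t powr (q - 1)\<close> it is a multiple of
  \<open>t powr (r - q)\<close>, decreasing because r < q. So \<open>eta\<close> has to be small
  only for the ball to contain a negative value. As r < s < 2, the functional need not be twice
  differentiable and the set of ray maxima need not be a smooth manifold; its minimizer is shown to
  be critical by comparing points on nearby rays, without multipliers. The variational part sees the
  gasket only through a nonnegative symmetric form, a sup norm bound, energy balls closed under
  pointwise limits, convergent subsequences, and a probability measure that charges every nonempty
  relatively open set; the latter rests on the Hausdorff measure of the gasket being finite and
  positive. The energy form is defined by \<open>lim\<close>, which says nothing about divergent
  sequences, so comparability with the cell energies would not even give bilinearity: true
  convergence is required.\<close>

lemma hausdorff_pre_lower:
  assumes "\<And>i. bounded (U i)" "\<And>i. diameter (U i) \<le> \<delta>" "A \<subseteq> (\<Union>i::nat. U i)"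
  shows "hausdorff_pre d \<delta> A \<le> (\<Sum>i. ennreal (diameter (U i) powr d))"
  unfolding hausdorff_pre_def by (rule INF_lower) (use assms in auto)

lemma hausdorff_pre_greatest:
  assumes "\<And>U :: nat \<Rightarrow> _ set. (\<And>i. bounded (U i)) \<Longrightarrow> (\<And>i. diameter (U i) \<le> \<delta>) \<Longrightarrow>
    A \<subseteq> (\<Union>i. U i) \<Longrightarrow> z \<le> (\<Sum>i. ennreal (diameter (U i) powr d))"
  shows "z \<le> hausdorff_pre d \<delta> A"
  unfolding hausdorff_pre_def by (rule INF_greatest) (use assms in auto)

lemma hausdorff_pre_mono:
  assumes "A \<subseteq> B" "\<delta>' \<le> \<delta>"
  shows "hausdorff_pre d \<delta> A \<le> hausdorff_pre d \<delta>' B"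
  by (intro hausdorff_pre_greatest hausdorff_pre_lower) (use assms in \<open>auto intro: order_trans\<close>)

lemma hausdorff_pre_empty [simp]: "\<delta> \<ge> 0 \<Longrightarrow> hausdorff_pre d \<delta> {} = 0"
  using hausdorff_pre_lower[of "\<lambda>_. {}" \<delta> "{}" d] by simp

lemma hausdorff_pre_UN:
  fixes A :: "nat \<Rightarrow> 'a::metric_space set"
  shows "hausdorff_pre d \<delta> (\<Union>n. A n) \<le> (\<Sum>n. hausdorff_pre d \<delta> (A n))"
proof (rule ennreal_le_epsilon)
  fix e :: real assume e: "0 < e" and fin: "(\<Sum>n. hausdorff_pre d \<delta> (A n)) < top"
  have "\<exists>U. (\<forall>i. bounded (U i) \<and> diameter (U i) \<le> \<delta>) \<and> A n \<subseteq> (\<Union>i. U i) \<and>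
      (\<Sum>i. ennreal (diameter (U i) powr d)) \<le> hausdorff_pre d \<delta> (A n) + e * (1/2)^Suc n" for n
  proof -
    \<comment> \<open>Strictness needs the finiteness granted by \<open>ennreal_le_epsilon\<close>;
      the errors add up to \<open>e\<close>.\<close>
    have "hausdorff_pre d \<delta> (A n) < hausdorff_pre d \<delta> (A n) + e * (1/2)^Suc n"
      using e fin by (auto simp add: less_top dest!: ennreal_suminf_lessD)
    then show ?thesis
      unfolding hausdorff_pre_def[of d \<delta> "A n"] INF_less_iff by (auto intro: less_imp_le)
  qed
  then obtain U where U: "\<And>n i. bounded (U n i)" "\<And>n i. diameter (U n i) \<le> \<delta>"
      "\<And>n. A n \<subseteq> (\<Union>i. U n i)"
      "\<And>n. (\<Sum>i. ennreal (diameter (U n i) powr d)) \<le> hausdorff_pre d \<delta> (A n) + e * (1/2)^Suc n"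
    by metis
  define C where "C = case_prod U \<circ> prod_decode"
  have "(\<Union>n. A n) \<subseteq> (\<Union>i. C i)"
    using U(3) by (auto simp add: C_def subset_eq) (metis prod.case prod_encode_inverse)
  then have "hausdorff_pre d \<delta> (\<Union>n. A n) \<le> (\<Sum>i. ennreal (diameter (C i) powr d))"
    by (intro hausdorff_pre_lower) (auto simp: C_def split_def U)
  also have "\<dots> = (\<Sum>n. \<Sum>i. ennreal (diameter (U n i) powr d))"
    using suminf_ennreal_2dimen[where f = "\<lambda>(n, i). ennreal (diameter (U n i) powr d)"]
    by (simp add: C_def split_def)
  also have "\<dots> \<le> (\<Sum>n. hausdorff_pre d \<delta> (A n) + e * (1/2) ^ Suc n)"
    by (intro suminf_le U(4)) auto
  also have "\<dots> = (\<Sum>n. hausdorff_pre d \<delta> (A n)) + (\<Sum>n. ennreal e * ennreal ((1/2) ^ Suc n))"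
    using e by (subst suminf_add[symmetric])
      (auto simp del: ennreal_suminf_cmult simp add: ennreal_mult[symmetric])
  also have "\<dots> = (\<Sum>n. hausdorff_pre d \<delta> (A n)) + e"
    unfolding ennreal_suminf_cmult
    by (subst suminf_ennreal_eq[OF zero_le_power power_half_series]) auto
  finally show "hausdorff_pre d \<delta> (\<Union>n. A n) \<le> (\<Sum>n. hausdorff_pre d \<delta> (A n)) + e" .
qed

section \<open>The Hausdorff outer measure\<close>

lemma hausdorff_pre_le_outer: "\<delta> > 0 \<Longrightarrow> hausdorff_pre d \<delta> A \<le> hausdorff_outer d A"
  unfolding hausdorff_outer_def by (rule SUP_upper) auto

lemma hausdorff_outer_mono: "A \<subseteq> B \<Longrightarrow> hausdorff_outer d A \<le> hausdorff_outer d B"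
  unfolding hausdorff_outer_def by (rule SUP_mono) (auto intro: hausdorff_pre_mono)

lemma hausdorff_outer_empty [simp]: "hausdorff_outer d {} = 0"
  unfolding hausdorff_outer_def by (rule antisym[OF SUP_least]) auto

lemma hausdorff_outer_UN:
  fixes A :: "nat \<Rightarrow> 'a::metric_space set"
  shows "hausdorff_outer d (\<Union>n. A n) \<le> (\<Sum>n. hausdorff_outer d (A n))"
  unfolding hausdorff_outer_def[of d "\<Union>n. A n"]
proof (rule SUP_least)
  fix \<delta> :: real assume "\<delta> \<in> {0<..}"
  then have "(\<Sum>n. hausdorff_pre d \<delta> (A n)) \<le> (\<Sum>n. hausdorff_outer d (A n))"
    by (intro suminf_le hausdorff_pre_le_outer) auto
  then show "hausdorff_pre d \<delta> (\<Union>n. A n) \<le> (\<Sum>n. hausdorff_outer d (A n))"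
    by (rule order_trans[OF hausdorff_pre_UN])
qed

lemma hausdorff_outer_space: "outer_measure_space (Pow UNIV) (hausdorff_outer d)"
  by (auto simp: outer_measure_space_def positive_def increasing_def countably_subadditive_def
      intro: hausdorff_outer_mono hausdorff_outer_UN)

lemma hausdorff_outer_Un: "hausdorff_outer d (A \<union> B) \<le> hausdorff_outer d A + hausdorff_outer d B"
proof -
  let ?A = "\<lambda>n::nat. if n = 0 then A else if n = 1 then B else {}"
  have "A \<union> B = (\<Union>n. ?A n)"
    by (auto split: if_splits)
  then have "hausdorff_outer d (A \<union> B) \<le> (\<Sum>n. hausdorff_outer d (?A n))"
    using hausdorff_outer_UN[of d ?A] by simp
  also have "\<dots> = (\<Sum>n\<in>{0,1}. hausdorff_outer d (?A n))"
    by (rule suminf_finite) auto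
  finally show ?thesis by simp
qed

lemma hausdorff_outer_eq_SUP_seq:
  "hausdorff_outer d A = (SUP n. hausdorff_pre d (1 / real (Suc n)) A)"
proof (rule antisym)
  show "hausdorff_outer d A \<le> (SUP n. hausdorff_pre d (1 / real (Suc n)) A)"
    unfolding hausdorff_outer_def
  proof (rule SUP_mono)
    fix \<delta> :: real assume "\<delta> \<in> {0<..}"
    then obtain n where "1 / real (Suc n) < \<delta>"
      using reals_Archimedean[of \<delta>] by (auto simp: inverse_eq_divide)
    then show "\<exists>n\<in>UNIV. hausdorff_pre d \<delta> A \<le> hausdorff_pre d (1 / real (Suc n)) A"
      by (intro bexI[of _ n] hausdorff_pre_mono) auto
  qed
qed (auto intro!: SUP_least hausdorff_pre_le_outer)

lemma hausdorff_outer_add_le: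
  fixes A B :: "'a::metric_space set"
  assumes "\<epsilon> > 0" and sep: "\<And>x y. x \<in> A \<Longrightarrow> y \<in> B \<Longrightarrow> \<epsilon> \<le> dist x y"
  shows "hausdorff_outer d A + hausdorff_outer d B \<le> hausdorff_outer d (A \<union> B)"
proof -
  have pre: "hausdorff_pre d \<delta> A + hausdorff_pre d \<delta> B \<le> hausdorff_pre d \<delta> (A \<union> B)"
    if \<delta>: "\<delta> > 0" "\<delta> < \<epsilon>" for \<delta>
  proof (rule hausdorff_pre_greatest)
    fix U :: "nat \<Rightarrow> 'a set"
    assume U: "\<And>i. bounded (U i)" "\<And>i. diameter (U i) \<le> \<delta>" "A \<union> B \<subseteq> (\<Union>i. U i)"
    \<comment> \<open>With \<delta> < \<epsilon> no covering set meets both A and B, so the covering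
      splits into one of A and one of B; the sets left out are replaced by {}, which costs nothing
      as \<open>0 powr d = 0\<close>.\<close>
    define P where "P i = (if U i \<inter> A = {} then {} else U i)" for i
    define Q where "Q i = (if U i \<inter> A = {} then U i else {})" for i
    have "A \<subseteq> (\<Union>i. P i)"
    proof
      fix x assume x: "x \<in> A"
      then obtain i where "x \<in> U i" using U(3) by blast
      with x have "x \<in> P i" by (auto simp: P_def)
      then show "x \<in> (\<Union>i. P i)" by blast
    qed
    then have 1: "hausdorff_pre d \<delta> A \<le> (\<Sum>i. ennreal (diameter (P i) powr d))"
      by (intro hausdorff_pre_lower) (use U \<delta> in \<open>auto simp: P_def\<close>)
    have "B \<subseteq> (\<Union>i. Q i)"
    proof
      fix y assume y: "y \<in> B"
      then obtain i where i: "y \<in> U i" using U(3) by auto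
      have "U i \<inter> A = {}"
      proof (rule ccontr)
        assume "U i \<inter> A \<noteq> {}"
        then obtain x where x: "x \<in> U i" "x \<in> A" by blast
        have "\<epsilon> \<le> \<delta>"
          using sep[OF x(2) y] U(2)[of i] diameter_bounded_bound[OF U(1) x(1) i] by linarith
        with \<delta> show False by simp
      qed
      then have "y \<in> Q i" using i by (simp add: Q_def)
      then show "y \<in> (\<Union>i. Q i)" by blast
    qed
    then have 2: "hausdorff_pre d \<delta> B \<le> (\<Sum>i. ennreal (diameter (Q i) powr d))"
      by (intro hausdorff_pre_lower) (use U \<delta> in \<open>auto simp: Q_def\<close>)
    have "(\<Sum>i. ennreal (diameter (P i) powr d)) + (\<Sum>i. ennreal (diameter (Q i) powr d)) =
        (\<Sum>i. ennreal (diameter (P i) powr d) + ennreal (diameter (Q i) powr d))"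
      by (rule suminf_add) auto
    also have "\<dots> = (\<Sum>i. ennreal (diameter (U i) powr d))"
      by (intro suminf_cong) (auto simp: P_def Q_def)
    finally show "hausdorff_pre d \<delta> A + hausdorff_pre d \<delta> B \<le> (\<Sum>i. ennreal (diameter (U i) powr d))"
      using add_mono[OF 1 2] by simp
  qed
  \<comment> \<open>In \<open>ennreal\<close> suprema add along increasing sequences, hence the
    restriction to the radii \<open>1 / Suc n\<close>.\<close>
  have inc: "incseq (\<lambda>n. hausdorff_pre d (1 / real (Suc n)) A)" for A :: "'a set"
    by (intro incseq_SucI hausdorff_pre_mono) (auto simp: field_simps)
  have "hausdorff_outer d A + hausdorff_outer d B =
      (SUP n. hausdorff_pre d (1 / real (Suc n)) A + hausdorff_pre d (1 / real (Suc n)) B)"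
    unfolding hausdorff_outer_eq_SUP_seq by (rule ennreal_SUP_add[symmetric]) (rule inc)+
  also have "\<dots> \<le> hausdorff_outer d (A \<union> B)"
  proof (rule SUP_least)
    fix n
    let ?\<delta> = "min (1 / real (Suc n)) (\<epsilon> / 2)"
    have "hausdorff_pre d (1 / real (Suc n)) A + hausdorff_pre d (1 / real (Suc n)) B \<le>
        hausdorff_pre d ?\<delta> A + hausdorff_pre d ?\<delta> B"
      by (intro add_mono hausdorff_pre_mono) auto
    also have "\<dots> \<le> hausdorff_pre d ?\<delta> (A \<union> B)"
      using \<open>\<epsilon> > 0\<close> by (intro pre) auto
    also have "\<dots> \<le> hausdorff_outer d (A \<union> B)"
      using \<open>\<epsilon> > 0\<close> by (intro hausdorff_pre_le_outer) auto
    finally show "hausdorff_pre d (1 / real (Suc n)) A + hausdorff_pre d (1 / real (Suc n)) B \<le>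
      hausdorff_outer d (A \<union> B)" .
  qed
  finally show ?thesis .
qed

section \<open>Borel sets are Caratheodory measurable\<close>

lemma infdist_dist_le: "infdist x C \<le> infdist y C + dist x y"
  using infdist_triangle by fast

text \<open>Removes a tail t from an estimate by adding the complementary partial sum s on both
  sides, since subtraction in \<open>ennreal\<close> is unreliable.\<close>

lemma ennreal_add_three_le:
  fixes a :: ennreal
  assumes "a \<le> b + t" "c + b \<le> x" "y = s + t"
  shows "c + a + s \<le> x + y"
proof -
  have "c + a + s \<le> c + (b + t) + s"
    by (intro add_mono assms order_refl)
  also have "\<dots> = (c + b) + (s + t)" by (simp add: ac_simps)
  also have "\<dots> \<le> x + (s + t)" by (intro add_mono assms order_refl)
  finally show ?thesis using assms(3) by simp
qed

text \<open>Caratheodory's argument for metric outer measures. The part of x at distance at least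
  1/(n+1) from C is separated from C; the rest of x - C is a union of shells. Shells of equal index
  parity are separated from each other, so all shells together have outer measure sum at most twice
  that of x, and their tails are negligible.\<close>

lemma hausdorff_outer_split_closed:
  fixes C x :: "'a::metric_space set"
  assumes "closed C" "C \<noteq> {}"
  shows "hausdorff_outer d (x \<inter> C) + hausdorff_outer d (x - C) \<le> hausdorff_outer d x"
proof (cases "hausdorff_outer d x = \<infinity>")
  case False
  let ?H = "hausdorff_outer d"
  define A where "A n = {a\<in>x. 1 / real (Suc n) \<le> infdist a C}" for n
  define D where "D n = {a\<in>x. 1 / real (n + 2) \<le> infdist a C \<and> infdist a C < 1 / real (n + 1)}" for n
  have step: "(\<Sum>k<K. ?H (D (2 * k + j))) \<le> ?H (\<Union>k<K. D (2 * k + j))" for K j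
  proof (induction K)
    case (Suc K)
    have "?H (\<Union>k<K. D (2 * k + j)) + ?H (D (2 * K + j)) \<le> ?H ((\<Union>k<K. D (2 * k + j)) \<union> D (2 * K + j))"
    proof (rule hausdorff_outer_add_le)
      \<comment> \<open>The gap is the width of the shell of index 2K + j - 1, which lies between
        the two sets. For K = 0 the union is empty and any positive number serves.\<close>
      show "0 < (if K = 0 then 1 else 1 / real (2 * K + j) - 1 / real (2 * K + j + 1))"
      proof (cases "K = 0")
        case False
        then have "1 / real (2 * K + j + 1) < 1 / real (2 * K + j)"
          by (intro divide_strict_left_mono) auto
        then show ?thesis using False by simp
      qed simp
      fix a b assume a: "a \<in> (\<Union>k<K. D (2 * k + j))" and b: "b \<in> D (2 * K + j)"
      then obtain k where k: "k < K" "1 / real (2 * k + j + 2) \<le> infdist a C"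
        by (auto simp: D_def)
      have "1 / real (2 * K + j) \<le> 1 / real (2 * k + j + 2)"
        using k(1) by (intro divide_left_mono) auto
      then have "1 / real (2 * K + j) \<le> infdist a C" using k(2) by linarith
      moreover have "infdist b C < 1 / real (2 * K + j + 1)" using b by (auto simp: D_def)
      ultimately show "(if K = 0 then 1 else 1 / real (2 * K + j) - 1 / real (2 * K + j + 1)) \<le> dist a b"
        using infdist_dist_le[of a C b] k(1) by auto
    qed
    also have "(\<Union>k<K. D (2 * k + j)) \<union> D (2 * K + j) = (\<Union>k<Suc K. D (2 * k + j))"
      by (auto simp: lessThan_Suc)
    finally show ?case
      using order_trans[OF add_right_mono[OF Suc.IH, of "?H (D (2 * K + j))"]] by simp
  qed simp
  have par: "(\<Sum>k<n. ?H (D (2 * k + j))) \<le> ?H x" for j n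
    by (rule order_trans[OF step]) (auto intro!: hausdorff_outer_mono simp: D_def)
  have "(\<Sum>k<n. ?H (D k)) \<le> (\<Sum>k<n. ?H (D (2 * k + 0))) + (\<Sum>k<n. ?H (D (2 * k + 1)))" for n
  proof -
    have "(\<Sum>k<n. ?H (D k)) \<le> (\<Sum>k<2 * n. ?H (D k))"
      by (rule sum_mono2) auto
    also have "\<dots> = (\<Sum>k<n. ?H (D (2 * k + 0))) + (\<Sum>k<n. ?H (D (2 * k + 1)))"
      by (induction n) (auto simp: algebra_simps)
    finally show ?thesis .
  qed
  also have "(\<Sum>k<n. ?H (D (2 * k + 0))) + (\<Sum>k<n. ?H (D (2 * k + 1))) \<le> ?H x + ?H x" for n
    by (intro add_mono par)
  finally have "(\<Sum>k. ?H (D k)) \<le> ?H x + ?H x"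
    by (intro suminf_le_const) auto
  then have fin: "(\<Sum>k. ?H (D k)) < \<infinity>"
    using False by (metis ennreal_add_eq_top infinity_ennreal_def less_top order_le_less_trans)
  let ?S = "\<Sum>k. ?H (D k)"
  \<comment> \<open>The shells up to n are added on the left instead of subtracting the tail on the
    right. In the limit the finite total \<open>?S\<close> stands on both sides and cancels.\<close>
  have main: "?H (x \<inter> C) + ?H (x - C) + (\<Sum>k<n. ?H (D k)) \<le> ?H x + ?S" for n
  proof -
    have sub: "x - C \<subseteq> A n \<union> (\<Union>k. D (k + n))"
    proof
      fix a assume a: "a \<in> x - C"
      then have pos: "infdist a C > 0"
        using in_closed_iff_infdist_zero[OF assms, of a] infdist_nonneg[of a C] by force
      show "a \<in> A n \<union> (\<Union>k. D (k + n))"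
      proof (cases "a \<in> A n")
        case False
        define m where "m = (LEAST m. 1 / real (m + 1) \<le> infdist a C)"
        obtain m0 where m0: "1 / real (Suc m0) < infdist a C" using nat_approx_posE[OF pos] .
        have m: "1 / real (m + 1) \<le> infdist a C"
          unfolding m_def by (rule LeastI[of _ m0]) (use m0 in auto)
        have less: "infdist a C < 1 / real (k + 1)" if "k < m" for k
          using not_less_Least[of k "\<lambda>m. 1 / real (m + 1) \<le> infdist a C"] that
          unfolding m_def by auto
        have An: "infdist a C < 1 / real (n + 1)" using False a by (auto simp: A_def)
        have "n < m"
        proof (rule ccontr)
          assume "\<not> n < m"
          then have "1 / real (n + 1) \<le> 1 / real (m + 1)" by (intro divide_left_mono) auto
          then show False using An m by linarith
        qed
        then obtain k where k: "m = k + n + 1" by (metis add.commute add.left_commute less_imp_Suc_add Suc_eq_plus1)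
        have "a \<in> D (k + n)"
          using m less[of "k + n"] a k by (auto simp: D_def add_ac)
        then show ?thesis by auto
      qed simp
    qed
    have "?H (x - C) \<le> ?H (A n) + (\<Sum>k. ?H (D (k + n)))"
      by (rule order_trans[OF hausdorff_outer_mono[OF sub]], rule order_trans[OF hausdorff_outer_Un])
        (intro add_left_mono hausdorff_outer_UN)
    moreover have "?H (x \<inter> C) + ?H (A n) \<le> ?H x"
    proof -
      have "?H (x \<inter> C) + ?H (A n) \<le> ?H ((x \<inter> C) \<union> A n)"
      proof (rule hausdorff_outer_add_le)
        show "1 / real (Suc n) > 0" by simp
        fix a b assume "a \<in> x \<inter> C" "b \<in> A n"
        then show "1 / real (Suc n) \<le> dist a b"
          using infdist_le[of a C b] by (auto simp: A_def dist_commute)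
      qed
      also have "\<dots> \<le> ?H x" by (rule hausdorff_outer_mono) (auto simp: A_def)
      finally show ?thesis .
    qed
    moreover have "?S = (\<Sum>k<n. ?H (D k)) + (\<Sum>k. ?H (D (k + n)))"
      using suminf_offset[of "\<lambda>k. ?H (D k)" n] by (simp add: add.commute)
    ultimately show ?thesis by (rule ennreal_add_three_le)
  qed
  have "(\<lambda>n. ?H (x \<inter> C) + ?H (x - C) + (\<Sum>k<n. ?H (D k))) \<longlonglongrightarrow> ?H (x \<inter> C) + ?H (x - C) + ?S"
    by (intro tendsto_add tendsto_const summable_LIMSEQ) auto
  then have "?H (x \<inter> C) + ?H (x - C) + ?S \<le> ?H x + ?S"
    by (rule LIMSEQ_le_const2) (use main in auto)
  then show ?thesis
    using fin by (auto simp: add.commute[of _ ?S] ennreal_add_left_cancel_le)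
qed simp

lemma borel_subset_lambda_system:
  "sets (borel :: 'a::metric_space measure) \<subseteq> lambda_system UNIV (Pow UNIV) (hausdorff_outer d)"
proof -
  interpret S: sigma_algebra "UNIV :: 'a set" "Pow UNIV" by (rule sigma_algebra_Pow)
  let ?L = "lambda_system (UNIV :: 'a set) (Pow UNIV) (hausdorff_outer d)"
  have "measure_space UNIV ?L (hausdorff_outer d)"
    by (rule S.caratheodory_lemma[OF hausdorff_outer_space])
  then interpret L: sigma_algebra UNIV ?L by (simp add: measure_space_def)
  have "C \<in> ?L" if "closed C" for C
  proof (cases "C = {}")
    case True
    then show ?thesis using L.empty_sets by simp
  next
    case False
    have "hausdorff_outer d (x \<inter> C) + hausdorff_outer d (x - C) = hausdorff_outer d x" for x
    proof (rule antisym)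
      show "hausdorff_outer d (x \<inter> C) + hausdorff_outer d (x - C) \<le> hausdorff_outer d x"
        by (rule hausdorff_outer_split_closed[OF that False])
      have "(x \<inter> C) \<union> (x - C) = x" by auto
      then show "hausdorff_outer d x \<le> hausdorff_outer d (x \<inter> C) + hausdorff_outer d (x - C)"
        using hausdorff_outer_Un[of d "x \<inter> C" "x - C"] by simp
    qed
    then show ?thesis by (subst S.lambda_system_eq) auto
  qed
  then have "sigma_sets UNIV (Collect closed) \<subseteq> ?L"
    by (intro L.sigma_sets_subset) auto
  then show ?thesis
    by (simp add: borel_eq_closed)
qed

lemma measure_space_hausdorff:
  "measure_space UNIV (sets (borel :: 'a::metric_space measure)) (hausdorff_outer d)"
proof -
  interpret S: sigma_algebra "UNIV :: 'a set" "Pow UNIV" by (rule sigma_algebra_Pow)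
  have L: "measure_space UNIV (lambda_system (UNIV :: 'a set) (Pow UNIV) (hausdorff_outer d)) (hausdorff_outer d)"
    by (rule S.caratheodory_lemma[OF hausdorff_outer_space])
  have "sigma_algebra UNIV (sets (borel :: 'a measure))"
    by (metis sets.sigma_algebra_axioms space_borel)
  then show ?thesis
    using L borel_subset_lambda_system[of d]
    by (auto simp: measure_space_def positive_def countably_additive_def)
qed

lemma space_hausdorff_measure [simp]: "space (hausdorff_measure d) = UNIV"
  by (simp add: hausdorff_measure_def space_measure_of_conv)

lemma sets_hausdorff_measure [simp]: "sets (hausdorff_measure d) = sets borel"
proof -
  have "sigma_sets UNIV (sets (borel :: 'a measure)) = sets borel"
    by (metis sets.sigma_sets_eq space_borel)
  then show ?thesis by (simp add: hausdorff_measure_def sets_measure_of_conv)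
qed

lemma emeasure_hausdorff_measure:
  assumes "A \<in> sets borel"
  shows "emeasure (hausdorff_measure d) A = hausdorff_outer d A"
proof -
  have "sigma_algebra UNIV (sets (borel :: 'a measure))"
    by (metis sets.sigma_algebra_axioms space_borel)
  then show ?thesis
    using measure_space_hausdorff[where ?'a = 'a, of d] assms
    by (auto simp: measure_space_def hausdorff_measure_def intro!: emeasure_measure_of_sigma)
qed

section \<open>Lipschitz images\<close>

lemma diameter_le_dist:
  assumes "0 \<le> \<delta>" "\<And>x y. x \<in> S \<Longrightarrow> y \<in> S \<Longrightarrow> dist x y \<le> \<delta>"
  shows "diameter S \<le> \<delta>"
  using assms by (auto simp: diameter_def intro!: cSUP_least)

lemma diameter_Lipschitz_image_le:
  fixes g :: "'a::metric_space \<Rightarrow> 'b::metric_space"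
  assumes g: "\<And>x y. dist (g x) (g y) \<le> L * dist x y" and "L \<ge> 0" and "bounded U"
  shows "bounded (g ` U)" "diameter (g ` U) \<le> L * diameter U"
proof -
  have *: "dist x y \<le> L * diameter U" if "x \<in> g ` U" "y \<in> g ` U" for x y
  proof -
    from that(1) obtain a where a: "a \<in> U" "x = g a" by (rule imageE)
    from that(2) obtain b where b: "b \<in> U" "y = g b" by (rule imageE)
    have "L * dist a b \<le> L * diameter U"
      using diameter_bounded_bound[OF \<open>bounded U\<close> a(1) b(1)] \<open>L \<ge> 0\<close> by (rule mult_left_mono)
    then show ?thesis using g[of a b] a b by simp
  qed
  show b: "bounded (g ` U)"
    unfolding bounded_two_points using * by blast
  have "0 \<le> L * diameter U"
    using \<open>L \<ge> 0\<close> diameter_ge_0[OF \<open>bounded U\<close>] by simp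
  then show "diameter (g ` U) \<le> L * diameter U"
    by (rule diameter_le_dist[OF _ *])
qed

lemma hausdorff_pre_Lipschitz_image:
  fixes g :: "'a::metric_space \<Rightarrow> 'b::metric_space"
  assumes g: "\<And>x y. dist (g x) (g y) \<le> L * dist x y" and L: "L > 0" and d: "d > 0"
  shows "hausdorff_pre d (L * \<delta>) (g ` A) \<le> ennreal (L powr d) * hausdorff_pre d \<delta> A"
proof -
  have *: "hausdorff_pre d (L * \<delta>) (g ` A) \<le> ennreal (L powr d) * (\<Sum>i. ennreal (diameter (U i) powr d))"
    if U: "\<And>i. bounded (U i)" "\<And>i. diameter (U i) \<le> \<delta>" "A \<subseteq> (\<Union>i::nat. U i)" for U
  proof -
    have "hausdorff_pre d (L * \<delta>) (g ` A) \<le> (\<Sum>i. ennreal (diameter (g ` U i) powr d))"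
    proof (rule hausdorff_pre_lower)
      fix i
      show "bounded (g ` U i)"
        using diameter_Lipschitz_image_le(1)[of g L "U i"] g L U by auto
      show "diameter (g ` U i) \<le> L * \<delta>"
        using diameter_Lipschitz_image_le(2)[OF g less_imp_le[OF L] U(1)[of i]]
          mult_left_mono[OF U(2)[of i] less_imp_le[OF L]] by linarith
      show "g ` A \<subseteq> (\<Union>i. g ` U i)" using U(3) by blast
    qed
    also have "\<dots> \<le> (\<Sum>i. ennreal (L powr d) * ennreal (diameter (U i) powr d))"
    proof (intro suminf_le allI)
      fix i
      have "diameter (g ` U i) powr d \<le> (L * diameter (U i)) powr d"
        using diameter_Lipschitz_image_le[of g L "U i"] g L U(1)[of i] d
        by (intro powr_mono2) (auto intro: diameter_ge_0)
      also have "\<dots> = L powr d * diameter (U i) powr d"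
        using L by (simp add: powr_mult diameter_ge_0 U)
      finally show "ennreal (diameter (g ` U i) powr d) \<le> ennreal (L powr d) * ennreal (diameter (U i) powr d)"
        by (simp add: ennreal_mult[symmetric] ennreal_leI)
    qed auto
    finally show ?thesis by simp
  qed
  have pos: "L powr d > 0" using L by simp
  have "hausdorff_pre d (L * \<delta>) (g ` A) / ennreal (L powr d) \<le> hausdorff_pre d \<delta> A"
  proof (rule hausdorff_pre_greatest)
    fix U :: "nat \<Rightarrow> 'a set"
    assume "\<And>i. bounded (U i)" "\<And>i. diameter (U i) \<le> \<delta>" "A \<subseteq> (\<Union>i. U i)"
    from *[OF this] show "hausdorff_pre d (L * \<delta>) (g ` A) / ennreal (L powr d) \<le> (\<Sum>i. ennreal (diameter (U i) powr d))"
      using pos by (subst divide_le_posI_ennreal) (auto simp: mult.commute)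
  qed
  then have "ennreal (L powr d) * (hausdorff_pre d (L * \<delta>) (g ` A) / ennreal (L powr d)) \<le> ennreal (L powr d) * hausdorff_pre d \<delta> A"
    by (rule mult_left_mono) simp
  then show ?thesis
    using pos by (subst (asm) ennreal_times_divide, subst (asm) mult.commute)
      (simp add: mult_divide_eq_ennreal)
qed

lemma hausdorff_outer_Lipschitz_image:
  fixes g :: "'a::metric_space \<Rightarrow> 'b::metric_space"
  assumes g: "\<And>x y. dist (g x) (g y) \<le> L * dist x y" and L: "L > 0" and d: "d > 0"
  shows "hausdorff_outer d (g ` A) \<le> ennreal (L powr d) * hausdorff_outer d A"
  unfolding hausdorff_outer_def[of d "g ` A"]
proof (rule SUP_least)
  fix \<delta> :: real assume \<delta>: "\<delta> \<in> {0<..}"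
  have "hausdorff_pre d (L * (\<delta> / L)) (g ` A) \<le> ennreal (L powr d) * hausdorff_pre d (\<delta> / L) A"
    by (rule hausdorff_pre_Lipschitz_image[OF g L d])
  also have "\<dots> \<le> ennreal (L powr d) * hausdorff_outer d A"
    using \<delta> L by (intro mult_left_mono hausdorff_pre_le_outer) auto
  finally show "hausdorff_pre d \<delta> (g ` A) \<le> ennreal (L powr d) * hausdorff_outer d A"
    using L by simp
qed

section \<open>Two critical points of a concave-convex functional\<close>

lemma abs_powr_mult_self: "\<bar>t\<bar> powr (a - 2) * t * t = \<bar>t\<bar> powr a" for t :: real
proof (cases "t = 0")
  case False
  have "\<bar>t\<bar> powr (a - 2) * t * t = \<bar>t\<bar> powr (a - 2) * \<bar>t\<bar> powr 2"
    using False powr_realpow[of "\<bar>t\<bar>" 2] by (simp add: power2_eq_square mult.assoc)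
  also have "\<dots> = \<bar>t\<bar> powr (a - 2 + 2)" by (rule powr_add[symmetric])
  finally show ?thesis by simp
qed simp

lemma continuous_on_abs_powr:
  assumes "a > 0" "continuous_on S f"
  shows "continuous_on S (\<lambda>x. \<bar>f x :: real\<bar> powr a)"
  by (intro continuous_on_powr' continuous_intros assms) (use assms in auto)

text \<open>For a < 2 the factor \<open>\<bar>t\<bar> powr (a - 2)\<close> blows up at 0; a
  difference of one-sided powers with the positive exponent a - 1 shows the continuity.\<close>

lemma continuous_on_odd_powr:
  assumes "a > 1"
  shows "continuous_on UNIV (\<lambda>t::real. \<bar>t\<bar> powr (a - 2) * t)"
proof -
  have eq: "\<bar>t\<bar> powr (a - 2) * t = (max t 0) powr (a - 1) - (max (- t) 0) powr (a - 1)" for t :: real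
  proof -
    have *: "u powr (a - 2) * u = u powr (a - 1)" if "u > 0" for u :: real
      using that powr_add[of u "a - 2" 1] by simp
    show ?thesis using *[of t] *[of "- t"] by (cases "t > 0"; cases "t < 0") auto
  qed
  show ?thesis unfolding eq
    by (intro continuous_on_diff continuous_on_powr' continuous_intros) (use assms in auto)
qed

lemma has_real_derivative_abs_powr:
  assumes "a > 1"
  shows "((\<lambda>t::real. \<bar>t\<bar> powr a) has_real_derivative a * (\<bar>t\<bar> powr (a - 2) * t)) (at t)"
proof (cases "t = 0")
  case True
  have "((\<lambda>h::real. \<bar>h\<bar> powr (a - 2) * h) \<longlongrightarrow> \<bar>0\<bar> powr (a - 2) * 0) (at 0)"
    using continuous_on_odd_powr[OF assms] unfolding continuous_on_def by blast
  \<comment> \<open>At 0 the difference quotient is the odd power itself, so its continuity gives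
    the derivative.\<close>
  moreover have "\<bar>h\<bar> powr (a - 2) * h = (\<bar>0 + h\<bar> powr a - \<bar>0\<bar> powr a) / h" for h :: real
    using abs_powr_mult_self[of h a] by (cases "h = 0") (simp_all add: eq_divide_eq)
  ultimately have "((\<lambda>h::real. (\<bar>0 + h\<bar> powr a - \<bar>0\<bar> powr a) / h) \<longlongrightarrow> 0) (at 0)"
    by simp
  then show ?thesis using True by (simp add: DERIV_def)
next
  case False
  have eq: "\<bar>t\<bar> powr (a - 1) * sgn t = \<bar>t\<bar> powr (a - 2) * t"
  proof -
    have "\<bar>t\<bar> powr (a - 1) = \<bar>t\<bar> powr (a - 2) * \<bar>t\<bar>"
      using False powr_add[of "\<bar>t\<bar>" "a - 2" 1] by simp
    then show ?thesis by (simp add: sgn_if split: if_splits)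
  qed
  have "((\<lambda>t::real. \<bar>t\<bar> powr a) has_real_derivative a * \<bar>t\<bar> powr (a - 1) * sgn t) (at t)"
  proof (cases "t > 0")
    case True
    have "((\<lambda>t. t powr a) has_real_derivative a * \<bar>t\<bar> powr (a - 1) * sgn t) (at t)"
      using True by (auto intro!: derivative_eq_intros)
    then show ?thesis
      by (rule has_field_derivative_transform_within_open[where S = "{0<..}"]) (use True in auto)
  next
    case neg: False
    have "((\<lambda>t. (- t) powr a) has_real_derivative a * \<bar>t\<bar> powr (a - 1) * sgn t) (at t)"
      using neg False by (auto intro!: derivative_eq_intros)
    then show ?thesis
      by (rule has_field_derivative_transform_within_open[where S = "{..<0}"]) (use neg False in auto)
  qed
  then show ?thesis using eq by (simp add: mult.assoc)
qed

text \<open>Functions live on the whole type and only their values on V matter.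
  \<open>closed_ball\<close> does not presuppose that the limit is in X; together with
  \<open>subseq\<close> it replaces weak compactness of balls in a Hilbert space, and
  \<open>sup_le\<close>, with constant D, lets every integral pass to the limit by bounded
  convergence.\<close>

locale energy_space =
  fixes \<mu> :: "'a::euclidean_space measure" and V :: "'a set" and X :: "('a \<Rightarrow> real) set"
    and B :: "('a \<Rightarrow> real) \<Rightarrow> ('a \<Rightarrow> real) \<Rightarrow> real" and D :: real
  assumes compact_V: "compact V"
    and space_\<mu>: "space \<mu> = V"
    and sets_\<mu>: "sets \<mu> = sets (restrict_space borel V)"
    and emeasure_V: "emeasure \<mu> V = 1"
    and support: "\<And>S. open S \<Longrightarrow> S \<inter> V \<noteq> {} \<Longrightarrow> emeasure \<mu> (S \<inter> V) > 0"
    and X_add: "\<And>u v. u \<in> X \<Longrightarrow> v \<in> X \<Longrightarrow> (\<lambda>x. u x + v x) \<in> X"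
    and X_scale: "\<And>u c. u \<in> X \<Longrightarrow> (\<lambda>x. c * u x) \<in> X"
    and X_cont: "\<And>u. u \<in> X \<Longrightarrow> continuous_on V u"
    and B_sym: "\<And>u v. u \<in> X \<Longrightarrow> v \<in> X \<Longrightarrow> B u v = B v u"
    and B_add: "\<And>u v w. u \<in> X \<Longrightarrow> v \<in> X \<Longrightarrow> w \<in> X \<Longrightarrow> B (\<lambda>x. u x + v x) w = B u w + B v w"
    and B_scale: "\<And>u w c. u \<in> X \<Longrightarrow> w \<in> X \<Longrightarrow> B (\<lambda>x. c * u x) w = c * B u w"
    and B_nonneg: "\<And>u. u \<in> X \<Longrightarrow> 0 \<le> B u u"
    and D_pos: "D > 0"
    and sup_le: "\<And>u x. u \<in> X \<Longrightarrow> x \<in> V \<Longrightarrow> \<bar>u x\<bar> \<le> D * sqrt (B u u)"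
    and closed_ball: "\<And>z w c. (\<And>n::nat. z n \<in> X) \<Longrightarrow> (\<And>n. B (z n) (z n) \<le> c) \<Longrightarrow>
        continuous_on V w \<Longrightarrow> (\<And>x. x \<in> V \<Longrightarrow> (\<lambda>n. z n x) \<longlonglongrightarrow> w x) \<Longrightarrow> w \<in> X \<and> B w w \<le> c"
    and subseq: "\<And>z c. (\<And>n::nat. z n \<in> X) \<Longrightarrow> (\<And>n. B (z n) (z n) \<le> c) \<Longrightarrow>
        \<exists>w k. strict_mono k \<and> continuous_on V w \<and> (\<forall>x\<in>V. (\<lambda>n. z (k n :: nat) x) \<longlonglongrightarrow> w x)"
begin

sublocale finite_measure \<mu>
  by (rule finite_measureI) (simp add: space_\<mu> emeasure_V)

lemma measure_V: "measure \<mu> V = 1"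
  by (simp add: measure_def emeasure_V)

lemma borel_measurable_cont: "continuous_on V f \<Longrightarrow> f \<in> borel_measurable \<mu>" for f :: "'a \<Rightarrow> real"
  by (subst measurable_cong_sets[OF sets_\<mu> refl]) (rule borel_measurable_continuous_on_restrict)

lemma bounded_cont:
  assumes "continuous_on V (f :: 'a \<Rightarrow> real)"
  obtains K where "K > 0" "\<And>x. x \<in> V \<Longrightarrow> \<bar>f x\<bar> \<le> K"
  using compact_imp_bounded[OF compact_continuous_image[OF assms compact_V]]
  by (auto simp: bounded_pos)

lemma integrable_cont:
  assumes "continuous_on V (f :: 'a \<Rightarrow> real)"
  shows "integrable \<mu> f"
proof -
  obtain K where "\<And>x. x \<in> V \<Longrightarrow> \<bar>f x\<bar> \<le> K" using bounded_cont[OF assms] by blast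
  then show ?thesis
    by (intro integrable_const_bound[where B = K] borel_measurable_cont[OF assms])
      (auto simp: space_\<mu>)
qed

lemma integral_tendsto:
  fixes f :: "nat \<Rightarrow> 'a \<Rightarrow> real"
  assumes "\<And>n. continuous_on V (f n)" "continuous_on V g"
    and "\<And>x. x \<in> V \<Longrightarrow> (\<lambda>n. f n x) \<longlonglongrightarrow> g x" "\<And>n x. x \<in> V \<Longrightarrow> \<bar>f n x\<bar> \<le> C"
  shows "(\<lambda>n. \<integral>x. f n x \<partial>\<mu>) \<longlonglongrightarrow> (\<integral>x. g x \<partial>\<mu>)"
  by (rule integral_dominated_convergence[where w = "\<lambda>_. C"])
    (use assms in \<open>auto simp: space_\<mu> intro!: borel_measurable_cont\<close>)

lemma integral_comp_tendsto:
  fixes h :: "real \<Rightarrow> real"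
  assumes h: "continuous_on UNIV h" and v: "continuous_on V v"
    and z: "\<And>n. continuous_on V (z n)" "continuous_on V w"
    and conv: "\<And>x. x \<in> V \<Longrightarrow> (\<lambda>n. z n x) \<longlonglongrightarrow> w x" and bd: "\<And>n x. x \<in> V \<Longrightarrow> \<bar>z n x\<bar> \<le> C"
  shows "(\<lambda>n. \<integral>x. h (z n x) * v x \<partial>\<mu>) \<longlonglongrightarrow> (\<integral>x. h (w x) * v x \<partial>\<mu>)"
proof -
  obtain Kv where Kv: "\<And>x. x \<in> V \<Longrightarrow> \<bar>v x\<bar> \<le> Kv" "Kv > 0" using bounded_cont[OF v] by blast
  have "bounded (h ` {-C..C})"
    by (intro compact_imp_bounded compact_continuous_image continuous_on_subset[OF h]) auto
  then obtain Kh where Kh: "Kh > 0" "\<forall>y\<in>h ` {-C..C}. norm y \<le> Kh"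
    unfolding bounded_pos by blast
  show ?thesis
  proof (rule integral_tendsto[where C = "Kh * Kv"])
    show "continuous_on V (\<lambda>x. h (z n x) * v x)" for n
      by (intro continuous_on_mult v continuous_on_compose2[OF h z(1)]) auto
    show "continuous_on V (\<lambda>x. h (w x) * v x)"
      by (intro continuous_on_mult v continuous_on_compose2[OF h z(2)]) auto
    show "(\<lambda>n. h (z n x) * v x) \<longlonglongrightarrow> h (w x) * v x" if "x \<in> V" for x
      by (intro tendsto_mult tendsto_const continuous_on_tendsto_compose[OF h conv[OF that]]) auto
    show "\<bar>h (z n x) * v x\<bar> \<le> Kh * Kv" if "x \<in> V" for n x
    proof -
      have "z n x \<in> {-C..C}" using bd[OF that, of n] by (simp add: abs_le_iff)
      then have "\<bar>h (z n x)\<bar> \<le> Kh" using Kh(2) by simp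
      then show ?thesis unfolding abs_mult using Kv(1)[OF that] by (intro mult_mono) auto
    qed
  qed
qed

lemma integral_has_derivative:
  fixes \<Phi> :: "real \<Rightarrow> real"
  assumes \<Phi>: "\<And>t. (\<Phi> has_real_derivative \<phi> t) (at t)" and \<phi>: "continuous_on UNIV \<phi>"
    and u: "continuous_on V u" and v: "continuous_on V v"
  shows "((\<lambda>\<epsilon>. \<integral>x. \<Phi> (u x + \<epsilon> * v x) \<partial>\<mu>) has_real_derivative (\<integral>x. \<phi> (u x + e * v x) * v x \<partial>\<mu>)) (at e)"
  unfolding has_field_derivative_iff tendsto_at_iff_sequentially
proof (intro allI impI)
  fix Y :: "nat \<Rightarrow> real" assume Y: "\<forall>i. Y i \<in> UNIV - {e}" and lim: "Y \<longlonglongrightarrow> e"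
  have \<Phi>c: "continuous_on UNIV \<Phi>" using \<Phi> by (meson DERIV_continuous_on has_field_derivative_at_within)
  obtain Ku where Ku: "\<And>x. x \<in> V \<Longrightarrow> \<bar>u x\<bar> \<le> Ku" using bounded_cont[OF u] by blast
  obtain Kv where Kv: "\<And>x. x \<in> V \<Longrightarrow> \<bar>v x\<bar> \<le> Kv" "Kv > 0" using bounded_cont[OF v] by blast
  obtain R where R: "\<And>n. \<bar>Y n\<bar> \<le> R"
    using convergent_imp_Bseq[of Y] lim unfolding Bseq_def convergent_def by auto
  have eR: "\<bar>e\<bar> \<le> R"
    using LIMSEQ_le_const2[OF tendsto_rabs[OF lim], of R] R by auto
  \<comment> \<open>The values \<open>u x + t * v x\<close> with
    \<open>\<bar>t\<bar> \<le> R\<close> fill at most [-C, C]. There \<Phi> is Lipschitz, which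
    dominates all difference quotients at once.\<close>
  define C where "C = Ku + R * Kv"
  have in_C: "u x + t * v x \<in> {-C..C}" if "x \<in> V" "\<bar>t\<bar> \<le> R" for x t
  proof -
    have "\<bar>t * v x\<bar> \<le> R * Kv" unfolding abs_mult using that Kv(1)[OF that(1)] by (intro mult_mono) auto
    then show ?thesis using Ku[OF that(1)] unfolding C_def by (auto simp: abs_le_iff)
  qed
  have "bounded (\<phi> ` {-C..C})"
    by (intro compact_imp_bounded compact_continuous_image continuous_on_subset[OF \<phi>]) auto
  then obtain K where "K > 0" "\<forall>y\<in>\<phi> ` {-C..C}. norm y \<le> K"
    unfolding bounded_pos by blast
  then have K: "\<And>t. t \<in> {-C..C} \<Longrightarrow> norm (\<phi> t) \<le> K" "K > 0" by auto
  have Lip: "\<bar>\<Phi> a - \<Phi> b\<bar> \<le> K * \<bar>a - b\<bar>" if "a \<in> {-C..C}" "b \<in> {-C..C}" for a b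
    using field_differentiable_bound[of "{-C..C}" \<Phi> \<phi> K a b] K \<Phi> that
    by (auto intro: has_field_derivative_at_within)
  define Q where "Q n x = (\<Phi> (u x + Y n * v x) - \<Phi> (u x + e * v x)) / (Y n - e)" for n x
  have Ye: "Y n - e \<noteq> 0" for n using Y by auto
  have cont: "continuous_on V (\<lambda>x. \<Phi> (u x + t * v x))" for t
    by (intro continuous_on_compose2[OF \<Phi>c] continuous_intros u v) auto
  have "(\<lambda>n. \<integral>x. Q n x \<partial>\<mu>) \<longlonglongrightarrow> (\<integral>x. \<phi> (u x + e * v x) * v x \<partial>\<mu>)"
  proof (rule integral_tendsto[where C = "K * Kv"])
    show "continuous_on V (Q n)" for n
      unfolding Q_def by (intro continuous_on_divide continuous_on_diff cont continuous_on_const) (use Ye in auto)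
    show "continuous_on V (\<lambda>x. \<phi> (u x + e * v x) * v x)"
      by (intro continuous_on_mult v continuous_on_compose2[OF \<phi>] continuous_intros u) auto
    show "(\<lambda>n. Q n x) \<longlonglongrightarrow> \<phi> (u x + e * v x) * v x" if "x \<in> V" for x
    proof -
      have "((\<lambda>\<epsilon>. \<Phi> (u x + \<epsilon> * v x)) has_real_derivative \<phi> (u x + e * v x) * v x) (at e)"
        by (rule DERIV_chain2[OF \<Phi>]) (auto intro!: derivative_eq_intros)
      then show ?thesis
        unfolding has_field_derivative_iff tendsto_at_iff_sequentially Q_def
        using Y lim by (auto simp: o_def)
    qed
    show "\<bar>Q n x\<bar> \<le> K * Kv" if "x \<in> V" for n x
    proof -
      have "\<bar>\<Phi> (u x + Y n * v x) - \<Phi> (u x + e * v x)\<bar> \<le> K * \<bar>(u x + Y n * v x) - (u x + e * v x)\<bar>"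
        by (intro Lip in_C that R eR)
      also have "\<dots> = K * \<bar>v x\<bar> * \<bar>Y n - e\<bar>" by (simp add: abs_mult[symmetric] algebra_simps)
      also have "\<dots> \<le> K * Kv * \<bar>Y n - e\<bar>"
        using Kv(1)[OF that] K(2) by (intro mult_right_mono mult_left_mono) auto
      finally show ?thesis using Ye[of n] by (simp add: Q_def abs_divide divide_le_eq)
    qed
  qed
  moreover have "(\<integral>x. Q n x \<partial>\<mu>) = ((\<integral>x. \<Phi> (u x + Y n * v x) \<partial>\<mu>) - (\<integral>x. \<Phi> (u x + e * v x) \<partial>\<mu>)) / (Y n - e)" for n
    unfolding Q_def integral_divide_zero
    by (subst Bochner_Integration.integral_diff[OF integrable_cont[OF cont] integrable_cont[OF cont]]) (rule refl)
  ultimately show "((\<lambda>y. ((\<integral>x. \<Phi> (u x + y * v x) \<partial>\<mu>) - (\<integral>x. \<Phi> (u x + e * v x) \<partial>\<mu>)) / (y - e)) \<circ> Y)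
      \<longlonglongrightarrow> (\<integral>x. \<phi> (u x + e * v x) * v x \<partial>\<mu>)"
    by (simp add: o_def)
qed

lemma B_scale_right: "u \<in> X \<Longrightarrow> w \<in> X \<Longrightarrow> B w (\<lambda>x. c * u x) = c * B w u"
  using B_sym[OF X_scale, of u w c] B_scale[of u w c] B_sym[of u w] by simp

lemma X_lin: "u \<in> X \<Longrightarrow> v \<in> X \<Longrightarrow> (\<lambda>x. u x + c * v x) \<in> X"
  using X_add[of u "\<lambda>x. c * v x"] X_scale by blast

lemma B_lin: "u \<in> X \<Longrightarrow> v \<in> X \<Longrightarrow> w \<in> X \<Longrightarrow> B (\<lambda>x. u x + c * v x) w = B u w + c * B v w"
  using B_add[of u "\<lambda>x. c * v x" w] B_scale[of v w c] X_scale[of v c] by simp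

lemma B_scale2: "u \<in> X \<Longrightarrow> B (\<lambda>x. c * u x) (\<lambda>x. c * u x) = c\<^sup>2 * B u u"
  by (simp add: B_scale B_scale_right X_scale power2_eq_square)

lemma B_expand:
  assumes "u \<in> X" "v \<in> X"
  shows "B (\<lambda>x. u x + c * v x) (\<lambda>x. u x + c * v x) = B u u + 2 * c * B u v + c\<^sup>2 * B v v"
proof -
  let ?z = "\<lambda>x. u x + c * v x"
  have z: "?z \<in> X" by (rule X_lin[OF assms])
  have "B ?z ?z = B u ?z + c * B v ?z" by (rule B_lin[OF assms z])
  also have "B u ?z = B u u + c * B v u" using B_sym[OF assms(1) z] B_lin[OF assms assms(1)] by simp
  also have "B v ?z = B u v + c * B v v" using B_sym[OF assms(2) z] B_lin[OF assms assms(2)] by simp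
  also have "B v u = B u v" by (rule B_sym[OF assms(2,1)])
  finally show ?thesis by (simp add: power2_eq_square algebra_simps)
qed

text \<open>Constant sequences in \<open>closed_ball\<close> give both inequalities: the form cannot
  see values off V.\<close>

lemma B_cong_V:
  assumes "u \<in> X" "w \<in> X" "\<And>x. x \<in> V \<Longrightarrow> u x = w x"
  shows "B u u = B w w"
proof -
  have "B w w \<le> B u u" "B u u \<le> B w w"
    using closed_ball[of "\<lambda>_. u" "B u u" w] closed_ball[of "\<lambda>_. w" "B w w" u] assms X_cont
    by auto
  then show ?thesis by simp
qed

lemma nonzero_on_V:
  assumes "u \<in> X" "B u u > 0"
  shows "\<exists>x\<in>V. u x \<noteq> 0"
proof (rule ccontr)
  assume "\<not> ?thesis"
  then have "B u u = B (\<lambda>x. 0 * u x) (\<lambda>x. 0 * u x)"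
    by (intro B_cong_V X_scale assms) auto
  also have "\<dots> = 0" using B_scale2[OF assms(1), of 0] by simp
  finally show False using assms(2) by simp
qed

lemma B_pos: "u \<in> X \<Longrightarrow> x \<in> V \<Longrightarrow> u x \<noteq> 0 \<Longrightarrow> B u u > 0"
  using sup_le[of u x] B_nonneg[of u] by (cases "B u u = 0") auto

section \<open>Power integrals\<close>

definition Pw :: "real \<Rightarrow> ('a \<Rightarrow> real) \<Rightarrow> real" where
  "Pw a u = (\<integral>x. \<bar>u x\<bar> powr a \<partial>\<mu>)"

lemma Pw_nonneg: "0 \<le> Pw a u"
  unfolding Pw_def by (intro Bochner_Integration.integral_nonneg) auto

lemma Pw_scale: "Pw a (\<lambda>x. c * u x) = \<bar>c\<bar> powr a * Pw a u"
  unfolding Pw_def by (simp add: abs_mult powr_mult)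

lemma Pw_le:
  assumes "u \<in> X" "a > 0"
  shows "Pw a u \<le> (D * sqrt (B u u)) powr a"
proof -
  have "Pw a u \<le> (\<integral>x. (D * sqrt (B u u)) powr a \<partial>\<mu>)"
    unfolding Pw_def
  proof (rule integral_mono)
    show "integrable \<mu> (\<lambda>x. \<bar>u x\<bar> powr a)"
      by (intro integrable_cont continuous_on_abs_powr X_cont assms)
    show "\<bar>u x\<bar> powr a \<le> (D * sqrt (B u u)) powr a" if "x \<in> space \<mu>" for x
      using sup_le[OF assms(1)] that assms(2) by (intro powr_mono2) (auto simp: space_\<mu>)
  qed auto
  then show ?thesis by (simp add: space_\<mu> measure_V)
qed

text \<open>A continuous function that is nonzero somewhere on V is nonzero on a relatively open
  set, which has positive measure by \<open>support\<close>.\<close>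

lemma Pw_pos:
  assumes "continuous_on V u" "x \<in> V" "u x \<noteq> 0" "a > 0"
  shows "Pw a u > 0"
proof (rule ccontr)
  assume "\<not> Pw a u > 0"
  then have 0: "(\<integral>x. \<bar>u x\<bar> powr a \<partial>\<mu>) = 0" using Pw_nonneg[of a u] unfolding Pw_def by linarith
  have int: "integrable \<mu> (\<lambda>x. \<bar>u x\<bar> powr a)"
    by (intro integrable_cont continuous_on_abs_powr assms)
  have ae: "AE x in \<mu>. \<bar>u x\<bar> powr a = 0"
    using 0 integral_nonneg_eq_0_iff_AE[OF int] by auto
  obtain S where S: "open S" "S \<inter> V = u -` (- {0}) \<inter> V"
    using continuous_on_open_invariant[of V u] assms(1) by (metis open_Compl closed_singleton)
  have "x \<in> S \<inter> V" unfolding S(2) using assms by simp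
  then have pos: "emeasure \<mu> (S \<inter> V) > 0" using support[OF S(1)] by blast
  have meas: "S \<inter> V \<in> sets \<mu>"
    unfolding sets_\<mu> sets_restrict_space using S(1) by (intro image_eqI[of _ _ S]) auto
  have "AE x in \<mu>. x \<notin> S \<inter> V"
    using ae
  proof (rule AE_mp, intro AE_I2 impI notI)
    fix y assume "\<bar>u y\<bar> powr a = 0" "y \<in> S \<inter> V"
    moreover have "y \<in> u -` (- {0})" using \<open>y \<in> S \<inter> V\<close> S(2) by blast
    ultimately show False by simp
  qed
  then have "emeasure \<mu> (S \<inter> V) = 0"
    using AE_iff_null_sets[OF meas] by blast
  with pos show False by simp
qed

end

section \<open>The functional along rays\<close>

lemma powr_minus2_mult_square: "x > 0 \<Longrightarrow> x powr (a - 2) * x\<^sup>2 = x powr a" for x :: real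
  using abs_powr_mult_self[of x a] by (simp add: power2_eq_square mult.assoc)

text \<open>On the sphere of radius \<rho>, \<open>small_\<rho>\<close> and the bound 1/4 in
  \<open>small_lam\<close> let the q-term and the s-term use up at most a quarter of the energy
  each. The second bound in \<open>small_lam\<close> makes the fibre maps decreasing beyond the
  sphere. Neither mentions \<open>eta\<close>.\<close>

locale concave_convex = energy_space +
  fixes r s q lam eta \<rho> :: real
  assumes r1: "1 < r" and rs: "r < s" and s2: "s < 2" and q2: "2 < q"
    and lam0: "0 \<le> lam" and eta0: "0 \<le> eta" and \<rho>0: "0 < \<rho>"
    and small_\<rho>: "D powr q * \<rho> powr (q - 2) \<le> 1 / 4"
    and small_lam: "lam * (D powr s * \<rho> powr (s - 2)) \<le> min (1 / 4) ((q - 2) / (2 * (q - s)))"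
begin

definition h :: "real \<Rightarrow> real" where
  "h t = lam * (\<bar>t\<bar> powr (s - 2) * t) - eta * (\<bar>t\<bar> powr (r - 2) * t) + \<bar>t\<bar> powr (q - 2) * t"

definition F :: "real \<Rightarrow> real" where
  "F t = lam / s * \<bar>t\<bar> powr s - eta / r * \<bar>t\<bar> powr r + 1 / q * \<bar>t\<bar> powr q"

definition I :: "('a \<Rightarrow> real) \<Rightarrow> real" where
  "I u = B u u / 2 - (\<integral>x. F (u x) \<partial>\<mu>)"

definition N :: "('a \<Rightarrow> real) \<Rightarrow> real" where
  "N u = (\<integral>x. h (u x) * u x \<partial>\<mu>)"

definition critical :: "('a \<Rightarrow> real) \<Rightarrow> bool" where
  "critical u \<longleftrightarrow> u \<in> X \<and> (\<forall>v\<in>X. B u v = (\<integral>x. h (u x) * v x \<partial>\<mu>))"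

lemma h_cont: "continuous_on UNIV h"
  unfolding h_def
  by (intro continuous_on_add continuous_on_diff continuous_on_mult[OF continuous_on_const]
      continuous_on_odd_powr) (use r1 rs s2 q2 in linarith)+

lemma F_deriv: "(F has_real_derivative h t) (at t)"
proof -
  have s1: "1 < s" and q1: "1 < q" using r1 rs q2 by auto
  show ?thesis
    unfolding F_def[abs_def] h_def
    by (rule DERIV_cong[OF DERIV_add[OF DERIV_diff[OF
          DERIV_cmult[OF has_real_derivative_abs_powr[OF s1]]
          DERIV_cmult[OF has_real_derivative_abs_powr[OF r1]]]
          DERIV_cmult[OF has_real_derivative_abs_powr[OF q1]]]])
      (use r1 s1 q1 in simp)
qed

lemma F_cont: "continuous_on UNIV F"
  by (rule DERIV_continuous_on[of _ _ h]) (rule has_field_derivative_at_within[OF F_deriv])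

lemma integrable_powr: "u \<in> X \<Longrightarrow> 0 < a \<Longrightarrow> integrable \<mu> (\<lambda>x. \<bar>u x\<bar> powr a)"
  by (intro integrable_cont continuous_on_abs_powr X_cont)

lemma integral_F: "u \<in> X \<Longrightarrow> (\<integral>x. F (u x) \<partial>\<mu>) = lam / s * Pw s u - eta / r * Pw r u + 1 / q * Pw q u"
proof -
  assume u: "u \<in> X"
  have i: "integrable \<mu> (\<lambda>x. c * \<bar>u x\<bar> powr a)" if "a > 0" for a c
    using integrable_powr[OF u that] by simp
  show ?thesis
    unfolding F_def Pw_def using r1 rs s2 q2
    by (subst Bochner_Integration.integral_add Bochner_Integration.integral_diff,
        (intro Bochner_Integration.integrable_diff i; linarith)+,
        subst Bochner_Integration.integral_diff, (intro i; linarith)+, simp)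
qed

lemma I_eq: "u \<in> X \<Longrightarrow> I u = B u u / 2 - lam / s * Pw s u + eta / r * Pw r u - Pw q u / q"
  by (simp add: I_def integral_F)

lemma N_eq: "u \<in> X \<Longrightarrow> N u = lam * Pw s u - eta * Pw r u + Pw q u"
proof -
  assume u: "u \<in> X"
  have "h t * t = lam * \<bar>t\<bar> powr s - eta * \<bar>t\<bar> powr r + \<bar>t\<bar> powr q" for t
    unfolding h_def using abs_powr_mult_self[of t s] abs_powr_mult_self[of t r] abs_powr_mult_self[of t q]
    by (simp add: left_diff_distrib distrib_right mult.assoc)
  then have "N u = (\<integral>x. lam * \<bar>u x\<bar> powr s - eta * \<bar>u x\<bar> powr r + \<bar>u x\<bar> powr q \<partial>\<mu>)"
    unfolding N_def by simp
  moreover have i: "integrable \<mu> (\<lambda>x. c * \<bar>u x\<bar> powr a)" "integrable \<mu> (\<lambda>x. \<bar>u x\<bar> powr a)" if "a > 0" for a c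
    using integrable_powr[OF u that] by simp_all
  ultimately show ?thesis
    unfolding Pw_def using r1 rs s2 q2
    by (simp only:, subst Bochner_Integration.integral_add,
        (intro Bochner_Integration.integrable_diff i; linarith)+,
        subst Bochner_Integration.integral_diff, (intro i; linarith)+, simp)
qed

lemma I_scale:
  assumes "u \<in> X" "t > 0"
  shows "I (\<lambda>x. t * u x) =
    t\<^sup>2 * B u u / 2 - lam / s * (t powr s * Pw s u) + eta / r * (t powr r * Pw r u) - t powr q * Pw q u / q"
  using assms by (simp add: I_eq X_scale B_scale2 Pw_scale)

lemma N_scale:
  assumes "u \<in> X" "t > 0"
  shows "N (\<lambda>x. t * u x) = lam * (t powr s * Pw s u) - eta * (t powr r * Pw r u) + t powr q * Pw q u"
  using assms by (simp add: N_eq X_scale Pw_scale)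

text \<open>The exponent s - 2 is negative, so the smallness of \<open>lam\<close> imposed at radius
  \<rho> is inherited by every larger radius.\<close>

lemma lam_Pw_le:
  assumes u: "u \<in> X" and B: "B u u \<ge> \<rho>\<^sup>2"
  shows "lam * Pw s u \<le> 1 / 4 * B u u" "lam * (q - s) * Pw s u \<le> (q - 2) / 2 * B u u"
proof -
  define a where "a = sqrt (B u u)"
  have "sqrt (B u u) > 0" using real_le_rsqrt[OF B] \<rho>0 by linarith
  then have a: "\<rho> \<le> a" "a\<^sup>2 = B u u" "a > 0"
    using real_le_rsqrt[OF B] \<rho>0 B_nonneg[OF u] unfolding a_def by auto
  have "Pw s u \<le> (D * a) powr s" using Pw_le[OF u, of s] r1 rs by (simp add: a_def)
  also have "\<dots> = D powr s * (a powr (s - 2) * a\<^sup>2)"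
    using D_pos a(3) powr_minus2_mult_square[OF a(3), of s] by (simp add: powr_mult)
  also have "\<dots> \<le> D powr s * (\<rho> powr (s - 2) * a\<^sup>2)"
    using a(1,3) \<rho>0 s2 by (intro mult_left_mono mult_right_mono powr_mono2') auto
  also have "\<dots> = D powr s * \<rho> powr (s - 2) * B u u" using a by simp
  finally have "lam * Pw s u \<le> lam * (D powr s * \<rho> powr (s - 2)) * B u u"
    using lam0 by (simp add: mult.assoc mult_left_mono)
  also have "\<dots> \<le> min (1 / 4) ((q - 2) / (2 * (q - s))) * B u u"
    by (intro mult_right_mono small_lam B_nonneg u)
  finally have *: "lam * Pw s u \<le> min (1 / 4) ((q - 2) / (2 * (q - s))) * B u u" .
  also have "\<dots> \<le> 1 / 4 * B u u" by (intro mult_right_mono B_nonneg u min.cobounded1)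
  finally show "lam * Pw s u \<le> 1 / 4 * B u u" .
  have "lam * Pw s u \<le> (q - 2) / (2 * (q - s)) * B u u"
    by (rule order_trans[OF *]) (intro mult_right_mono B_nonneg u min.cobounded2)
  then have "(q - s) * (lam * Pw s u) \<le> (q - s) * ((q - 2) / (2 * (q - s)) * B u u)"
    using s2 q2 by (intro mult_left_mono) auto
  also have "\<dots> = (q - 2) / 2 * B u u" using s2 q2 by (simp add: field_simps)
  finally show "lam * (q - s) * Pw s u \<le> (q - 2) / 2 * B u u" by (simp add: mult_ac)
qed

text \<open>Two quarters of the energy bound the s-term and the q-term, and the \<open>eta\<close>
  term only lowers N.\<close>

lemma N_less_sphere:
  assumes u: "u \<in> X" and B: "B u u = \<rho>\<^sup>2"
  shows "N u < B u u"
proof -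
  have "Pw q u \<le> (D * \<rho>) powr q" using Pw_le[OF u, of q] q2 B \<rho>0 by simp
  also have "\<dots> = D powr q * \<rho> powr (q - 2) * \<rho>\<^sup>2"
    using D_pos \<rho>0 powr_minus2_mult_square[OF \<rho>0, of q] by (simp add: powr_mult)
  also have "\<dots> \<le> 1 / 4 * \<rho>\<^sup>2" by (intro mult_right_mono small_\<rho>) auto
  finally have "Pw q u \<le> 1 / 4 * \<rho>\<^sup>2" .
  moreover have "lam * Pw s u \<le> 1 / 4 * \<rho>\<^sup>2" using lam_Pw_le(1)[OF u] B by simp
  moreover have "eta * Pw r u \<ge> 0" using eta0 Pw_nonneg by simp
  moreover have "\<rho>\<^sup>2 > 0" using \<rho>0 by simp
  ultimately show ?thesis unfolding N_eq[OF u] B by linarith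
qed

text \<open>The derivative of \<open>t \<mapsto> I (t u)\<close> divided by \<open>t powr (q - 1)\<close>, which makes it strictly
  decreasing outside the ball of radius \<open>\<rho>\<close> whatever the value of \<open>eta \<ge> 0\<close>.\<close>

definition fibre :: "('a \<Rightarrow> real) \<Rightarrow> real \<Rightarrow> real" where
  "fibre u t = t powr (2 - q) * B u u - lam * (t powr (s - q) * Pw s u)
     + eta * (t powr (r - q) * Pw r u) - Pw q u"

lemma fibre_eq:
  assumes "u \<in> X" "t > 0"
  shows "t powr q * fibre u t = B (\<lambda>x. t * u x) (\<lambda>x. t * u x) - N (\<lambda>x. t * u x)"
proof -
  have "t powr q * t powr (2 - q) = t\<^sup>2" "t powr q * t powr (s - q) = t powr s"
      "t powr q * t powr (r - q) = t powr r"
    using assms(2) by (simp_all flip: powr_add)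
  moreover have "t powr q * fibre u t = (t powr q * t powr (2 - q)) * B u u
      - lam * ((t powr q * t powr (s - q)) * Pw s u)
      + eta * ((t powr q * t powr (r - q)) * Pw r u) - t powr q * Pw q u"
    unfolding fibre_def by (simp add: algebra_simps)
  ultimately have "t powr q * fibre u t = t\<^sup>2 * B u u - lam * (t powr s * Pw s u)
      + eta * (t powr r * Pw r u) - t powr q * Pw q u" by simp
  then show ?thesis using assms by (simp add: N_scale B_scale2)
qed

lemma fibre_sgn:
  assumes "u \<in> X" "t > 0"
  shows "fibre u t > 0 \<longleftrightarrow> N (\<lambda>x. t * u x) < B (\<lambda>x. t * u x) (\<lambda>x. t * u x)"
    and "fibre u t < 0 \<longleftrightarrow> B (\<lambda>x. t * u x) (\<lambda>x. t * u x) < N (\<lambda>x. t * u x)"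
    and "fibre u t = 0 \<longleftrightarrow> N (\<lambda>x. t * u x) = B (\<lambda>x. t * u x) (\<lambda>x. t * u x)"
proof -
  have "t powr q > 0" using assms by simp
  then show "fibre u t > 0 \<longleftrightarrow> N (\<lambda>x. t * u x) < B (\<lambda>x. t * u x) (\<lambda>x. t * u x)"
    "fibre u t < 0 \<longleftrightarrow> B (\<lambda>x. t * u x) (\<lambda>x. t * u x) < N (\<lambda>x. t * u x)"
    "fibre u t = 0 \<longleftrightarrow> N (\<lambda>x. t * u x) = B (\<lambda>x. t * u x) (\<lambda>x. t * u x)"
    using fibre_eq[OF assms]
    by (metis diff_gt_0_iff_gt zero_less_mult_pos mult_pos_pos, metis diff_less_0_iff_less mult_less_0_iff order_less_asym,
        metis eq_iff_diff_eq_0 less_irrefl mult_eq_0_iff)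
qed

lemma I_deriv_scale:
  assumes "u \<in> X" "t > 0"
  shows "((\<lambda>t. I (\<lambda>x. t * u x)) has_real_derivative t powr (q - 1) * fibre u t) (at t)"
proof -
  let ?f = "\<lambda>t. t\<^sup>2 * B u u / 2 - lam / s * (t powr s * Pw s u) + eta / r * (t powr r * Pw r u) - t powr q * Pw q u / q"
  have p: "t powr (q - 1) * t powr (2 - q) = t" "t powr (q - 1) * t powr (s - q) = t powr (s - 1)"
      "t powr (q - 1) * t powr (r - q) = t powr (r - 1)"
    using assms(2) by (simp_all flip: powr_add)
  have "(?f has_real_derivative (t * B u u - lam * (t powr (s - 1) * Pw s u)
      + eta * (t powr (r - 1) * Pw r u) - t powr (q - 1) * Pw q u)) (at t)"
    using assms r1 rs s2 q2 by (auto intro!: derivative_eq_intros simp: field_simps)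
  also have "t * B u u - lam * (t powr (s - 1) * Pw s u)
      + eta * (t powr (r - 1) * Pw r u) - t powr (q - 1) * Pw q u = t powr (q - 1) * fibre u t"
  proof -
    have "t powr (q - 1) * fibre u t = (t powr (q - 1) * t powr (2 - q)) * B u u
      - lam * ((t powr (q - 1) * t powr (s - q)) * Pw s u)
      + eta * ((t powr (q - 1) * t powr (r - q)) * Pw r u) - t powr (q - 1) * Pw q u"
      unfolding fibre_def by (simp add: algebra_simps)
    then show ?thesis unfolding p by simp
  qed
  finally show ?thesis
  proof (rule has_field_derivative_transform_within_open[where S = "{0<..}"])
    fix t :: real assume "t \<in> {0<..}"
    then show "?f t = I (\<lambda>x. t * u x)" using I_scale[OF assms(1)] by auto
  qed (use assms in auto)
qed

text \<open>Multiplied by \<open>t powr (q + 1)\<close>, the derivative is - (q - 2) times the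
  energy of t u, plus an s-term of which \<open>lam_Pw_le\<close> shows that it is at most half as
  large, minus a nonnegative \<open>eta\<close> term, as r < q.\<close>

lemma fibre_deriv_neg:
  assumes u: "u \<in> X" and t: "t > 0" and B: "t\<^sup>2 * B u u \<ge> \<rho>\<^sup>2"
  shows "\<exists>y. (fibre u has_real_derivative y) (at t) \<and> y < 0"
proof -
  define y where "y = (2 - q) * t powr (1 - q) * B u u - lam * ((s - q) * t powr (s - q - 1) * Pw s u)
      + eta * ((r - q) * t powr (r - q - 1) * Pw r u)"
  have "(fibre u has_real_derivative y) (at t)"
    unfolding fibre_def y_def using t by (auto intro!: derivative_eq_intros)
  moreover have "y < 0"
  proof -
    have p: "t powr (q + 1) * t powr (1 - q) = t\<^sup>2" "t powr (q + 1) * t powr (s - q - 1) = t powr s"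
      "t powr (q + 1) * t powr (r - q - 1) = t powr r"
      using t by (simp_all flip: powr_add)
    have "t powr (q + 1) * y = - (q - 2) * (t powr (q + 1) * t powr (1 - q) * B u u)
        + lam * (q - s) * (t powr (q + 1) * t powr (s - q - 1) * Pw s u)
        - eta * (q - r) * (t powr (q + 1) * t powr (r - q - 1) * Pw r u)"
      unfolding y_def by (simp add: algebra_simps)
    also have "\<dots> = - (q - 2) * (t\<^sup>2 * B u u) + lam * (q - s) * (t powr s * Pw s u) - eta * (q - r) * (t powr r * Pw r u)"
      unfolding p ..
    also have "\<dots> < 0"
    proof -
      have "lam * (q - s) * Pw s (\<lambda>x. t * u x) \<le> (q - 2) / 2 * B (\<lambda>x. t * u x) (\<lambda>x. t * u x)"
        using B by (intro lam_Pw_le X_scale u) (simp add: B_scale2[OF u])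
      then have "lam * (q - s) * (t powr s * Pw s u) \<le> (q - 2) / 2 * (t\<^sup>2 * B u u)"
        using t by (simp add: Pw_scale B_scale2[OF u])
      moreover have "eta * (q - r) * (t powr r * Pw r u) \<ge> 0"
        using eta0 q2 s2 rs Pw_nonneg by simp
      moreover have "(q - 2) * (t\<^sup>2 * B u u) > 0"
      proof -
        have "0 < \<rho>\<^sup>2" using \<rho>0 by simp
        then show ?thesis using B q2 mult_pos_pos[of "q - 2" "t\<^sup>2 * B u u"] by linarith
      qed
      ultimately show ?thesis by (simp add: field_simps)
    qed
    finally show ?thesis using t by (simp add: mult_less_0_iff)
  qed
  ultimately show ?thesis by blast
qed

lemma fibre_anti:
  assumes u: "u \<in> X" and t: "0 < t" "t < t'" and B: "t\<^sup>2 * B u u \<ge> \<rho>\<^sup>2"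
  shows "fibre u t' < fibre u t"
proof (rule DERIV_neg_imp_decreasing[OF t(2)])
  fix x assume x: "t \<le> x" "x \<le> t'"
  have "t\<^sup>2 * B u u \<le> x\<^sup>2 * B u u" using x t B_nonneg[OF u] by (intro mult_right_mono power_mono) auto
  then show "\<exists>y. (fibre u has_real_derivative y) (at x) \<and> y < 0"
    using x t B by (intro fibre_deriv_neg u) auto
qed

text \<open>The part of the Nehari set that lies on or outside the sphere. Critical points inside
  the ball are excluded on purpose: on this part \<open>fibre\<close> is monotone.\<close>

definition M :: "('a \<Rightarrow> real) set" where
  "M = {w \<in> X. B w w \<ge> \<rho>\<^sup>2 \<and> N w = B w w}"

lemma M_strict: "w \<in> M \<Longrightarrow> B w w > \<rho>\<^sup>2"
  using N_less_sphere[of w] by (force simp: M_def)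

lemma M_fibre: "w \<in> M \<Longrightarrow> fibre w 1 = 0"
  using fibre_sgn(3)[of w 1] by (simp add: M_def)

text \<open>The fibre map of w vanishes at 1 and is strictly decreasing from the sphere outwards;
  its sign is that of the derivative of I along the ray.\<close>

lemma M_ray:
  assumes w: "w \<in> M" and t: "t > 0" "t\<^sup>2 * B w w \<ge> \<rho>\<^sup>2"
  shows "I (\<lambda>x. t * w x) \<le> I w" and "t < 1 \<Longrightarrow> fibre w t > 0" and "t > 1 \<Longrightarrow> fibre w t < 0"
proof -
  have X: "w \<in> X" and B1: "B w w \<ge> \<rho>\<^sup>2" using w by (auto simp: M_def)
  have mono: "x\<^sup>2 * B w w \<ge> \<rho>\<^sup>2" if "t \<le> x" for x
  proof -
    have "t\<^sup>2 * B w w \<le> x\<^sup>2 * B w w" using that t B_nonneg[OF X] by (intro mult_right_mono power_mono) auto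
    then show ?thesis using t by simp
  qed
  have lt: "fibre w x > 0" if "t \<le> x" "x < 1" for x
    using fibre_anti[OF X _ that(2)] mono[OF that(1)] that t M_fibre[OF w] by simp
  have gt: "fibre w x < 0" if "x > 1" for x
    using fibre_anti[OF X _ that] B1 M_fibre[OF w] by simp
  show "t < 1 \<Longrightarrow> fibre w t > 0" "t > 1 \<Longrightarrow> fibre w t < 0" using lt gt by auto
  have D: "((\<lambda>t. I (\<lambda>x. t * w x)) has_real_derivative x powr (q - 1) * fibre w x) (at x)" if "x > 0" for x
    using I_deriv_scale[OF X that] .
  consider "t = 1" | "t < 1" | "t > 1" by linarith
  then show "I (\<lambda>x. t * w x) \<le> I w"
  proof cases
    case 2
    have "I (\<lambda>x. t * w x) \<le> I (\<lambda>x. 1 * w x)"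
    proof (rule DERIV_nonneg_imp_nondecreasing[of t 1 "\<lambda>t. I (\<lambda>x. t * w x)"])
      fix x assume x: "t \<le> x" "x \<le> 1"
      have "fibre w x \<ge> 0" using lt[OF x(1)] M_fibre[OF w] x(2) by (cases "x = 1") auto
      then show "\<exists>y. ((\<lambda>t. I (\<lambda>x. t * w x)) has_real_derivative y) (at x) \<and> 0 \<le> y"
        using D[of x] x t by (intro exI[of _ "x powr (q - 1) * fibre w x"]) auto
    qed (use 2 in auto)
    then show ?thesis by simp
  next
    case 3
    have "I (\<lambda>x. 1 * w x) \<ge> I (\<lambda>x. t * w x)"
    proof (rule DERIV_nonpos_imp_nonincreasing[of 1 t "\<lambda>t. I (\<lambda>x. t * w x)"])
      fix x assume x: "1 \<le> x" "x \<le> t"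
      have "fibre w x \<le> 0" using gt[of x] M_fibre[OF w] x(1) by (cases "x = 1") auto
      then show "\<exists>y. ((\<lambda>t. I (\<lambda>x. t * w x)) has_real_derivative y) (at x) \<and> y \<le> 0"
        using D[of x] x t by (intro exI[of _ "x powr (q - 1) * fibre w x"]) (auto simp: mult_le_0_iff)
    qed (use 3 in auto)
    then show ?thesis by simp
  qed simp
qed

lemma fibre_cont: "continuous_on {0<..} (fibre u)"
  unfolding fibre_def by (intro continuous_intros) auto

lemma ray_exists:
  assumes w: "w \<in> X" and Bw: "B w w > 0"
  obtains t where "t > 0" "(\<lambda>x. t * w x) \<in> M"
proof -
  obtain x where x: "x \<in> V" "w x \<noteq> 0" using nonzero_on_V[OF w Bw] by blast
  have d: "Pw q w > 0" using Pw_pos[OF X_cont[OF w] x] q2 by simp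
  define t0 where "t0 = \<rho> / sqrt (B w w)"
  have t0: "t0 > 0" "t0\<^sup>2 * B w w = \<rho>\<^sup>2" using \<rho>0 Bw by (auto simp: t0_def power_divide)
  have B0: "B (\<lambda>x. t0 * w x) (\<lambda>x. t0 * w x) = \<rho>\<^sup>2" using B_scale2[OF w] t0 by simp
  have pos: "fibre w t0 > 0"
    unfolding fibre_sgn(1)[OF w t0(1)] using N_less_sphere[OF X_scale[OF w] B0] .
  \<comment> \<open>All powers of t in \<open>fibre\<close> have negative exponents, so only
    \<open>- Pw q w\<close> survives; it is negative since w does not vanish on V.\<close>
  have "((\<lambda>t. fibre w t) \<longlongrightarrow> 0 * B w w - lam * (0 * Pw s w) + eta * (0 * Pw r w) - Pw q w) at_top"
    unfolding fibre_def using q2 s2 rs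
    by (intro tendsto_intros tendsto_neg_powr filterlim_ident) auto
  then have "eventually (\<lambda>t. fibre w t < 0) at_top"
    using d by (intro order_tendstoD(2)) auto
  then obtain T0 where T0: "\<And>t. t \<ge> T0 \<Longrightarrow> fibre w t < 0"
    unfolding eventually_at_top_linorder by blast
  define T where "T = max T0 t0"
  have "\<exists>t\<ge>t0. t \<le> T \<and> fibre w t = 0"
    using pos T0[of T] t0(1)
    by (intro IVT2' continuous_on_subset[OF fibre_cont]) (auto simp: T_def)
  then obtain t where t: "t \<ge> t0" "fibre w t = 0" by blast
  have "t > 0" using t t0 by simp
  moreover have "t0\<^sup>2 * B w w \<le> t\<^sup>2 * B w w" using t t0 Bw by (intro mult_right_mono power_mono) auto
  ultimately have "(\<lambda>x. t * w x) \<in> M"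
    using fibre_sgn(3)[OF w, of t] t t0 w by (auto simp: M_def X_scale B_scale2)
  with \<open>t > 0\<close> show ?thesis by (rule that)
qed

text \<open>Elimination of the q-term on \<open>M\<close> leaves the factor (q - 2) / (2q), and the
  bound of \<open>lam_Pw_le\<close> on the s-term takes away the fraction 1/s of it.\<close>

definition \<kappa> :: real where "\<kappa> = (q - 2) / (2 * q) * (1 - 1 / s)"

lemma \<kappa>_pos: "\<kappa> > 0" using r1 rs s2 q2 by (simp add: \<kappa>_def)

lemma M_coercive:
  assumes "w \<in> M"
  shows "I w \<ge> \<kappa> * B w w"
proof -
  have X: "w \<in> X" and BM: "B w w \<ge> \<rho>\<^sup>2" and NM: "N w = B w w" using assms by (auto simp: M_def)
  define a b c d where "a = B w w" and "b = lam * Pw s w" and "c = eta * Pw r w" and "d = Pw q w"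
  have c0: "c \<ge> 0" using eta0 Pw_nonneg by (simp add: c_def)
  have a: "d = a - b + c" using NM N_eq[OF X] by (simp add: a_def b_def c_def d_def)
  have b: "(q - s) * b \<le> (q - 2) / 2 * a"
    using lam_Pw_le(2)[OF X BM] by (simp add: a_def b_def mult_ac)
  have "I w = a / 2 - b / s + c / r - d / q"
    by (simp add: I_eq[OF X] a_def b_def c_def d_def)
  also have "\<dots> = (q - 2) / (2 * q) * a - (q - s) * b / (s * q) + c * (1 / r - 1 / q)"
    unfolding a using r1 rs q2 by (simp add: field_simps)
  also have "\<dots> \<ge> (q - 2) / (2 * q) * a - ((q - 2) / 2 * a) / (s * q) + 0"
    using b r1 rs s2 q2 c0 by (intro add_mono diff_left_mono divide_right_mono mult_nonneg_nonneg) (auto simp: field_simps)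
  finally have "I w \<ge> (q - 2) / (2 * q) * a - ((q - 2) / 2 * a) / (s * q)" by simp
  also have "(q - 2) / (2 * q) * a - ((q - 2) / 2 * a) / (s * q) = \<kappa> * a"
    using r1 rs q2 by (simp add: \<kappa>_def field_simps)
  finally show ?thesis by (simp add: a_def)
qed

end

section \<open>Weak limits and minimization\<close>

context energy_space
begin

lemma bounded_by_ball:
  assumes "u \<in> X" "B u u \<le> c" "x \<in> V"
  shows "\<bar>u x\<bar> \<le> D * sqrt c"
  using sup_le[OF assms(1,3)] mult_left_mono[OF real_sqrt_le_mono[OF assms(2)] less_imp_le[OF D_pos]] by linarith

text \<open>Lower semicontinuity: a tail of the sequence lies in the closed energy ball of level A +
  e.\<close>

lemma weak_limit:
  assumes z: "\<And>n::nat. z n \<in> X" and B: "\<And>n. B (z n) (z n) \<le> c" "(\<lambda>n. B (z n) (z n)) \<longlonglongrightarrow> A"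
    and w: "continuous_on V w" "\<And>x. x \<in> V \<Longrightarrow> (\<lambda>n. z n x) \<longlonglongrightarrow> w x"
  shows "B w w \<le> A"
proof (rule field_le_epsilon)
  fix e :: real assume "e > 0"
  then have "eventually (\<lambda>n. B (z n) (z n) < A + e) sequentially"
    using B(2) by (intro order_tendstoD(2)) auto
  then obtain n0 where n0: "\<And>n. n \<ge> n0 \<Longrightarrow> B (z n) (z n) \<le> A + e"
    unfolding eventually_sequentially by (auto intro: less_imp_le)
  have "w \<in> X \<and> B w w \<le> A + e"
    by (rule closed_ball[of "\<lambda>n. z (n + n0)"]) (use n0 z w in \<open>auto intro: LIMSEQ_ignore_initial_segment\<close>)
  then show "B w w \<le> A + e" ..
qed

end

context concave_convex
begin

lemma I_line_deriv:
  assumes u: "u \<in> X" and v: "v \<in> X"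
  shows "((\<lambda>\<epsilon>. I (\<lambda>x. u x + \<epsilon> * v x)) has_real_derivative
    B (\<lambda>x. u x + e * v x) v - (\<integral>x. h (u x + e * v x) * v x \<partial>\<mu>)) (at e)"
proof -
  have "((\<lambda>\<epsilon>. (B u u + 2 * \<epsilon> * B u v + \<epsilon>\<^sup>2 * B v v) / 2 - (\<integral>x. F (u x + \<epsilon> * v x) \<partial>\<mu>)) has_real_derivative
     (B u v + e * B v v) - (\<integral>x. h (u x + e * v x) * v x \<partial>\<mu>)) (at e)"
    by (rule DERIV_diff[OF _ integral_has_derivative[OF F_deriv h_cont X_cont[OF u] X_cont[OF v]]])
      (auto intro!: derivative_eq_intros)
  moreover have "B (\<lambda>x. u x + e * v x) v = B u v + e * B v v" by (rule B_lin[OF u v v])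
  ultimately show ?thesis unfolding I_def B_expand[OF u v] by simp
qed

lemma critical_of_local_min:
  assumes u: "u \<in> X"
    and min: "\<And>v. v \<in> X \<Longrightarrow> \<exists>\<delta>>0. \<forall>\<epsilon>. \<bar>\<epsilon>\<bar> < \<delta> \<longrightarrow> I u \<le> I (\<lambda>x. u x + \<epsilon> * v x)"
  shows "critical u"
  unfolding critical_def
proof (intro conjI ballI)
  fix v assume v: "v \<in> X"
  obtain \<delta> where \<delta>: "\<delta> > 0" "\<And>\<epsilon>. \<bar>\<epsilon>\<bar> < \<delta> \<Longrightarrow> I u \<le> I (\<lambda>x. u x + \<epsilon> * v x)" using min[OF v] by blast
  have "B (\<lambda>x. u x + 0 * v x) v - (\<integral>x. h (u x + 0 * v x) * v x \<partial>\<mu>) = 0"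
    by (rule DERIV_local_min[OF I_line_deriv[OF u v] \<delta>(1)]) (use \<delta>(2) in auto)
  then show "B u v = (\<integral>x. h (u x) * v x \<partial>\<mu>)" by simp
qed (rule u)

lemma min_sequence:
  fixes S :: "('a \<Rightarrow> real) set"
  assumes "S \<noteq> {}" "\<And>u. u \<in> S \<Longrightarrow> K \<le> I u"
  shows "\<exists>z m. (\<forall>n::nat. z n \<in> S) \<and> (\<lambda>n. I (z n)) \<longlonglongrightarrow> m \<and> (\<forall>u\<in>S. m \<le> I u) \<and>
    (\<forall>n. I (z n) \<le> m + 1)"
proof -
  define m where "m = Inf (I ` S)"
  have lower: "m \<le> I u" if "u \<in> S" for u
    unfolding m_def by (rule cInf_lower) (use that assms(2) in \<open>auto intro!: bdd_belowI2\<close>)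
  have "\<exists>u\<in>S. I u < m + 1 / real (Suc n)" for n
    using cInf_lessD[of "I ` S" "m + 1 / real (Suc n)"] assms(1) by (auto simp: m_def)
  then obtain z where z: "\<And>n. z n \<in> S" "\<And>n. I (z n) < m + 1 / real (Suc n)" by metis
  have "(\<lambda>n. m + 1 / real (Suc n)) \<longlonglongrightarrow> m"
    using LIMSEQ_inverse_real_of_nat_add[of m] by (simp add: inverse_eq_divide)
  then have "(\<lambda>n. I (z n)) \<longlonglongrightarrow> m"
    by (rule tendsto_sandwich[OF always_eventually always_eventually tendsto_const, rotated 2])
      (use z lower in \<open>auto intro: less_imp_le\<close>)
  moreover have "I (z n) \<le> m + 1" for n
  proof -
    have "1 / real (Suc n) \<le> 1" by simp
    then show ?thesis using z(2)[of n] by linarith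
  qed
  ultimately show ?thesis using z(1) lower by blast
qed

lemma integral_F_tendsto:
  assumes z: "\<And>n::nat. z n \<in> X" and B: "\<And>n. B (z n) (z n) \<le> c"
    and w: "continuous_on V w" "\<And>x. x \<in> V \<Longrightarrow> (\<lambda>n. z n x) \<longlonglongrightarrow> w x"
  shows "(\<lambda>n. \<integral>x. F (z n x) \<partial>\<mu>) \<longlonglongrightarrow> (\<integral>x. F (w x) \<partial>\<mu>)"
  using integral_comp_tendsto[of F "\<lambda>_. 1" z w "D * sqrt c"] F_cont X_cont[OF z] w bounded_by_ball[OF z B]
  by auto

lemma continuous_h_self: "continuous_on UNIV (\<lambda>t. h t * t)"
  by (intro continuous_on_mult h_cont continuous_on_id)

lemma N_tendsto:
  assumes z: "\<And>n::nat. z n \<in> X" and B: "\<And>n. B (z n) (z n) \<le> c"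
    and w: "continuous_on V w" "\<And>x. x \<in> V \<Longrightarrow> (\<lambda>n. z n x) \<longlonglongrightarrow> w x"
  shows "(\<lambda>n. N (z n)) \<longlonglongrightarrow> N w"
  unfolding N_def
  using integral_comp_tendsto[of "\<lambda>t. h t * t" "\<lambda>_. 1" z w "D * sqrt c"] continuous_h_self X_cont[OF z] w
    bounded_by_ball[OF z B]
  by auto

text \<open>The negative value at \<psi> keeps the minimizer away from 0. On the sphere I increases
  strictly outwards, so a minimizer there could be improved by shrinking it; hence it is interior
  and critical.\<close>

lemma ball_minimizer:
  assumes \<psi>: "\<psi> \<in> X" "B \<psi> \<psi> \<le> \<rho>\<^sup>2" "I \<psi> < 0"
  shows "\<exists>u. critical u \<and> B u u < \<rho>\<^sup>2 \<and> B u u > 0"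
proof -
  let ?S = "{u\<in>X. B u u \<le> \<rho>\<^sup>2}"
  have lower: "- (lam / s * (D * \<rho>) powr s) - (D * \<rho>) powr q / q \<le> I u" if "u \<in> ?S" for u
  proof -
    have u: "u \<in> X" "B u u \<le> \<rho>\<^sup>2" using that by auto
    have le: "D * sqrt (B u u) \<le> D * \<rho>"
      using real_sqrt_le_mono[OF u(2)] \<rho>0 D_pos by simp
    have P: "Pw a u \<le> (D * \<rho>) powr a" if "a > 0" for a
      by (rule order_trans[OF Pw_le[OF u(1) that]])
        (intro powr_mono2 le, use that D_pos B_nonneg[OF u(1)] in auto)
    have "lam / s * Pw s u \<le> lam / s * (D * \<rho>) powr s"
      using lam0 r1 rs by (intro mult_left_mono P) auto
    moreover have "Pw q u / q \<le> (D * \<rho>) powr q / q" using q2 by (intro divide_right_mono P) auto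
    moreover have "eta / r * Pw r u \<ge> 0" using eta0 r1 Pw_nonneg by simp
    ultimately show ?thesis using B_nonneg[OF u(1)] unfolding I_eq[OF u(1)] by linarith
  qed
  have ne: "?S \<noteq> {}" using \<psi> by blast
  obtain z m where z: "\<And>n::nat. z n \<in> ?S" and Im: "(\<lambda>n. I (z n)) \<longlonglongrightarrow> m" and m: "\<And>u. u \<in> ?S \<Longrightarrow> m \<le> I u"
    using min_sequence[OF ne lower] by blast
  have zX: "\<And>n. z n \<in> X" "\<And>n. B (z n) (z n) \<le> \<rho>\<^sup>2" using z by auto
  obtain u k where k: "strict_mono k" and u: "continuous_on V u"
      and conv: "\<And>x. x \<in> V \<Longrightarrow> (\<lambda>n. z (k n :: nat) x) \<longlonglongrightarrow> u x"
    using subseq[of z, OF zX] by blast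
  have uX: "u \<in> X" "B u u \<le> \<rho>\<^sup>2"
    using closed_ball[of "\<lambda>n. z (k n)", OF zX u conv] by auto
  have Fl: "(\<lambda>n. \<integral>x. F (z (k n) x) \<partial>\<mu>) \<longlonglongrightarrow> (\<integral>x. F (u x) \<partial>\<mu>)"
    by (rule integral_F_tendsto[of "\<lambda>n. z (k n)", OF zX u conv])
  have Il: "(\<lambda>n. I (z (k n))) \<longlonglongrightarrow> m"
    using LIMSEQ_subseq_LIMSEQ[OF Im k] by (simp add: o_def)
  \<comment> \<open>The values of I and the integrals of F converge, so the energies do as well, as
    \<open>weak_limit\<close> requires.\<close>
  have "(\<lambda>n. 2 * (I (z (k n)) + (\<integral>x. F (z (k n) x) \<partial>\<mu>))) \<longlonglongrightarrow> 2 * (m + (\<integral>x. F (u x) \<partial>\<mu>))"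
    by (intro tendsto_intros Il Fl)
  then have Bl: "(\<lambda>n. B (z (k n)) (z (k n))) \<longlonglongrightarrow> 2 * (m + (\<integral>x. F (u x) \<partial>\<mu>))"
    by (simp add: I_def)
  have "B u u \<le> 2 * (m + (\<integral>x. F (u x) \<partial>\<mu>))"
    by (rule weak_limit[of "\<lambda>n. z (k n)", OF zX Bl u conv])
  then have "I u \<le> m" by (simp add: I_def)
  then have Iu: "I u \<le> I v" if "v \<in> X" "B v v \<le> \<rho>\<^sup>2" for v using m[of v] that by simp
  have "I u < 0" using Iu[OF \<psi>(1,2)] \<psi>(3) by simp
  have pos: "B u u > 0"
  proof (rule ccontr)
    assume "\<not> B u u > 0"
    then have B0: "B u u = 0" using B_nonneg[OF uX(1)] by simp
    have P0: "Pw a u = 0" if "a > 0" for a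
      using Pw_le[OF uX(1) that] Pw_nonneg[of a u] B0 by simp
    have "I u = 0" using P0[of s] P0[of r] P0[of q] r1 rs q2 B0 by (simp add: I_eq[OF uX(1)])
    with \<open>I u < 0\<close> show False by simp
  qed
  have strict: "B u u < \<rho>\<^sup>2"
  proof (rule ccontr)
    assume "\<not> B u u < \<rho>\<^sup>2"
    then have eq: "B u u = \<rho>\<^sup>2" using uX by simp
    have "fibre u 1 > 0" using fibre_sgn(1)[OF uX(1), of 1] N_less_sphere[OF uX(1) eq] by simp
    then obtain d where d: "d > 0" "\<And>t. t > 0 \<Longrightarrow> t < d \<Longrightarrow> I (\<lambda>x. (1 - t) * u x) < I (\<lambda>x. 1 * u x)"
      using DERIV_pos_inc_left[OF I_deriv_scale[OF uX(1), of 1]] by auto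
    define t where "t = min (d / 2) (1 / 2)"
    have t: "t > 0" "t < d" "t < 1" using d(1) by (auto simp: t_def)
    have "(1 - t)\<^sup>2 * B u u \<le> 1 * B u u"
      using t pos by (intro mult_right_mono power_le_one) auto
    then have "I u \<le> I (\<lambda>x. (1 - t) * u x)"
      using uX by (intro Iu X_scale) (auto simp: B_scale2)
    then show False using d(2)[OF t(1,2)] by simp
  qed
  have "critical u"
  proof (rule critical_of_local_min[OF uX(1)])
    fix v assume v: "v \<in> X"
    have "((\<lambda>\<epsilon>. B u u + 2 * \<epsilon> * B u v + \<epsilon>\<^sup>2 * B v v) \<longlongrightarrow> B u u + 2 * 0 * B u v + 0\<^sup>2 * B v v) (nhds 0)"
      by (intro tendsto_intros filterlim_ident)
    then have "eventually (\<lambda>\<epsilon>. B u u + 2 * \<epsilon> * B u v + \<epsilon>\<^sup>2 * B v v < \<rho>\<^sup>2) (nhds 0)"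
      using strict by (intro order_tendstoD(2)) auto
    then obtain \<delta> where \<delta>: "\<delta> > 0" "\<And>\<epsilon>. \<bar>\<epsilon>\<bar> < \<delta> \<Longrightarrow> B u u + 2 * \<epsilon> * B u v + \<epsilon>\<^sup>2 * B v v < \<rho>\<^sup>2"
      unfolding eventually_nhds_metric by (auto simp: dist_real_def)
    show "\<exists>\<delta>>0. \<forall>\<epsilon>. \<bar>\<epsilon>\<bar> < \<delta> \<longrightarrow> I u \<le> I (\<lambda>x. u x + \<epsilon> * v x)"
    proof (intro exI[of _ \<delta>] conjI allI impI \<delta>(1))
      fix \<epsilon> :: real assume "\<bar>\<epsilon>\<bar> < \<delta>"
      then show "I u \<le> I (\<lambda>x. u x + \<epsilon> * v x)"
        using \<delta>(2)[of \<epsilon>] by (intro Iu X_lin uX v) (simp add: B_expand[OF uX(1) v])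
    qed
  qed
  with strict pos show ?thesis by blast
qed

text \<open>The limit w of a minimizing sequence may leave \<open>M\<close>, as energy can drop in
  the limit. It is moved back along its ray: for the t with t w in \<open>M\<close>, semicontinuity
  bounds I(t w) by the limit of I(t z), and \<open>M_ray\<close> bounds I(t z) by I(z).\<close>

lemma M_minimizer:
  assumes "\<phi> \<in> X" "B \<phi> \<phi> > 0"
  obtains w where "w \<in> M" "\<And>u. u \<in> M \<Longrightarrow> I w \<le> I u"
proof -
  obtain t where "(\<lambda>x. t * \<phi> x) \<in> M" using ray_exists[OF assms] by blast
  then have ne: "M \<noteq> {}" by blast
  have lower: "0 \<le> I u" if "u \<in> M" for u
  proof -
    have "u \<in> X" using that by (simp add: M_def)
    then have "0 \<le> \<kappa> * B u u" using \<kappa>_pos B_nonneg[of u] by simp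
    then show ?thesis using M_coercive[OF that] by linarith
  qed
  obtain z m where z: "\<And>n::nat. z n \<in> M" and Im: "(\<lambda>n. I (z n)) \<longlonglongrightarrow> m"
      and m: "\<And>u. u \<in> M \<Longrightarrow> m \<le> I u" and Ib: "\<And>n. I (z n) \<le> m + 1"
    using min_sequence[OF ne lower] by blast
  define c where "c = (m + 1) / \<kappa>"
  have zX: "\<And>n. z n \<in> X" and zB: "\<And>n. B (z n) (z n) \<ge> \<rho>\<^sup>2" and zN: "\<And>n. N (z n) = B (z n) (z n)"
    using z by (auto simp: M_def)
  have zc: "B (z n) (z n) \<le> c" for n
    using M_coercive[OF z, of n] Ib[of n] \<kappa>_pos by (simp add: c_def pos_le_divide_eq mult.commute)
  obtain w k where k: "strict_mono k" and w: "continuous_on V w"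
      and conv: "\<And>x. x \<in> V \<Longrightarrow> (\<lambda>n. z (k n :: nat) x) \<longlonglongrightarrow> w x"
    using subseq[of z, OF zX zc] by blast
  have wX: "w \<in> X" using closed_ball[of "\<lambda>n. z (k n)", OF zX zc w conv] by auto
  have "(\<lambda>n. N (z (k n))) \<longlonglongrightarrow> N w" by (rule N_tendsto[of "\<lambda>n. z (k n)", OF zX zc w conv])
  then have Bl: "(\<lambda>n. B (z (k n)) (z (k n))) \<longlonglongrightarrow> N w" by (simp add: zN)
  have Bw: "B w w \<le> N w" by (rule weak_limit[of "\<lambda>n. z (k n)", OF zX zc Bl w conv])
  \<comment> \<open>N passes to the limit although the energy need not; this prevents w from
    vanishing.\<close>
  have Nw: "N w \<ge> \<rho>\<^sup>2" by (rule LIMSEQ_le_const[OF Bl]) (use zB in auto)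
  have pos: "B w w > 0"
  proof (rule ccontr)
    assume "\<not> B w w > 0"
    then have B0: "B w w = 0" using B_nonneg[OF wX] by simp
    have P0: "Pw a w = 0" if "a > 0" for a
      using Pw_le[OF wX that] Pw_nonneg[of a w] B0 by simp
    have "N w = 0" using P0[of s] P0[of r] P0[of q] r1 rs q2 by (simp add: N_eq[OF wX])
    with Nw \<rho>0 show False by simp
  qed
  obtain t where t: "t > 0" "(\<lambda>x. t * w x) \<in> M" using ray_exists[OF wX pos] by blast
  have tB: "t\<^sup>2 * B w w > \<rho>\<^sup>2" using M_strict[OF t(2)] by (simp add: B_scale2[OF wX])
  have Fl: "(\<lambda>n. \<integral>x. F (t * z (k n) x) \<partial>\<mu>) \<longlonglongrightarrow> (\<integral>x. F (t * w x) \<partial>\<mu>)"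
  proof (rule integral_F_tendsto[of "\<lambda>n x. t * z (k n) x" "t\<^sup>2 * c"])
    show "B (\<lambda>x. t * z (k n) x) (\<lambda>x. t * z (k n) x) \<le> t\<^sup>2 * c" for n
      using zc[of "k n"] by (simp add: B_scale2[OF zX] mult_left_mono)
  qed (use conv in \<open>auto intro!: X_scale zX continuous_intros w tendsto_intros\<close>)
  have "(\<lambda>n. t\<^sup>2 * B (z (k n)) (z (k n)) / 2 - (\<integral>x. F (t * z (k n) x) \<partial>\<mu>)) \<longlonglongrightarrow>
      t\<^sup>2 * N w / 2 - (\<integral>x. F (t * w x) \<partial>\<mu>)"
    by (intro tendsto_intros Bl Fl) auto
  then have It: "(\<lambda>n. I (\<lambda>x. t * z (k n) x)) \<longlonglongrightarrow> t\<^sup>2 * N w / 2 - (\<integral>x. F (t * w x) \<partial>\<mu>)"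
    by (simp add: I_def B_scale2[OF zX])
  have Il: "(\<lambda>n. I (z (k n))) \<longlonglongrightarrow> m" using LIMSEQ_subseq_LIMSEQ[OF Im k] by (simp add: o_def)
  have "(\<lambda>n. t\<^sup>2 * B (z (k n)) (z (k n))) \<longlonglongrightarrow> t\<^sup>2 * N w" by (intro tendsto_intros Bl)
  \<comment> \<open>The energies of t z tend to \<open>t\<^sup>2 * N w\<close>, so these functions
    are eventually outside the ball, where \<open>M_ray\<close> applies.\<close>
  moreover have "t\<^sup>2 * N w > \<rho>\<^sup>2" using mult_left_mono[OF Bw, of "t\<^sup>2"] tB by simp
  ultimately have "eventually (\<lambda>n. t\<^sup>2 * B (z (k n)) (z (k n)) > \<rho>\<^sup>2) sequentially"
    by (rule order_tendstoD(1))
  then have "eventually (\<lambda>n. I (\<lambda>x. t * z (k n) x) \<le> I (z (k n))) sequentially"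
    by eventually_elim (rule M_ray(1)[OF z t(1)], simp)
  then have "t\<^sup>2 * N w / 2 - (\<integral>x. F (t * w x) \<partial>\<mu>) \<le> m"
    by (rule tendsto_le[OF sequentially_bot Il It])
  moreover have "I (\<lambda>x. t * w x) \<le> t\<^sup>2 * N w / 2 - (\<integral>x. F (t * w x) \<partial>\<mu>)"
    using mult_left_mono[OF Bw, of "t\<^sup>2"] by (simp add: I_def B_scale2[OF wX])
  ultimately have "I (\<lambda>x. t * w x) \<le> m" by simp
  then show ?thesis using that[OF t(2)] m by force
qed

section \<open>Criticality of the minimizer on the Nehari set\<close>

lemma Pw_line_cont:
  assumes "u \<in> X" "v \<in> X" "a > 1"
  shows "((\<lambda>\<epsilon>. Pw a (\<lambda>x. u x + \<epsilon> * v x)) \<longlongrightarrow> Pw a u) (at_right 0)"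
proof -
  have c: "continuous_on UNIV (\<lambda>t. a * (\<bar>t\<bar> powr (a - 2) * t))"
    by (intro continuous_on_mult[OF continuous_on_const] continuous_on_odd_powr assms)
  have "isCont (\<lambda>\<epsilon>. Pw a (\<lambda>x. u x + \<epsilon> * v x)) 0"
    unfolding Pw_def
    by (rule DERIV_isCont, rule integral_has_derivative[OF has_real_derivative_abs_powr[OF assms(3)] c])
      (intro X_cont assms)+
  then have "((\<lambda>\<epsilon>. Pw a (\<lambda>x. u x + \<epsilon> * v x)) \<longlongrightarrow> Pw a (\<lambda>x. u x + 0 * v x)) (at 0)"
    by (rule isContD)
  then have "((\<lambda>\<epsilon>. Pw a (\<lambda>x. u x + \<epsilon> * v x)) \<longlongrightarrow> Pw a u) (at 0)" by simp
  then show ?thesis by (rule filterlim_mono) (auto simp: at_within_le_nhds at_le)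
qed

lemma B_line_cont:
  assumes "u \<in> X" "v \<in> X"
  shows "((\<lambda>\<epsilon>. B (\<lambda>x. u x + \<epsilon> * v x) (\<lambda>x. u x + \<epsilon> * v x)) \<longlongrightarrow> B u u) (at_right 0)"
proof -
  have "((\<lambda>\<epsilon>. B u u + 2 * \<epsilon> * B u v + \<epsilon>\<^sup>2 * B v v) \<longlongrightarrow> B u u + 2 * 0 * B u v + 0\<^sup>2 * B v v) (at_right 0)"
    by (intro tendsto_intros)
  then show ?thesis unfolding B_expand[OF assms] by simp
qed

lemma fibre_line_cont:
  assumes "u \<in> X" "v \<in> X"
  shows "((\<lambda>\<epsilon>. fibre (\<lambda>x. u x + \<epsilon> * v x) t) \<longlongrightarrow> fibre u t) (at_right 0)"
  unfolding fibre_def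
  by (intro tendsto_intros B_line_cont Pw_line_cont assms) (use r1 rs s2 q2 in auto)

text \<open>A substitute for the implicit function theorem: the fibre map of w is positive at 1 - e
  and negative at 1 + e. Both signs survive a small change of direction, and the intermediate value
  theorem finds a point of \<open>M\<close> on the new ray.\<close>

lemma M_perturb:
  assumes w: "w \<in> M" and v: "v \<in> X" and e: "0 < e" "e < 1" and eB: "(1 - e)\<^sup>2 * B w w > \<rho>\<^sup>2"
  obtains \<epsilon> t where "0 < \<epsilon>" "\<epsilon> < e" "1 - e \<le> t" "t \<le> 1 + e"
    "(\<lambda>x. t * (w x + \<epsilon> * v x)) \<in> M"
proof -
  have wX: "w \<in> X" and wB: "B w w \<ge> \<rho>\<^sup>2" using w by (auto simp: M_def)
  have "(1 + e)\<^sup>2 * B w w \<ge> 1 * B w w"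
    using e B_nonneg[OF wX] by (intro mult_right_mono) (auto simp: power2_eq_square algebra_simps)
  then have "fibre w (1 + e) < 0" using wB e by (intro M_ray(3)[OF w]) auto
  moreover have "fibre w (1 - e) > 0" using e eB by (intro M_ray(2)[OF w]) auto
  moreover have "((\<lambda>\<epsilon>. (1 - e)\<^sup>2 * B (\<lambda>x. w x + \<epsilon> * v x) (\<lambda>x. w x + \<epsilon> * v x)) \<longlongrightarrow> (1 - e)\<^sup>2 * B w w) (at_right 0)"
    by (intro tendsto_intros B_line_cont wX v)
  ultimately have f: "fibre w (1 + e) < 0" "fibre w (1 - e) > 0" and
    Bl: "((\<lambda>\<epsilon>. (1 - e)\<^sup>2 * B (\<lambda>x. w x + \<epsilon> * v x) (\<lambda>x. w x + \<epsilon> * v x)) \<longlongrightarrow> (1 - e)\<^sup>2 * B w w) (at_right 0)"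
    by blast+
  have "eventually (\<lambda>\<epsilon>. fibre (\<lambda>x. w x + \<epsilon> * v x) (1 + e) < 0 \<and> fibre (\<lambda>x. w x + \<epsilon> * v x) (1 - e) > 0 \<and>
      (1 - e)\<^sup>2 * B (\<lambda>x. w x + \<epsilon> * v x) (\<lambda>x. w x + \<epsilon> * v x) > \<rho>\<^sup>2 \<and> \<epsilon> \<in> {0<..<e}) (at_right 0)"
    by (intro eventually_conj order_tendstoD(2)[OF fibre_line_cont[OF wX v] f(1)]
        order_tendstoD(1)[OF fibre_line_cont[OF wX v] f(2)] order_tendstoD(1)[OF Bl eB]
        eventually_at_right_real e(1))
  then obtain \<epsilon> where \<epsilon>: "fibre (\<lambda>x. w x + \<epsilon> * v x) (1 + e) < 0" "fibre (\<lambda>x. w x + \<epsilon> * v x) (1 - e) > 0"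
      "(1 - e)\<^sup>2 * B (\<lambda>x. w x + \<epsilon> * v x) (\<lambda>x. w x + \<epsilon> * v x) > \<rho>\<^sup>2" "0 < \<epsilon>" "\<epsilon> < e"
    by (auto dest!: eventually_happens'[OF trivial_limit_at_right_real])
  let ?y = "\<lambda>x. w x + \<epsilon> * v x"
  have y: "?y \<in> X" by (rule X_lin[OF wX v])
  have "\<exists>t\<ge>1 - e. t \<le> 1 + e \<and> fibre ?y t = 0"
    using \<epsilon> e by (intro IVT2' continuous_on_subset[OF fibre_cont]) auto
  then obtain t where t: "1 - e \<le> t" "t \<le> 1 + e" "fibre ?y t = 0" by blast
  have "(1 - e)\<^sup>2 * B ?y ?y \<le> t\<^sup>2 * B ?y ?y"
    using t e B_nonneg[OF y] by (intro mult_right_mono power_mono) auto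
  then have "(\<lambda>x. t * ?y x) \<in> M"
    using \<epsilon>(3) fibre_sgn(3)[OF y, of t] t e by (auto simp: M_def X_scale[OF y] B_scale2[OF y])
  with \<epsilon> t show ?thesis using that by blast
qed

text \<open>For a point t (w + \<epsilon> v) of \<open>M\<close> near w one has I(t w) \<le> I(w)
  \<le> I(t (w + \<epsilon> v)), first because w is the maximum of its ray and then by minimality.
  Both ends share the factor t, so the mean value theorem yields the derivative in direction v
  alone; then t tends to 1.\<close>

lemma M_minimizer_ineq:
  assumes w: "w \<in> M" "\<And>u. u \<in> M \<Longrightarrow> I w \<le> I u" and v: "v \<in> X"
  shows "B w v - (\<integral>x. h (w x) * v x \<partial>\<mu>) \<ge> 0"
proof -
  have wX: "w \<in> X" using w by (simp add: M_def)
  have "((\<lambda>e. (1 - e)\<^sup>2 * B w w) \<longlongrightarrow> (1 - 0)\<^sup>2 * B w w) (at_right 0)" by (intro tendsto_intros)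
  then have "eventually (\<lambda>e. (1 - e)\<^sup>2 * B w w > \<rho>\<^sup>2) (at_right 0)"
    using M_strict[OF w(1)] by (intro order_tendstoD(1)) auto
  then obtain e0 where e0: "e0 > 0" "\<And>e. 0 < e \<Longrightarrow> e < e0 \<Longrightarrow> (1 - e)\<^sup>2 * B w w > \<rho>\<^sup>2"
    by (auto simp: eventually_at_right_field)
  \<comment> \<open>The shift by 2 keeps \<open>e n\<close> strictly below both e0 and 1, so that 1
    - e n is positive for every n.\<close>
  define e where "e n = min e0 1 / real (n + 2)" for n
  have e: "0 < e n" "e n < e0" "e n < 1" "e n \<le> 1" for n
  proof -
    have "min e0 1 / real (n + 2) < min e0 1 / 1" using e0(1) by (intro divide_strict_left_mono) auto
    then show "0 < e n" "e n < e0" "e n < 1" "e n \<le> 1" using e0(1) by (auto simp: e_def)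
  qed
  have elim: "e \<longlonglongrightarrow> 0"
    unfolding e_def by (rule LIMSEQ_ignore_initial_segment[OF lim_const_over_n])
  define Q where "Q n \<xi> t \<longleftrightarrow> 0 \<le> \<xi> \<and> \<xi> \<le> e n \<and> 1 - e n \<le> t \<and> t \<le> 1 + e n \<and>
      B (\<lambda>x. t * w x + (\<xi> * t) * v x) v - (\<integral>x. h (t * w x + (\<xi> * t) * v x) * v x \<partial>\<mu>) \<ge> 0" for n \<xi> t
  have "\<exists>\<xi> t. Q n \<xi> t" for n
  proof -
    obtain \<epsilon> t where \<epsilon>: "0 < \<epsilon>" "\<epsilon> < e n" and t: "1 - e n \<le> t" "t \<le> 1 + e n"
        and M: "(\<lambda>x. t * (w x + \<epsilon> * v x)) \<in> M"
      using M_perturb[OF w(1) v e(1,3) e0(2)[OF e(1,2)]] by blast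
    have t0: "t > 0" using t(1) e(3)[of n] by linarith
    have tX: "(\<lambda>x. t * w x) \<in> X" "(\<lambda>x. t * v x) \<in> X" using X_scale wX v by auto
    have "(1 - e n)\<^sup>2 * B w w \<le> t\<^sup>2 * B w w"
      using t e(3)[of n] B_nonneg[OF wX] by (intro mult_right_mono power_mono) auto
    then have "I (\<lambda>x. t * w x) \<le> I w"
      using e0(2)[OF e(1,2), of n] by (intro M_ray(1)[OF w(1) t0]) simp
    also have "I w \<le> I (\<lambda>x. t * (w x + \<epsilon> * v x))" by (rule w(2)[OF M])
    finally have le: "I (\<lambda>x. t * w x + 0 * (t * v x)) \<le> I (\<lambda>x. t * w x + \<epsilon> * (t * v x))"
      by (simp add: algebra_simps)
    obtain \<xi> where \<xi>: "0 < \<xi>" "\<xi> < \<epsilon>" and eq: "I (\<lambda>x. t * w x + \<epsilon> * (t * v x)) - I (\<lambda>x. t * w x + 0 * (t * v x)) =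
        (\<epsilon> - 0) * (B (\<lambda>x. t * w x + \<xi> * (t * v x)) (\<lambda>x. t * v x) - (\<integral>x. h (t * w x + \<xi> * (t * v x)) * (t * v x) \<partial>\<mu>))"
      using MVT2[OF \<epsilon>(1) I_line_deriv[OF tX]] by blast
    have "B (\<lambda>x. t * w x + \<xi> * (t * v x)) (\<lambda>x. t * v x) - (\<integral>x. h (t * w x + \<xi> * (t * v x)) * (t * v x) \<partial>\<mu>) \<ge> 0"
    proof -
      have "(\<epsilon> - 0) * (B (\<lambda>x. t * w x + \<xi> * (t * v x)) (\<lambda>x. t * v x) - (\<integral>x. h (t * w x + \<xi> * (t * v x)) * (t * v x) \<partial>\<mu>)) \<ge> 0"
        using le eq by linarith
      then show ?thesis using \<epsilon>(1) by (simp add: zero_le_mult_iff)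
    qed
    moreover have "B (\<lambda>x. t * w x + \<xi> * (t * v x)) (\<lambda>x. t * v x) = t * B (\<lambda>x. t * w x + (\<xi> * t) * v x) v"
      using B_scale_right[OF v X_lin[OF tX, of \<xi>], of t] by (simp add: mult.assoc)
    moreover have "(\<integral>x. h (t * w x + \<xi> * (t * v x)) * (t * v x) \<partial>\<mu>) = t * (\<integral>x. h (t * w x + (\<xi> * t) * v x) * v x \<partial>\<mu>)"
      by (subst integral_mult_right_zero[symmetric]) (simp add: mult_ac)
    ultimately have "t * (B (\<lambda>x. t * w x + (\<xi> * t) * v x) v - (\<integral>x. h (t * w x + (\<xi> * t) * v x) * v x \<partial>\<mu>)) \<ge> 0"
      by (simp add: right_diff_distrib)
    then have "B (\<lambda>x. t * w x + (\<xi> * t) * v x) v - (\<integral>x. h (t * w x + (\<xi> * t) * v x) * v x \<partial>\<mu>) \<ge> 0"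
      using t0 by (simp add: zero_le_mult_iff)
    then have "Q n \<xi> t" using \<xi> \<epsilon> t unfolding Q_def by auto
    then show ?thesis by blast
  qed
  then obtain \<xi> t where "\<And>n. Q n (\<xi> n) (t n)" by metis
  then have \<xi>: "\<And>n. 0 \<le> \<xi> n" "\<And>n. \<xi> n \<le> e n" and t: "\<And>n. 1 - e n \<le> t n" "\<And>n. t n \<le> 1 + e n"
    and ge: "\<And>n. B (\<lambda>x. t n * w x + (\<xi> n * t n) * v x) v - (\<integral>x. h (t n * w x + (\<xi> n * t n) * v x) * v x \<partial>\<mu>) \<ge> 0"
    unfolding Q_def by blast+
  have tl: "t \<longlonglongrightarrow> 1"
  proof (rule tendsto_sandwich[OF always_eventually always_eventually])
    show "(\<lambda>n. 1 - e n) \<longlonglongrightarrow> 1" using tendsto_diff[OF tendsto_const[of 1] elim] by simp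
    show "(\<lambda>n. 1 + e n) \<longlonglongrightarrow> 1" using tendsto_add[OF tendsto_const[of 1] elim] by simp
  qed (use t in auto)
  have "\<xi> \<longlonglongrightarrow> 0"
    by (rule tendsto_sandwich[OF always_eventually always_eventually tendsto_const elim]) (use \<xi> in auto)
  then have \<xi>l: "(\<lambda>n. \<xi> n * t n) \<longlonglongrightarrow> 0" using tendsto_mult[OF _ tl] by fastforce
  have bd: "\<bar>t n\<bar> \<le> 2" "\<bar>\<xi> n * t n\<bar> \<le> 2" for n
  proof -
    show *: "\<bar>t n\<bar> \<le> 2" using t[of n] e(4)[of n] by linarith
    have "\<bar>\<xi> n\<bar> \<le> 1" using \<xi>[of n] e(4)[of n] by linarith
    then have "\<bar>\<xi> n\<bar> * \<bar>t n\<bar> \<le> 1 * 2" using * by (intro mult_mono) auto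
    then show "\<bar>\<xi> n * t n\<bar> \<le> 2" by (simp add: abs_mult)
  qed
  obtain Kw where Kw: "\<And>x. x \<in> V \<Longrightarrow> \<bar>w x\<bar> \<le> Kw" using bounded_cont[OF X_cont[OF wX]] by blast
  obtain Kv where Kv: "\<And>x. x \<in> V \<Longrightarrow> \<bar>v x\<bar> \<le> Kv" using bounded_cont[OF X_cont[OF v]] by blast
  have "(\<lambda>n. \<integral>x. h (t n * w x + (\<xi> n * t n) * v x) * v x \<partial>\<mu>) \<longlonglongrightarrow> (\<integral>x. h (w x) * v x \<partial>\<mu>)"
  proof (rule integral_comp_tendsto[OF h_cont X_cont[OF v], where C = "2 * Kw + 2 * Kv"])
    fix n
    show "continuous_on V (\<lambda>x. t n * w x + \<xi> n * t n * v x)"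
      by (intro continuous_intros X_cont wX v)
    fix x assume x: "x \<in> V"
    have "\<bar>t n * w x\<bar> \<le> 2 * Kw" unfolding abs_mult using bd Kw[OF x] by (intro mult_mono) auto
    moreover have "\<bar>\<xi> n * t n * v x\<bar> \<le> 2 * Kv"
      unfolding abs_mult[of "\<xi> n * t n"] using bd Kv[OF x] by (intro mult_mono) auto
    ultimately show "\<bar>t n * w x + \<xi> n * t n * v x\<bar> \<le> 2 * Kw + 2 * Kv" by linarith
  next
    fix x assume "x \<in> V"
    have "(\<lambda>n. t n * w x + \<xi> n * t n * v x) \<longlonglongrightarrow> 1 * w x + 0 * v x"
      by (intro tendsto_intros tl \<xi>l)
    then show "(\<lambda>n. t n * w x + \<xi> n * t n * v x) \<longlonglongrightarrow> w x" by simp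
  qed (rule X_cont[OF wX])
  moreover have "B (\<lambda>x. t n * w x + (\<xi> n * t n) * v x) v = t n * B w v + \<xi> n * t n * B v v" for n
    using B_lin[OF X_scale[OF wX] v v] B_scale[OF wX v] by simp
  moreover have "(\<lambda>n. t n * B w v + \<xi> n * t n * B v v) \<longlonglongrightarrow> 1 * B w v + 0 * B v v"
    by (intro tendsto_intros tl \<xi>l)
  ultimately have "(\<lambda>n. B (\<lambda>x. t n * w x + (\<xi> n * t n) * v x) v - (\<integral>x. h (t n * w x + (\<xi> n * t n) * v x) * v x \<partial>\<mu>))
      \<longlonglongrightarrow> B w v - (\<integral>x. h (w x) * v x \<partial>\<mu>)"
    by (simp add: tendsto_diff)
  then show ?thesis by (rule LIMSEQ_le_const) (use ge in auto)
qed

lemma M_minimizer_critical: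
  assumes w: "w \<in> M" "\<And>u. u \<in> M \<Longrightarrow> I w \<le> I u"
  shows "critical w"
  unfolding critical_def
proof (intro conjI ballI)
  show wX: "w \<in> X" using w by (simp add: M_def)
  fix v assume v: "v \<in> X"
  have v': "(\<lambda>x. - 1 * v x) \<in> X" by (rule X_scale[OF v])
  have "B w v - (\<integral>x. h (w x) * v x \<partial>\<mu>) \<ge> 0" by (rule M_minimizer_ineq[OF w v])
  moreover have "- (B w v) + (\<integral>x. h (w x) * v x \<partial>\<mu>) \<ge> 0"
    using M_minimizer_ineq[OF w v'] B_scale_right[OF v wX, of "- 1"] by simp
  ultimately show "B w v = (\<integral>x. h (w x) * v x \<partial>\<mu>)" by simp
qed

end

theorem (in energy_space) two_critical_points:
  assumes "1 < r" "r < s" "s < 2" "2 < q" and \<phi>: "\<phi> \<in> X" "x0 \<in> V" "\<phi> x0 \<noteq> 0"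
  shows "\<exists>\<Lambda>>0. \<forall>lam\<in>{0<..<\<Lambda>}. \<exists>eta0>0. \<forall>eta\<in>{0..<eta0}. \<exists>u\<in>X. \<exists>w\<in>X.
    0 < B u u \<and> B u u < B w w \<and>
    (\<forall>v\<in>X. B u v = (\<integral>x. rhs r s q lam eta x (u x) * v x \<partial>\<mu>)) \<and>
    (\<forall>v\<in>X. B w v = (\<integral>x. rhs r s q lam eta x (w x) * v x \<partial>\<mu>))"
proof -
  \<comment> \<open>The radius at which \<open>small_\<rho>\<close> holds with equality.\<close>
  define \<rho> where "\<rho> = (1 / (4 * D powr q)) powr (1 / (q - 2))"
  have \<rho>: "\<rho> > 0" using D_pos by (simp add: \<rho>_def)
  have "\<rho> powr (q - 2) = 1 / (4 * D powr q)"
    unfolding \<rho>_def powr_powr using \<open>2 < q\<close> D_pos by simp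
  then have sm\<rho>: "D powr q * \<rho> powr (q - 2) \<le> 1 / 4" using D_pos by simp
  \<comment> \<open>The value of \<open>lam\<close> at which \<open>small_lam\<close> becomes an
    equality.\<close>
  define \<Lambda> where "\<Lambda> = min (1 / 4) ((q - 2) / (2 * (q - s))) / (D powr s * \<rho> powr (s - 2))"
  have "\<Lambda> > 0" using D_pos \<rho> assms by (simp add: \<Lambda>_def)
  moreover have "\<exists>eta0>0. \<forall>eta\<in>{0..<eta0}. \<exists>u\<in>X. \<exists>w\<in>X.
    0 < B u u \<and> B u u < B w w \<and>
    (\<forall>v\<in>X. B u v = (\<integral>x. rhs r s q lam eta x (u x) * v x \<partial>\<mu>)) \<and>
    (\<forall>v\<in>X. B w v = (\<integral>x. rhs r s q lam eta x (w x) * v x \<partial>\<mu>))" if lam: "lam \<in> {0<..<\<Lambda>}" for lam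
  proof -
    have lam0: "lam > 0" using lam by simp
    have den: "D powr s * \<rho> powr (s - 2) > 0" using D_pos \<rho> by simp
    have "lam * (D powr s * \<rho> powr (s - 2)) \<le> \<Lambda> * (D powr s * \<rho> powr (s - 2))"
      using lam den by (intro mult_right_mono) auto
    also have "\<dots> = min (1 / 4) ((q - 2) / (2 * (q - s)))"
      unfolding \<Lambda>_def using den by (metis nonzero_eq_divide_eq less_irrefl)
    finally have sml: "lam * (D powr s * \<rho> powr (s - 2)) \<le> min (1 / 4) ((q - 2) / (2 * (q - s)))" .
    define a b c where "a = B \<phi> \<phi>" and "b = Pw s \<phi>" and "c = Pw r \<phi>"
    have pos: "a > 0" "b > 0" "c > 0"
      unfolding a_def b_def c_def using B_pos[OF \<phi>] Pw_pos[OF X_cont[OF \<phi>(1)] \<phi>(2,3)] assms by auto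
    have "((\<lambda>t. t powr (2 - s) * a / 2 - lam / s * b) \<longlongrightarrow> 0 * a / 2 - lam / s * b) (at_right 0)"
    proof (intro tendsto_intros)
      show "((\<lambda>t. t powr (2 - s)) \<longlongrightarrow> 0) (at_right 0)"
        using assms by (intro tendsto_zero_powrI[of _ _ _ "2 - s"] tendsto_ident_at tendsto_const)
           (auto intro: eventually_mono[OF eventually_at_right_less])
    qed auto
    moreover have "lam / s * b > 0" using lam0 pos assms by simp
    ultimately have ev1: "eventually (\<lambda>t. t powr (2 - s) * a / 2 - lam / s * b < 0) (at_right 0)"
      by (intro order_tendstoD(2)) auto
    have "((\<lambda>t. t\<^sup>2 * a) \<longlongrightarrow> 0\<^sup>2 * a) (at_right 0)" by (intro tendsto_intros)
    then have ev2: "eventually (\<lambda>t. t\<^sup>2 * a < \<rho>\<^sup>2) (at_right 0)"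
      using \<rho> by (intro order_tendstoD(2)) auto
    obtain t where t: "t powr (2 - s) * a / 2 - lam / s * b < 0" "t\<^sup>2 * a < \<rho>\<^sup>2" "t > 0"
      using eventually_happens'[OF trivial_limit_at_right_real
          eventually_conj[OF ev1 eventually_conj[OF ev2 eventually_at_right_less[of 0]]]] by auto
    \<comment> \<open>The depth of the functional at t \<phi> for \<open>eta\<close> = 0 with the
      q-term dropped. It is positive for small t because s < 2 lets the concave term win.\<close>
    define g where "g = lam / s * (t powr s * b) - t\<^sup>2 * a / 2"
    have "t powr s * (t powr (2 - s) * a / 2 - lam / s * b) < 0"
      using t(1,3) by (intro mult_pos_neg) auto
    moreover have "t powr s * t powr (2 - s) = t\<^sup>2" using t(3) by (simp flip: powr_add)
    ultimately have g: "g > 0" unfolding g_def by (simp add: algebra_simps)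
    \<comment> \<open>At this value the r-term at t \<phi> would use up the whole depth g.\<close>
    define eta0 where "eta0 = g * r / (t powr r * c)"
    have "eta0 > 0" using g pos t assms by (simp add: eta0_def)
    moreover have "\<exists>u\<in>X. \<exists>w\<in>X. 0 < B u u \<and> B u u < B w w \<and>
      (\<forall>v\<in>X. B u v = (\<integral>x. rhs r s q lam eta x (u x) * v x \<partial>\<mu>)) \<and>
      (\<forall>v\<in>X. B w v = (\<integral>x. rhs r s q lam eta x (w x) * v x \<partial>\<mu>))" if eta: "eta \<in> {0..<eta0}" for eta
    proof -
      interpret concave_convex \<mu> V X B D r s q lam eta \<rho>
        by unfold_locales (use assms lam0 eta \<rho> sm\<rho> sml in auto)
      have hr: "rhs r s q lam eta x = h" for x :: 'a by (simp add: fun_eq_iff rhs_def h_def)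
      have "eta / r * (t powr r * c) < g"
      proof -
        have "eta * (t powr r * c) < g * r"
          using eta pos t by (simp add: eta0_def pos_less_divide_eq)
        then show ?thesis using assms by (simp add: field_simps)
      qed
      moreover have "0 \<le> t powr q * Pw q \<phi> / q" using assms Pw_nonneg by simp
      ultimately have I: "I (\<lambda>x. t * \<phi> x) < 0"
        unfolding I_scale[OF \<phi>(1) t(3)] g_def a_def[symmetric] b_def[symmetric] c_def[symmetric] by linarith
      obtain u where u: "critical u" "B u u < \<rho>\<^sup>2" "B u u > 0"
        using ball_minimizer[OF X_scale[OF \<phi>(1)] _ I] t(2) by (auto simp: B_scale2[OF \<phi>(1)] a_def)
      obtain w where w: "w \<in> M" "\<And>u. u \<in> M \<Longrightarrow> I w \<le> I u"
        using M_minimizer[OF \<phi>(1) B_pos[OF \<phi>]] by blast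
      have "critical w" by (rule M_minimizer_critical[OF w])
      moreover have "B u u < B w w" using M_strict[OF w(1)] u(2) by simp
      ultimately show ?thesis using u unfolding critical_def hr by blast
    qed
    ultimately show ?thesis by blast
  qed
  ultimately show ?thesis by blast
qed

section \<open>Geometry of the gasket\<close>

declare One_nat_def [simp del]

text \<open>The simplex is given by mutual distances only, so inner products have to be expressed by
  distances.\<close>

lemma inner_diff_diff_polarization:
  fixes a b c d :: "'a::real_inner"
  shows "(a - b) \<bullet> (c - d) = ((norm (a - d))\<^sup>2 + (norm (b - c))\<^sup>2 - (norm (a - c))\<^sup>2 - (norm (b - d))\<^sup>2) / 2"
  by (simp add: power2_norm_eq_inner inner_diff_left inner_diff_right inner_commute)

lemma closure_contr: "closure (contr p i ` A) = contr p i ` closure A"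
proof -
  have eq: "contr p i = (\<lambda>x. (1/2) *\<^sub>R p i + x) \<circ> (\<lambda>x. (1/2) *\<^sub>R x)"
    by (auto simp: contr_def fun_eq_iff)
  show ?thesis
    unfolding eq image_comp[symmetric] closure_translation closure_scaleR by simp
qed

lemma closure_UN_finite: "finite I \<Longrightarrow> closure (\<Union>i\<in>I. f i) = (\<Union>i\<in>I. closure (f i))"
  by (induction rule: finite_induct) auto

lemma contr_inj: "contr p i x = contr p i y \<longleftrightarrow> x = y"
  by (simp add: contr_def)

lemma dist_contr: "dist (contr p i x) (contr p i y) = dist x y / 2"
proof -
  have "contr p i x - contr p i y = (1/2) *\<^sub>R (x - y)"
    by (simp add: contr_def algebra_simps)
  then show ?thesis by (simp add: dist_norm)
qed

lemma continuous_on_contr [continuous_intros]: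
  "continuous_on A f \<Longrightarrow> continuous_on A (\<lambda>x. contr p i (f x))"
  unfolding contr_def by (intro continuous_intros)

locale simplex =
  fixes N :: nat and p :: "nat \<Rightarrow> 'a::euclidean_space"
  assumes N2: "N \<ge> 2" and vertices: "simplex_vertices N p"
begin

definition J :: "nat set" where "J = {1..N}"

lemma finite_J [simp]: "finite J" by (simp add: J_def)

lemma card_J [simp]: "card J = N" by (simp add: J_def)

lemma J_nonempty: "J \<noteq> {}" using N2 by (simp add: J_def)

lemma level_0 [simp]: "gasket_level N p 0 = p ` J" by (simp add: J_def)

lemma level_Suc [simp]: "gasket_level N p (Suc m) = (\<Union>i\<in>J. contr p i ` gasket_level N p m)"
  by (simp add: J_def)

declare gasket_level.simps [simp del]

abbreviation S :: "nat \<Rightarrow> 'a \<Rightarrow> 'a" where "S \<equiv> contr p"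
abbreviation V :: "'a set" where "V \<equiv> gasket N p"
abbreviation L :: "nat \<Rightarrow> 'a set" where "L \<equiv> gasket_level N p"

section \<open>Barycentric coordinates\<close>

definition centre :: 'a where "centre = (1 / real N) *\<^sub>R (\<Sum>k\<in>J. p k)"

text \<open>For unit edges the inner product of p i - centre and p j - centre is (N - 1) / (2N) if i
  = j and - 1 / (2N) otherwise; factor and shift turn these values into 1 and 0. The explicit affine
  formula makes continuity and Lipschitz bounds immediate.\<close>

definition bary :: "nat \<Rightarrow> 'a \<Rightarrow> real" where
  "bary j x = 2 * ((x - centre) \<bullet> (p j - centre)) + 1 / real N"

lemma N_pos: "real N > 0" using N2 by simp

lemma dist_vertices: "i \<in> J \<Longrightarrow> j \<in> J \<Longrightarrow> (norm (p i - p j))\<^sup>2 = (if i = j then 0 else 1)"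
  using vertices by (auto simp: simplex_vertices_def J_def)

lemma scaled_diff_centre: "x - centre = (1 / real N) *\<^sub>R (\<Sum>k\<in>J. x - p k)"
  using N_pos by (simp add: centre_def sum_subtractf scaleR_diff_right sum_constant_scaleR)

lemma bary_vertex:
  assumes ij: "i \<in> J" "j \<in> J"
  shows "bary j (p i) = (if i = j then 1 else 0)"
proof -
  define e where "e k l = (if k = l then 0 else 1 :: real)" for k l :: nat
  have de: "(norm (p k - p l))\<^sup>2 = e k l" if "k \<in> J" "l \<in> J" for k l
    using dist_vertices[OF that] by (simp add: e_def)
  have e1: "(\<Sum>l\<in>J. e k l) = real N - 1" "(\<Sum>l\<in>J. e l k) = real N - 1" if "k \<in> J" for k
  proof -
    have "(\<Sum>l\<in>J. e k l) = (\<Sum>l\<in>J. 1 - (if l = k then 1 else 0))"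
      by (intro sum.cong) (auto simp: e_def)
    also have "\<dots> = real N - 1" unfolding sum_subtractf using that by simp
    finally show "(\<Sum>l\<in>J. e k l) = real N - 1" .
    moreover have "e l k = e k l" for l by (simp add: e_def)
    ultimately show "(\<Sum>l\<in>J. e l k) = real N - 1" by simp
  qed
  have "(p i - centre) \<bullet> (p j - centre) =
     1 / (real N)\<^sup>2 * (\<Sum>k\<in>J. \<Sum>l\<in>J. (p i - p k) \<bullet> (p j - p l))"
    unfolding scaled_diff_centre
    by (simp add: inner_sum_left inner_sum_right power2_eq_square sum_distrib_left) (rule sum.swap)
  also have "(\<Sum>k\<in>J. \<Sum>l\<in>J. (p i - p k) \<bullet> (p j - p l)) =
      (\<Sum>k\<in>J. \<Sum>l\<in>J. (e i l + e k j - e i j - e k l) / 2)"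
    by (intro sum.cong refl, subst inner_diff_diff_polarization) (simp add: de ij)
  also have "\<dots> = (\<Sum>k\<in>J. ((real N - 1) + real N * e k j - real N * e i j - (real N - 1)) / 2)"
    by (intro sum.cong refl) (simp add: sum_divide_distrib[symmetric] sum.distrib sum_subtractf e1 ij)
  also have "\<dots> = (real N * (real N - 1) - real N * real N * e i j) / 2"
    by (simp add: sum_divide_distrib[symmetric] sum.distrib sum_subtractf sum_distrib_left[symmetric] e1 ij)
  also have "real N * (real N - 1) - real N * real N * e i j = real N * (real N - 1 - real N * e i j)"
    by (simp add: algebra_simps)
  finally have "(p i - centre) \<bullet> (p j - centre) = (real N - 1 - real N * e i j) / (real N * 2)"
    using N_pos by (simp add: power2_eq_square)
  moreover have "2 * (Y / (real N * 2)) = Y / real N" for Y by simp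
  ultimately have "2 * ((p i - centre) \<bullet> (p j - centre)) = (real N - 1 - real N * e i j) / real N"
    by (simp only:)
  then have "bary j (p i) = 1 - e i j" using N_pos unfolding bary_def by (simp add: field_simps)
  then show ?thesis by (simp add: e_def)
qed

lemma bary_S: "bary j (S i x) = bary j x / 2 + bary j (p i) / 2"
proof -
  have "S i x - centre = (1/2) *\<^sub>R (x - centre) + (1/2) *\<^sub>R (p i - centre)"
    by (simp add: contr_def algebra_simps flip: scaleR_add_left)
  then show ?thesis by (simp add: bary_def inner_add_left add_divide_distrib)
qed

lemma bary_S': "i \<in> J \<Longrightarrow> j \<in> J \<Longrightarrow> bary j (S i x) = bary j x / 2 + (if i = j then 1 / 2 else 0)"
  by (simp add: bary_S bary_vertex)

lemma sum_diff_centre: "(\<Sum>j\<in>J. p j - centre) = 0"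
  using N_pos by (simp add: centre_def sum_subtractf sum_constant_scaleR)

lemma bary_sum: "(\<Sum>j\<in>J. bary j x) = 1"
  using N_pos by (simp add: bary_def sum.distrib sum_distrib_left[symmetric] inner_sum_right[symmetric] sum_diff_centre)

text \<open>The affine hull of the vertices, written as a coincidence set of continuous maps: this
  gives closedness at once, and within it a point is determined by its coordinates.\<close>

definition affine_span :: "'a set" where
  "affine_span = {x. x = (\<Sum>j\<in>J. bary j x *\<^sub>R p j)}"

lemma vertex_span: "i \<in> J \<Longrightarrow> p i \<in> affine_span"
  by (simp add: affine_span_def bary_vertex if_distrib[of "\<lambda>c. c *\<^sub>R _"] sum.delta' cong: if_cong)

lemma S_span: "x \<in> affine_span \<Longrightarrow> i \<in> J \<Longrightarrow> S i x \<in> affine_span"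
proof -
  assume x: "x \<in> affine_span" and i: "i \<in> J"
  have "S i x = (1/2) *\<^sub>R (\<Sum>j\<in>J. bary j x *\<^sub>R p j) + (1/2) *\<^sub>R (\<Sum>j\<in>J. bary j (p i) *\<^sub>R p j)"
    using x vertex_span[OF i] unfolding contr_def affine_span_def by auto
  also have "\<dots> = (\<Sum>j\<in>J. bary j (S i x) *\<^sub>R p j)"
    by (simp add: bary_S scaleR_sum_right sum.distrib[symmetric] scaleR_add_left)
  finally show ?thesis by (simp add: affine_span_def)
qed

lemma span_eqI:
  assumes "x \<in> affine_span" "y \<in> affine_span" "\<And>j. j \<in> J \<Longrightarrow> bary j x = bary j y"
  shows "x = y"
proof -
  have "(\<Sum>j\<in>J. bary j x *\<^sub>R p j) = (\<Sum>j\<in>J. bary j y *\<^sub>R p j)"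
    by (intro sum.cong refl) (use assms(3) in simp)
  then show ?thesis using assms(1,2) unfolding affine_span_def by simp
qed

lemma bary_diff: "bary j x - bary j y = 2 * ((x - y) \<bullet> (p j - centre))"
  by (simp add: bary_def inner_diff_left inner_diff_right)

text \<open>The coordinate differences sum to 0, so x - y can be expanded in the vectors p j -
  centre; pairing with the second copy of x - y gives the coordinates again, up to the factor 1/2
  from \<open>bary_diff\<close>.\<close>

lemma norm_diff_bary:
  assumes "x \<in> affine_span" "y \<in> affine_span"
  shows "(norm (x - y))\<^sup>2 = (\<Sum>j\<in>J. (bary j x - bary j y)\<^sup>2) / 2"
proof -
  define d where "d j = bary j x - bary j y" for j
  have "x - y = (\<Sum>j\<in>J. d j *\<^sub>R p j)"
    using assms unfolding affine_span_def d_def by (simp add: scaleR_diff_left sum_subtractf)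
  moreover have "(\<Sum>j\<in>J. d j) = 0" by (simp add: d_def sum_subtractf bary_sum)
  ultimately have eq: "x - y = (\<Sum>j\<in>J. d j *\<^sub>R (p j - centre))"
    by (simp add: scaleR_diff_right sum_subtractf scaleR_sum_left[symmetric])
  have "(norm (x - y))\<^sup>2 = (x - y) \<bullet> (x - y)" by (simp add: power2_norm_eq_inner)
  also have "\<dots> = (x - y) \<bullet> (\<Sum>j\<in>J. d j *\<^sub>R (p j - centre))" using eq by simp
  also have "\<dots> = (\<Sum>j\<in>J. d j * ((x - y) \<bullet> (p j - centre)))" by (simp add: inner_sum_right)
  also have "\<dots> = (\<Sum>j\<in>J. (d j)\<^sup>2 / 2)"
    by (intro sum.cong refl) (simp add: d_def bary_diff power2_eq_square)
  finally show ?thesis by (simp add: d_def sum_divide_distrib)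
qed

lemma bary_Lipschitz:
  assumes "j \<in> J"
  shows "\<bar>bary j x - bary j y\<bar> \<le> 2 * dist x y"
proof -
  have "2 * (norm (p j - centre))\<^sup>2 + 1 / real N = 1"
    using bary_vertex[OF assms assms] by (simp add: bary_def power2_norm_eq_inner)
  moreover have "1 / real N > 0" using N_pos by simp
  ultimately have "(norm (p j - centre))\<^sup>2 \<le> 1\<^sup>2"
    using zero_le_power2[of "norm (p j - centre)"] unfolding power_one by linarith
  then have "norm (p j - centre) \<le> 1" by (rule power2_le_imp_le) simp
  then have "norm (x - y) * norm (p j - centre) \<le> norm (x - y) * 1" by (intro mult_left_mono) auto
  then show ?thesis
    using Cauchy_Schwarz_ineq2[of "x - y" "p j - centre"] by (simp add: bary_diff dist_norm abs_mult)
qed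

lemma bary_continuous: "continuous_on A (bary j)"
  unfolding bary_def by (intro continuous_intros)

definition simplex_hull :: "'a set" where
  "simplex_hull = {x \<in> affine_span. \<forall>j\<in>J. 0 \<le> bary j x}"

lemma simplex_hull_closed: "closed simplex_hull"
proof -
  have "simplex_hull = {x. x = (\<Sum>j\<in>J. bary j x *\<^sub>R p j)} \<inter> (\<Inter>j\<in>J. {x. 0 \<le> bary j x})"
    by (auto simp: simplex_hull_def affine_span_def)
  then show ?thesis
    by (auto intro!: closed_Int closed_INT closed_Collect_eq closed_Collect_le continuous_intros bary_continuous)
qed

lemma bary_le_1:
  assumes "x \<in> simplex_hull" "j \<in> J"
  shows "bary j x \<le> 1"
proof -
  have "bary j x \<le> (\<Sum>k\<in>J. bary k x)"
    using assms by (intro member_le_sum) (auto simp: simplex_hull_def)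
  then show ?thesis by (simp add: bary_sum)
qed

lemma simplex_hull_bounded: "bounded simplex_hull"
proof (rule boundedI)
  fix x assume x: "x \<in> simplex_hull"
  then have "norm x = norm (\<Sum>j\<in>J. bary j x *\<^sub>R p j)" by (simp add: simplex_hull_def affine_span_def)
  also have "\<dots> \<le> (\<Sum>j\<in>J. norm (bary j x *\<^sub>R p j))" by (rule norm_sum)
  also have "\<dots> \<le> (\<Sum>j\<in>J. norm (p j))"
  proof (rule sum_mono)
    fix j assume j: "j \<in> J"
    have "\<bar>bary j x\<bar> \<le> 1" using x j bary_le_1[OF x j] by (auto simp: simplex_hull_def)
    then show "norm (bary j x *\<^sub>R p j) \<le> norm (p j)" by (simp add: mult_left_le_one_le)
  qed
  finally show "norm x \<le> (\<Sum>j\<in>J. norm (p j))" .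
qed

lemma simplex_hull_vertex_eq:
  assumes "x \<in> simplex_hull" "j \<in> J" "bary j x \<ge> 1"
  shows "x = p j"
proof (rule span_eqI)
  show "x \<in> affine_span" using assms by (simp add: simplex_hull_def)
  show "p j \<in> affine_span" using assms by (intro vertex_span)
  fix k assume k: "k \<in> J"
  have sp: "bary j x + (\<Sum>k\<in>J-{j}. bary k x) = 1"
    using bary_sum[of x] assms(2) by (simp add: sum.remove)
  have nn: "0 \<le> bary k x" if "k \<in> J" for k using assms(1) that by (simp add: simplex_hull_def)
  have "(\<Sum>k\<in>J-{j}. bary k x) \<ge> 0" by (intro sum_nonneg nn) auto
  then have j1: "bary j x = 1" and 0: "(\<Sum>k\<in>J-{j}. bary k x) = 0" using sp assms(3) by auto
  have "\<forall>k\<in>J-{j}. bary k x = 0"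
    using 0 by (subst (asm) sum_nonneg_eq_0_iff) (auto intro: nn)
  then show "bary k x = bary k (p j)" using k j1 assms(2) by (cases "k = j") (auto simp: bary_vertex)
qed

lemma simplex_hull_vertex: "i \<in> J \<Longrightarrow> p i \<in> simplex_hull"
  by (auto simp: simplex_hull_def vertex_span bary_vertex)

lemma simplex_hull_S: "x \<in> simplex_hull \<Longrightarrow> i \<in> J \<Longrightarrow> S i x \<in> simplex_hull"
  by (auto simp: simplex_hull_def S_span bary_S')

lemma S_fix: "S i (p i) = p i"
  by (simp add: contr_def flip: scaleR_add_left)

lemma S_junction: "S i (p j) = S j (p i)"
  by (simp add: contr_def add.commute)

text \<open>Coordinate j is at least 1/2 in the image of S j but half of that of x in the image of S
  i, which forces \<open>bary j x\<close> up to 1.\<close>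

lemma S_overlap:
  assumes "S i x = S j y" "i \<noteq> j" "i \<in> J" "j \<in> J" "x \<in> simplex_hull" "y \<in> simplex_hull"
  shows "x = p j" "y = p i"
proof -
  have *: "bary j x \<ge> 1" if "S i x = S j y" "i \<noteq> j" "i \<in> J" "j \<in> J" "y \<in> simplex_hull" for i j x y
  proof -
    have "0 \<le> bary j y" using that by (simp add: simplex_hull_def)
    then show ?thesis using arg_cong[OF that(1), of "bary j"] that(2-4) by (simp add: bary_S')
  qed
  show "x = p j" by (rule simplex_hull_vertex_eq[OF assms(5,4) *[OF assms(1-4,6)]])
  show "y = p i" by (rule simplex_hull_vertex_eq[OF assms(6,3) *[OF assms(1)[symmetric] assms(2)[symmetric] assms(4,3,5)]])
qed

section \<open>The levels and the gasket as the closure of their union\<close>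

lemma level_hull: "L m \<subseteq> simplex_hull"
  by (induction m) (auto intro: simplex_hull_vertex simplex_hull_S)

lemma level_finite: "finite (L m)"
  by (induction m) auto

lemma level_mono_Suc: "L m \<subseteq> L (Suc m)"
proof (induction m)
  case 0
  show ?case
  proof
    fix x assume "x \<in> L 0"
    then obtain i where i: "i \<in> J" "x = p i" by auto
    then show "x \<in> L (Suc 0)" using S_fix[of i] by (auto intro!: bexI[of _ i] image_eqI[of _ _ "p i"])
  qed
next
  case (Suc m)
  then show ?case by (subst level_Suc, subst level_Suc) blast
qed

lemma level_mono: "m \<le> n \<Longrightarrow> L m \<subseteq> L n"
  using lift_Suc_mono_le[of L] level_mono_Suc by blast

lemma vertex_level: "i \<in> J \<Longrightarrow> p i \<in> L m"
  using level_mono[of 0 m] by auto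

text \<open>A point of A farthest from B is the image of some x in A under a contraction that halves
  the distance to B; as x is no farther from B, the maximal distance is 0.\<close>

lemma self_similar_unique:
  assumes "compact A" "A \<noteq> {}" "A = (\<Union>i\<in>J. S i ` A)"
    and "compact B" "B \<noteq> {}" "B = (\<Union>i\<in>J. S i ` B)"
  shows "A \<subseteq> B"
proof -
  obtain a where a: "a \<in> A" "\<And>x. x \<in> A \<Longrightarrow> infdist x B \<le> infdist a B"
    using continuous_attains_sup[OF assms(1,2), of "\<lambda>x. infdist x B"]
      continuous_on_infdist[OF continuous_on_id] by blast
  from a(1) assms(3) obtain i x where i: "i \<in> J" "x \<in> A" "a = S i x" by blast
  obtain b where b: "b \<in> B" "infdist x B = dist x b"
    using infdist_attains_inf[OF compact_imp_closed[OF assms(4)] assms(5)] by blast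
  have "S i b \<in> B" using assms(6) i(1) b(1) by blast
  then have "infdist a B \<le> dist (S i x) (S i b)" unfolding i(3) by (rule infdist_le)
  also have "\<dots> = infdist x B / 2" by (simp add: dist_contr b(2))
  also have "\<dots> \<le> infdist a B / 2" using a(2)[OF i(2)] by simp
  finally have "infdist a B = 0" using infdist_nonneg[of a B] by simp
  then have "infdist x B = 0" if "x \<in> A" for x using a(2)[OF that] infdist_nonneg[of x B] by simp
  then show ?thesis
    using in_closed_iff_infdist_zero[OF compact_imp_closed[OF assms(4)] assms(5)] by auto
qed

lemma closure_levels_self_similar:
  "closure (\<Union>m. L m) = (\<Union>i\<in>J. S i ` closure (\<Union>m. L m))"
proof -
  have "(\<Union>m. L m) = (\<Union>m. L (Suc m))"
    using level_mono_Suc by blast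
  also have "\<dots> = (\<Union>i\<in>J. S i ` (\<Union>m. L m))" by auto
  finally have "closure (\<Union>m. L m) = closure (\<Union>i\<in>J. S i ` (\<Union>m. L m))" by simp
  also have "\<dots> = (\<Union>i\<in>J. closure (S i ` (\<Union>m. L m)))" by (rule closure_UN_finite) simp
  finally show ?thesis unfolding closure_contr .
qed

lemma closure_levels_hull: "closure (\<Union>m. L m) \<subseteq> simplex_hull"
  using level_hull by (intro closure_minimal simplex_hull_closed) blast

lemma gasket_eq: "V = closure (\<Union>m. L m)"
proof -
  let ?C = "closure (\<Union>m. L m)"
  have C: "compact ?C \<and> ?C \<noteq> {} \<and> ?C = (\<Union>i\<in>J. S i ` ?C)"
  proof (intro conjI closure_levels_self_similar)
    show "compact ?C"
      using bounded_subset[OF simplex_hull_bounded closure_levels_hull] by (simp add: compact_eq_bounded_closed)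
    have "L 0 \<subseteq> ?C" by (rule order_trans[OF _ closure_subset]) (rule UN_upper, simp)
    moreover have "L 0 \<noteq> {}" using J_nonempty by simp
    ultimately show "?C \<noteq> {}" by blast
  qed
  have eqC: "B = ?C" if "compact B \<and> B \<noteq> {} \<and> B = (\<Union>i\<in>J. S i ` B)" for B
  proof -
    from that have b: "compact B" "B \<noteq> {}" "B = (\<Union>i\<in>J. S i ` B)" by blast+
    from C have c: "compact ?C" "?C \<noteq> {}" "?C = (\<Union>i\<in>J. S i ` ?C)" by blast+
    show ?thesis by (rule antisym[OF self_similar_unique[OF b c] self_similar_unique[OF c b]])
  qed
  show ?thesis unfolding gasket_def J_def[symmetric] by (rule the_equality) (rule C, rule eqC)
qed

lemma V_compact: "compact V"
  unfolding gasket_eq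
  using bounded_subset[OF simplex_hull_bounded closure_levels_hull] by (simp add: compact_eq_bounded_closed)

lemma V_hull: "V \<subseteq> simplex_hull" unfolding gasket_eq by (rule closure_levels_hull)

lemma level_V: "L m \<subseteq> V"
  unfolding gasket_eq by (rule order_trans[OF _ closure_subset]) (rule UN_upper, simp)

lemma vertex_V: "i \<in> J \<Longrightarrow> p i \<in> V" using vertex_level[of i 0] level_V by blast

lemma S_V: "x \<in> V \<Longrightarrow> i \<in> J \<Longrightarrow> S i x \<in> V"
  using closure_levels_self_similar unfolding gasket_eq by blast

lemma V_cases:
  assumes "x \<in> V"
  obtains i y where "i \<in> J" "y \<in> V" "x = S i y"
  using assms closure_levels_self_similar unfolding gasket_eq by blast

lemma V_eq: "V = (\<Union>i\<in>J. S i ` V)"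
  unfolding gasket_eq by (rule closure_levels_self_similar)

lemma V_overlap:
  assumes "S i x = S j y" "i \<noteq> j" "i \<in> J" "j \<in> J" "x \<in> V" "y \<in> V"
  shows "x = p j" "y = p i"
  using S_overlap[of i x j y] assms V_hull by blast+

lemma V_bound_of_levels:
  assumes "continuous_on V u" "\<And>m x. x \<in> L m \<Longrightarrow> \<bar>u x\<bar> \<le> (K::real)" "x \<in> V"
  shows "\<bar>u x\<bar> \<le> K"
  using continuous_on_closure_norm_le[of "\<Union>m. L m" u K x] assms unfolding gasket_eq by auto

end

section \<open>Cell energies and harmonic functions\<close>

context simplex
begin

definition rn :: real where "rn = (real N + 2) / real N"

lemma rn_gt1: "rn > 1" using N_pos by (simp add: rn_def)

lemma rn_pos: "rn > 0" using rn_gt1 by simp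

definition vform :: "(nat \<Rightarrow> real) \<Rightarrow> (nat \<Rightarrow> real) \<Rightarrow> real" where
  "vform f g = (\<Sum>i\<in>J. \<Sum>j\<in>J. (f i - f j) * (g i - g j))"

text \<open>The recursion removes the outermost contraction and sums over cells instead of pairs of
  points, so pairs across cells never appear and the self-similarity is built in.\<close>

primrec cform :: "nat \<Rightarrow> ('a \<Rightarrow> real) \<Rightarrow> ('a \<Rightarrow> real) \<Rightarrow> real" where
  "cform 0 = (\<lambda>u v. vform (\<lambda>i. u (p i)) (\<lambda>i. v (p i)))"
| "cform (Suc m) = (\<lambda>u v. rn * (\<Sum>i\<in>J. cform m (\<lambda>x. u (S i x)) (\<lambda>x. v (S i x))))"

lemma vform_cong: "(\<And>i. i \<in> J \<Longrightarrow> f i = f' i) \<Longrightarrow> (\<And>i. i \<in> J \<Longrightarrow> g i = g' i) \<Longrightarrow> vform f g = vform f' g'"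
  unfolding vform_def by (intro sum.cong refl) simp

lemma vform_nonneg: "0 \<le> vform f f"
  unfolding vform_def by (intro sum_nonneg) simp

lemma vform_ge: "i \<in> J \<Longrightarrow> (\<Sum>j\<in>J. (f i - f j)\<^sup>2) \<le> vform f f"
  unfolding vform_def power2_eq_square
  by (rule member_le_sum) (auto intro!: sum_nonneg)

lemma vform_ge1: "i \<in> J \<Longrightarrow> j \<in> J \<Longrightarrow> (f i - f j)\<^sup>2 \<le> vform f f"
  by (rule order_trans[OF _ vform_ge[of i]]) (auto intro!: member_le_sum[of j J "\<lambda>j. (f i - f j)\<^sup>2"])

lemma vform_eq: "vform f g = 2 * (real N * (\<Sum>i\<in>J. f i * g i) - (\<Sum>i\<in>J. f i) * (\<Sum>i\<in>J. g i))"
proof -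
  have "vform f g = (\<Sum>i\<in>J. \<Sum>j\<in>J. f i * g i + f j * g j - f i * g j - g i * f j)"
    unfolding vform_def by (intro sum.cong refl) (simp add: algebra_simps)
  also have "\<dots> = (\<Sum>i\<in>J. real N * (f i * g i) + (\<Sum>j\<in>J. f j * g j) - f i * (\<Sum>j\<in>J. g j) - g i * (\<Sum>j\<in>J. f j))"
    by (intro sum.cong refl) (simp add: sum.distrib sum_subtractf sum_distrib_left)
  also have "\<dots> = 2 * (real N * (\<Sum>i\<in>J. f i * g i) - (\<Sum>i\<in>J. f i) * (\<Sum>i\<in>J. g i))"
    by (simp add: sum.distrib sum_subtractf sum_distrib_left[symmetric] sum_distrib_right[symmetric] algebra_simps)
  finally show ?thesis .
qed

lemma cform_cong:
  "(\<And>x. x \<in> V \<Longrightarrow> u x = u' x) \<Longrightarrow> (\<And>x. x \<in> V \<Longrightarrow> v x = v' x) \<Longrightarrow> cform m u v = cform m u' v'"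
proof (induction m arbitrary: u u' v v')
  case 0
  then show ?case by (auto intro!: vform_cong vertex_V)
next
  case (Suc m)
  have "cform m (\<lambda>x. u (S i x)) (\<lambda>x. v (S i x)) = cform m (\<lambda>x. u' (S i x)) (\<lambda>x. v' (S i x))" if "i \<in> J" for i
    by (rule Suc.IH) (use Suc.prems S_V that in auto)
  then show ?case by simp
qed

lemma cform_nonneg: "0 \<le> cform m u u"
  by (induction m arbitrary: u) (auto intro!: vform_nonneg mult_nonneg_nonneg sum_nonneg simp: rn_pos less_imp_le)

lemma cform_sym: "cform m u v = cform m v u"
  by (induction m arbitrary: u v) (simp_all add: vform_def mult.commute)

lemma cform_lin: "cform m (\<lambda>x. u x + c * v x) w = cform m u w + c * cform m v w"
proof (induction m arbitrary: u v w)
  case 0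
  have "vform (\<lambda>i. u (p i) + c * v (p i)) (\<lambda>i. w (p i)) =
    (\<Sum>i\<in>J. \<Sum>j\<in>J. (u (p i) - u (p j)) * (w (p i) - w (p j)) + c * ((v (p i) - v (p j)) * (w (p i) - w (p j))))"
    unfolding vform_def by (intro sum.cong refl) (simp add: algebra_simps)
  also have "\<dots> = vform (\<lambda>i. u (p i)) (\<lambda>i. w (p i)) + c * vform (\<lambda>i. v (p i)) (\<lambda>i. w (p i))"
    unfolding vform_def by (simp add: sum.distrib sum_distrib_left)
  finally show ?case by simp
next
  case (Suc m)
  show ?case by (simp add: Suc.IH sum.distrib sum_distrib_left algebra_simps)
qed

lemma cform_lin_right: "cform m w (\<lambda>x. u x + c * v x) = cform m w u + c * cform m w v"
  using cform_lin[of m u c v w] by (simp add: cform_sym)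

lemma cform_expand:
  "cform m (\<lambda>x. u x + c * v x) (\<lambda>x. u x + c * v x) = cform m u u + 2 * c * cform m u v + c\<^sup>2 * cform m v v"
  by (simp add: cform_lin cform_lin_right cform_sym[of m v u] power2_eq_square algebra_simps)

lemma cform_tendsto:
  "(\<And>x. x \<in> V \<Longrightarrow> (\<lambda>n. u n x) \<longlonglongrightarrow> u' x) \<Longrightarrow> (\<lambda>n. cform m (u n) (u n)) \<longlonglongrightarrow> cform m u' u'"
proof (induction m arbitrary: u u')
  case 0
  then show ?case unfolding cform.simps vform_def by (intro tendsto_intros) (auto intro: vertex_V)
next
  case (Suc m)
  then show ?case unfolding cform.simps by (intro tendsto_intros Suc.IH) (auto intro: S_V)
qed

section \<open>The harmonic extension rule\<close>

definition vmap :: "(nat \<Rightarrow> real) \<Rightarrow> nat \<Rightarrow> nat \<Rightarrow> real" where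
  "vmap f i k = (if k = i then f i else (f i + f k + (\<Sum>l\<in>J. f l)) / (real N + 2))"

lemma vmap_sym: "vmap f i j = vmap f j i"
  by (simp add: vmap_def add.commute)

text \<open>\<open>vmap\<close> is the harmonic extension rule: relative to the affine values
  \<open>(2 f i + \<Sigma> f) / (N + 2)\<close> it is antisymmetric off the diagonal, so only the diagonal pairs with
  a symmetric family.\<close>

lemma vmap_decomp:
  "vmap f i k = (2 * f i + (\<Sum>l\<in>J. f l)) / (real N + 2) + (f k - f i) / (real N + 2)
     + (if k = i then (real N * f i - (\<Sum>l\<in>J. f l)) / (real N + 2) else 0)"
proof -
  have "real N + 2 > 0" by simp
  then show ?thesis by (auto simp: vmap_def add_divide_distrib[symmetric]) (simp add: field_simps)
qed

lemma sum_vmap: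
  assumes "i \<in> J"
  shows "(\<Sum>k\<in>J. vmap f i k) = real N * (2 * f i + (\<Sum>l\<in>J. f l)) / (real N + 2)"
proof -
  define s where "s = (\<Sum>l\<in>J. f l)"
  have "(\<Sum>k\<in>J. vmap f i k) = (\<Sum>k\<in>J. (2 * f i + s) / (real N + 2)) + (\<Sum>k\<in>J. (f k - f i) / (real N + 2)) +
     (\<Sum>k\<in>J. if k = i then (real N * f i - s) / (real N + 2) else 0)"
    unfolding vmap_decomp s_def[symmetric] by (simp only: sum.distrib)
  also have "(\<Sum>k\<in>J. if k = i then (real N * f i - s) / (real N + 2) else 0) = (real N * f i - s) / (real N + 2)"
    using assms by simp
  also have "(\<Sum>k\<in>J. (f k - f i) / (real N + 2)) = - ((real N * f i - s) / (real N + 2))"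
    by (simp add: sum_divide_distrib[symmetric] sum_subtractf s_def diff_divide_distrib)
  finally show ?thesis by (simp add: s_def)
qed

lemma sum_antisym:
  fixes a :: "nat \<Rightarrow> nat \<Rightarrow> real"
  assumes "\<And>i k. i \<in> J \<Longrightarrow> k \<in> J \<Longrightarrow> a i k = - a k i"
  shows "(\<Sum>i\<in>J. \<Sum>k\<in>J. a i k) = 0"
proof -
  have "(\<Sum>i\<in>J. \<Sum>k\<in>J. a i k) = (\<Sum>i\<in>J. \<Sum>k\<in>J. - a k i)"
    by (intro sum.cong refl) (rule assms)
  also have "\<dots> = - (\<Sum>i\<in>J. \<Sum>k\<in>J. a k i)" by (simp add: sum_negf)
  also have "(\<Sum>i\<in>J. \<Sum>k\<in>J. a k i) = (\<Sum>i\<in>J. \<Sum>k\<in>J. a i k)" by (rule sum.swap)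
  finally show ?thesis by simp
qed

text \<open>Summation by parts for one subdivision. Symmetry of \<open>a\<close> says that cells i
  and k share the junction value; the extension rule balances the differences there, so junction
  values cancel and the diagonal remains. \<open>rn\<close> is the factor that makes this
  exact.\<close>

lemma vform_vmap:
  assumes sym: "\<And>i k. i \<in> J \<Longrightarrow> k \<in> J \<Longrightarrow> a i k = a k i"
  shows "rn * (\<Sum>i\<in>J. vform (a i) (vmap f i)) = vform (\<lambda>i. a i i) f"
proof -
  define s where "s = (\<Sum>l\<in>J. f l)"
  have "vform (a i) (vmap f i) =
      2 * real N * ((\<Sum>k\<in>J. a i k * (f k - f i)) / (real N + 2) + a i i * (real N * f i - s) / (real N + 2))"
    if i: "i \<in> J" for i
  proof -
    have "vform (a i) (vmap f i) = 2 * (real N * (\<Sum>k\<in>J. a i k * vmap f i k) -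
        (\<Sum>k\<in>J. a i k) * (real N * (2 * f i + s) / (real N + 2)))"
      unfolding vform_eq sum_vmap[OF i] s_def ..
    also have "(\<Sum>k\<in>J. a i k * vmap f i k) = (\<Sum>k\<in>J. a i k * ((2 * f i + s) / (real N + 2))) +
        (\<Sum>k\<in>J. a i k * (f k - f i) / (real N + 2)) + (\<Sum>k\<in>J. if k = i then a i i * (real N * f i - s) / (real N + 2) else 0)"
      unfolding vmap_decomp s_def[symmetric] sum.distrib[symmetric]
      by (intro sum.cong refl) (simp add: distrib_left)
    also have "(\<Sum>k\<in>J. if k = i then a i i * (real N * f i - s) / (real N + 2) else 0) = a i i * (real N * f i - s) / (real N + 2)"
      using i by simp
    also have "(\<Sum>k\<in>J. a i k * ((2 * f i + s) / (real N + 2))) = (\<Sum>k\<in>J. a i k) * ((2 * f i + s) / (real N + 2))"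
      by (rule sum_distrib_right[symmetric])
    also have "(\<Sum>k\<in>J. a i k * (f k - f i) / (real N + 2)) = (\<Sum>k\<in>J. a i k * (f k - f i)) / (real N + 2)"
      by (rule sum_divide_distrib[symmetric])
    finally show ?thesis
      by (simp only: times_divide_eq_right distrib_left right_diff_distrib mult_ac)
  qed
  then have "(\<Sum>i\<in>J. vform (a i) (vmap f i)) = 2 * real N * ((\<Sum>i\<in>J. \<Sum>k\<in>J. a i k * (f k - f i)) / (real N + 2) +
      (\<Sum>i\<in>J. a i i * (real N * f i - s)) / (real N + 2))"
    by (simp add: sum_distrib_left[symmetric] sum.distrib sum_divide_distrib)
  also have "(\<Sum>i\<in>J. \<Sum>k\<in>J. a i k * (f k - f i)) = 0"
    by (rule sum_antisym) (simp add: sym algebra_simps)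
  also have "(\<Sum>i\<in>J. a i i * (real N * f i - s)) = real N * (\<Sum>i\<in>J. a i i * f i) - (\<Sum>i\<in>J. a i i) * s"
    by (simp add: right_diff_distrib sum_subtractf sum_distrib_left sum_distrib_right mult.left_commute)
  finally show ?thesis
    using N_pos by (simp add: vform_eq rn_def s_def field_simps)
qed

definition spread :: "(nat \<Rightarrow> real) \<Rightarrow> real \<Rightarrow> bool" where
  "spread f K \<longleftrightarrow> (\<forall>i\<in>J. \<forall>j\<in>J. \<bar>f i - f j\<bar> \<le> K)"

text \<open>A junction value minus f i is a sum of N differences of f divided by N + 2, after the
  vanishing one is left out, and N / (N + 2) is \<open>1 / rn\<close>.\<close>

lemma spread_vmap:
  assumes f: "spread f K" and i: "i \<in> J"
  shows "spread (vmap f i) (K / rn)"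
proof -
  have K: "\<bar>f k - f l\<bar> \<le> K" if "k \<in> J" "l \<in> J" for k l using f that by (simp add: spread_def)
  have K0: "K \<ge> 0" using K[OF i i] by simp
  have rn: "K / rn = real N * K / (real N + 2)" by (simp add: rn_def)
  have *: "\<bar>vmap f i k - f i\<bar> \<le> K / rn" if k: "k \<in> J" for k
  proof (cases "k = i")
    case False
    have "vmap f i k - f i = ((f k - f i) + (\<Sum>l\<in>J. f l - f i)) / (real N + 2)"
      using False by (simp add: vmap_def sum_subtractf field_simps)
    also have "(\<Sum>l\<in>J. f l - f i) = (\<Sum>l\<in>J-{i}. f l - f i)" using i by (simp add: sum.remove)
    finally have "\<bar>vmap f i k - f i\<bar> = \<bar>(f k - f i) + (\<Sum>l\<in>J-{i}. f l - f i)\<bar> / (real N + 2)"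
      by simp
    also have "\<bar>(f k - f i) + (\<Sum>l\<in>J-{i}. f l - f i)\<bar> \<le> K + (\<Sum>l\<in>J-{i}. K)"
      by (intro order_trans[OF abs_triangle_ineq] add_mono order_trans[OF sum_abs] sum_mono K i k) auto
    also have "K + (\<Sum>l\<in>J-{i}. K) = real N * K" using i N2 by (simp add: of_nat_diff algebra_simps)
    finally show ?thesis unfolding rn by (simp add: divide_right_mono)
  qed (use K0 rn_pos in \<open>simp add: vmap_def\<close>)
  have "\<bar>vmap f i k - vmap f i l\<bar> \<le> K / rn" if k: "k \<in> J" and l: "l \<in> J" for k l
  proof (cases "k = i \<or> l = i")
    case True
    then show ?thesis using *[OF k] *[OF l] by (auto simp: vmap_def abs_minus_commute)
  next
    case False
    then have "vmap f i k - vmap f i l = (f k - f l) / (real N + 2)"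
      by (simp add: vmap_def diff_divide_distrib[symmetric])
    then have "\<bar>vmap f i k - vmap f i l\<bar> = \<bar>f k - f l\<bar> / (real N + 2)" by simp
    also have "\<dots> \<le> (real N * K) / (real N + 2)"
    proof (rule divide_right_mono)
      have "1 * K \<le> real N * K" using K0 N2 by (intro mult_right_mono) auto
      then show "\<bar>f k - f l\<bar> \<le> real N * K" using K[OF k l] by simp
    qed simp
    finally show ?thesis unfolding rn .
  qed
  then show ?thesis by (simp add: spread_def)
qed

text \<open>Here \<open>2 *\<^sub>R x - p i\<close> inverts S i. A point in several cells gets an
  arbitrary one of them; \<open>glue_S\<close> shows that the choice is irrelevant when the pieces
  agree at the junctions.\<close>

definition glue :: "(nat \<Rightarrow> 'a \<Rightarrow> real) \<Rightarrow> 'a \<Rightarrow> real" where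
  "glue g x = (let i = (SOME i. i \<in> J \<and> x \<in> S i ` V) in g i (2 *\<^sub>R x - p i))"

lemma glue_S:
  assumes g: "\<And>i j. i \<in> J \<Longrightarrow> j \<in> J \<Longrightarrow> g i (p j) = g j (p i)" and i: "i \<in> J" and y: "y \<in> V"
  shows "glue g (S i y) = g i y"
proof -
  define j where "j = (SOME j. j \<in> J \<and> S i y \<in> S j ` V)"
  have "j \<in> J \<and> S i y \<in> S j ` V" unfolding j_def by (rule someI[of _ i]) (use i y in auto)
  then obtain z where z: "j \<in> J" "z \<in> V" "S i y = S j z" by blast
  have inv: "2 *\<^sub>R S j z - p j = z" by (simp add: contr_def scaleR_add_right)
  have "glue g (S i y) = g j z" unfolding glue_def j_def[symmetric] using z(3) inv by (simp add: Let_def)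
  also have "g j z = g i y"
  proof (cases "i = j")
    case True
    then show ?thesis using z(3) by (simp add: contr_inj)
  next
    case False
    then show ?thesis using V_overlap[OF z(3) False i z(1) y z(2)] g[OF i z(1)] by simp
  qed
  finally show ?thesis .
qed

lemma glue_cont:
  assumes g: "\<And>i j. i \<in> J \<Longrightarrow> j \<in> J \<Longrightarrow> g i (p j) = g j (p i)" and c: "\<And>i. i \<in> J \<Longrightarrow> continuous_on V (g i)"
  shows "continuous_on V (glue g)"
proof -
  have "continuous_on (\<Union>i\<in>J. S i ` V) (glue g)"
  proof (rule continuous_on_closed_Union)
    fix i assume i: "i \<in> J"
    show "closed (S i ` V)"
      by (intro compact_imp_closed compact_continuous_image V_compact continuous_intros)
    have "continuous_on (S i ` V) (\<lambda>x. g i (2 *\<^sub>R x - p i))"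
      by (rule continuous_on_compose2[OF c[OF i]])
        (auto intro!: continuous_intros simp: contr_def scaleR_add_right)
    then show "continuous_on (S i ` V) (glue g)"
    proof (rule continuous_on_eq)
      fix x assume "x \<in> S i ` V"
      then obtain y where y: "y \<in> V" "x = S i y" by blast
      have "glue g (S i y) = g i y" by (rule glue_S) (use g i y in auto)
      then show "g i (2 *\<^sub>R x - p i) = glue g x" by (simp add: y(2) contr_def scaleR_add_right)
    qed
  qed simp
  then show ?thesis using V_eq by simp
qed

text \<open>n steps of harmonic subdivision followed by affine interpolation in the cells:
  approximations that are continuous on all of V, not only defined at the vertices.\<close>

primrec Hn :: "nat \<Rightarrow> (nat \<Rightarrow> real) \<Rightarrow> 'a \<Rightarrow> real" where
  "Hn 0 = (\<lambda>f x. \<Sum>j\<in>J. f j * bary j x)"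
| "Hn (Suc n) = (\<lambda>f. glue (\<lambda>i. Hn n (vmap f i)))"

lemma Hn_vertex: "i \<in> J \<Longrightarrow> Hn n f (p i) = f i"
proof (induction n arbitrary: f i)
  case 0
  have "(\<Sum>j\<in>J. f j * bary j (p i)) = (\<Sum>j\<in>J. if j = i then f i else 0)"
    by (intro sum.cong refl) (use 0 in \<open>auto simp: bary_vertex\<close>)
  then show ?case using 0 by simp
next
  case (Suc n)
  have "Hn (Suc n) f (S i (p i)) = Hn n (vmap f i) (p i)"
    unfolding Hn.simps by (rule glue_S) (simp_all add: Suc vmap_sym vertex_V)
  also have "\<dots> = f i" using Suc by (simp add: vmap_def)
  finally show ?case by (simp only: S_fix)
qed

lemma Hn_S: "i \<in> J \<Longrightarrow> y \<in> V \<Longrightarrow> Hn (Suc n) f (S i y) = Hn n (vmap f i) y"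
  unfolding Hn.simps by (rule glue_S) (simp_all add: Hn_vertex vmap_sym)

lemma Hn_cont: "continuous_on V (Hn n f)"
proof (induction n arbitrary: f)
  case 0
  show ?case unfolding Hn.simps by (intro continuous_intros bary_continuous)
next
  case (Suc n)
  show ?case unfolding Hn.simps by (rule glue_cont) (simp_all add: Hn_vertex vmap_sym Suc)
qed

lemma Hn0_diff:
  assumes "spread f K" "i \<in> J" "x \<in> V"
  shows "\<bar>Hn 0 f x - f i\<bar> \<le> K"
proof -
  have x: "x \<in> simplex_hull" using V_hull assms(3) by blast
  have b: "0 \<le> bary j x" if "j \<in> J" for j using x that by (simp add: simplex_hull_def)
  have "Hn 0 f x - f i = (\<Sum>j\<in>J. f j * bary j x) - f i * (\<Sum>j\<in>J. bary j x)" by (simp add: bary_sum)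
  also have "\<dots> = (\<Sum>j\<in>J. (f j - f i) * bary j x)"
    by (simp add: sum_distrib_left sum_subtractf[symmetric] left_diff_distrib)
  finally have "\<bar>Hn 0 f x - f i\<bar> \<le> (\<Sum>j\<in>J. \<bar>(f j - f i) * bary j x\<bar>)" by simp
  also have "\<dots> \<le> (\<Sum>j\<in>J. K * bary j x)"
    by (intro sum_mono) (use assms b in \<open>auto simp: abs_mult spread_def intro!: mult_right_mono\<close>)
  also have "\<dots> = K" by (simp add: sum_distrib_left[symmetric] bary_sum)
  finally show ?thesis .
qed

text \<open>Each subdivision shrinks the spread of the vertex values by \<open>1 / rn\<close>, so
  only the first step has to be estimated; there both functions are within K of a common vertex
  value.\<close>

lemma Hn_step: "spread f K \<Longrightarrow> x \<in> V \<Longrightarrow> \<bar>Hn (Suc n) f x - Hn n f x\<bar> \<le> 2 * K * (1 / rn) ^ n"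
proof (induction n arbitrary: f K x)
  case 0
  obtain i y where i: "i \<in> J" "y \<in> V" "x = S i y" using V_cases[OF 0(2)] by blast
  have K0: "0 \<le> K" using 0(1) i(1) by (fastforce simp: spread_def)
  have "\<bar>Hn 0 (vmap f i) y - vmap f i i\<bar> \<le> K / rn"
    by (rule Hn0_diff[OF spread_vmap[OF 0(1) i(1)] i(1,2)])
  also have "\<dots> \<le> K" using K0 rn_gt1 by (simp add: divide_le_eq mult_le_cancel_left1)
  finally have "\<bar>Hn 1 f x - f i\<bar> \<le> K"
    using Hn_S[OF i(1,2), of 0 f] i(3) by (simp add: vmap_def One_nat_def)
  moreover have "\<bar>Hn 0 f x - f i\<bar> \<le> K" by (rule Hn0_diff[OF 0(1) i(1) 0(2)])
  ultimately show ?case unfolding One_nat_def by (simp del: Hn.simps)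
next
  case (Suc n)
  obtain i y where i: "i \<in> J" "y \<in> V" "x = S i y" using V_cases[OF Suc.prems(2)] by blast
  have "\<bar>Hn (Suc n) (vmap f i) y - Hn n (vmap f i) y\<bar> \<le> 2 * (K / rn) * (1 / rn) ^ n"
    by (rule Suc.IH[OF spread_vmap[OF Suc.prems(1) i(1)] i(2)])
  then show ?case unfolding i(3) Hn_S[OF i(1,2)] by simp
qed

definition H :: "(nat \<Rightarrow> real) \<Rightarrow> 'a \<Rightarrow> real" where
  "H f x = lim (\<lambda>n. Hn n f x)"

lemma spread_exists: "\<exists>K. spread f K"
proof -
  have "\<bar>f i - f j\<bar> \<le> 2 * (\<Sum>k\<in>J. \<bar>f k\<bar>)" if "i \<in> J" "j \<in> J" for i j
    using member_le_sum[of i J "\<lambda>k. \<bar>f k\<bar>"] member_le_sum[of j J "\<lambda>k. \<bar>f k\<bar>"] that by simp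
  then show ?thesis unfolding spread_def by blast
qed

lemma Hn_uniform: "uniform_limit V (\<lambda>n. Hn n f) (H f) sequentially"
proof -
  obtain K where K: "spread f K" using spread_exists by blast
  have q: "\<bar>1 / rn\<bar> < 1" using rn_gt1 by simp
  have sum: "summable (\<lambda>n. 2 * K * (1 / rn) ^ n)" by (intro summable_mult summable_geometric) (use q in simp)
  have "uniform_limit V (\<lambda>n x. \<Sum>k<n. Hn (Suc k) f x - Hn k f x) (\<lambda>x. \<Sum>k. Hn (Suc k) f x - Hn k f x) sequentially"
    by (rule Weierstrass_m_test[OF _ sum]) (use Hn_step[OF K] in simp)
  then have "uniform_limit V (\<lambda>n x. Hn n f x - Hn 0 f x) (\<lambda>x. \<Sum>k. Hn (Suc k) f x - Hn k f x) sequentially"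
    by (simp only: sum_lessThan_telescope[of "\<lambda>n. Hn n f _"])
  then have "uniform_limit V (\<lambda>n x. (Hn n f x - Hn 0 f x) + Hn 0 f x) (\<lambda>x. (\<Sum>k. Hn (Suc k) f x - Hn k f x) + Hn 0 f x) sequentially"
    by (rule uniform_limit_add) (rule uniform_limit_const)
  then have *: "uniform_limit V (\<lambda>n x. Hn n f x) (\<lambda>x. (\<Sum>k. Hn (Suc k) f x - Hn k f x) + Hn 0 f x) sequentially"
    by (simp only: diff_add_cancel)
  have "H f x = (\<Sum>k. Hn (Suc k) f x - Hn k f x) + Hn 0 f x" if "x \<in> V" for x
    unfolding H_def by (rule limI[OF tendsto_uniform_limitI[OF * that]])
  then show ?thesis using * by (subst uniform_limit_cong'[where g = "\<lambda>n x. Hn n f x"]) auto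
qed

lemma Hn_tendsto: "x \<in> V \<Longrightarrow> (\<lambda>n. Hn n f x) \<longlonglongrightarrow> H f x"
  by (rule tendsto_uniform_limitI[OF Hn_uniform])

lemma H_cont: "continuous_on V (H f)"
  by (rule uniform_limit_theorem[OF _ Hn_uniform]) (auto simp: Hn_cont)

lemma H_vertex: "i \<in> J \<Longrightarrow> H f (p i) = f i"
  unfolding H_def by (simp add: Hn_vertex)

lemma H_S: "i \<in> J \<Longrightarrow> y \<in> V \<Longrightarrow> H f (S i y) = H (vmap f i) y"
  using LIMSEQ_unique[OF LIMSEQ_Suc[OF Hn_tendsto[OF S_V]] ] Hn_tendsto[of y "vmap f i"]
  by (simp only: Hn_S)

text \<open>Discrete Gauss-Green formula: by \<open>vform_vmap\<close> the inner values of v cancel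
  level by level, the symmetric family being v (S i (p k)). So \<open>H f\<close> is orthogonal at
  every level to functions vanishing at the vertices.\<close>

lemma cform_H: "cform m v (H f) = vform (\<lambda>i. v (p i)) f"
proof (induction m arbitrary: v f)
  case 0
  show ?case by (auto intro!: vform_cong simp: H_vertex)
next
  case (Suc m)
  have "cform m (\<lambda>x. v (S i x)) (\<lambda>x. H f (S i x)) = vform (\<lambda>k. v (S i (p k))) (vmap f i)" if "i \<in> J" for i
  proof -
    have "cform m (\<lambda>x. v (S i x)) (\<lambda>x. H f (S i x)) = cform m (\<lambda>x. v (S i x)) (H (vmap f i))"
      by (rule cform_cong) (simp_all add: H_S that)
    then show ?thesis by (simp add: Suc.IH)
  qed
  then have "cform (Suc m) v (H f) = rn * (\<Sum>i\<in>J. vform (\<lambda>k. v (S i (p k))) (vmap f i))" by simp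
  also have "\<dots> = vform (\<lambda>i. v (S i (p i))) f"
    by (rule vform_vmap) (simp add: S_junction)
  finally show ?case by (simp only: S_fix)
qed

text \<open>The harmonic spline of level K: it interpolates u at the vertices of the K-cells and is
  harmonic inside each of them.\<close>

primrec G :: "nat \<Rightarrow> ('a \<Rightarrow> real) \<Rightarrow> 'a \<Rightarrow> real" where
  "G 0 = (\<lambda>u. H (\<lambda>i. u (p i)))"
| "G (Suc K) = (\<lambda>u. glue (\<lambda>i. G K (\<lambda>x. u (S i x))))"

lemma G_vertex: "i \<in> J \<Longrightarrow> G K u (p i) = u (p i)"
proof (induction K arbitrary: u i)
  case (Suc K)
  have "G (Suc K) u (S i (p i)) = G K (\<lambda>x. u (S i x)) (p i)"
    unfolding G.simps by (rule glue_S) (simp_all add: Suc S_junction vertex_V)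
  also have "\<dots> = u (S i (p i))" using Suc by simp
  finally show ?case by (simp only: S_fix)
qed (simp add: H_vertex)

lemma G_S: "i \<in> J \<Longrightarrow> y \<in> V \<Longrightarrow> G (Suc K) u (S i y) = G K (\<lambda>x. u (S i x)) y"
  unfolding G.simps by (rule glue_S) (simp_all add: G_vertex S_junction)

lemma G_cont: "continuous_on V (G K u)"
proof (induction K arbitrary: u)
  case 0
  show ?case by (simp add: H_cont)
next
  case (Suc K)
  show ?case unfolding G.simps by (rule glue_cont) (simp_all add: G_vertex S_junction Suc)
qed

lemma cform_G: "K \<le> m \<Longrightarrow> cform m v (G K u) = cform K v u"
proof (induction K arbitrary: m u v)
  case 0
  show ?case by (simp add: cform_H)
next
  case (Suc K)
  then obtain m' where m: "m = Suc m'" "K \<le> m'" by (cases m) auto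
  have "cform m' (\<lambda>x. v (S i x)) (\<lambda>x. G (Suc K) u (S i x)) = cform K (\<lambda>x. v (S i x)) (\<lambda>x. u (S i x))" if "i \<in> J" for i
  proof -
    have "cform m' (\<lambda>x. v (S i x)) (\<lambda>x. G (Suc K) u (S i x)) = cform m' (\<lambda>x. v (S i x)) (G K (\<lambda>x. u (S i x)))"
      by (rule cform_cong[OF refl]) (rule G_S[OF that])
    then show ?thesis using Suc.IH[OF m(2)] by simp
  qed
  then show ?case unfolding m(1) cform.simps by simp
qed

lemma cform_G_G: "K \<le> m \<Longrightarrow> cform m (G K u) (G K u) = cform K u u"
  using cform_G[of K m "G K u" u] cform_G[of K K u u] by (simp add: cform_sym)

text \<open>Pythagoras: from level K on, u minus its spline is orthogonal to the spline.
  Monotonicity of the cell energies follows.\<close>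

lemma cform_diff_G:
  assumes "K \<le> m"
  shows "cform m (\<lambda>x. u x + (- 1) * G K u x) (\<lambda>x. u x + (- 1) * G K u x) = cform m u u - cform K u u"
  unfolding cform_expand using cform_G[OF assms, of u u] cform_G_G[OF assms, of u] by simp

lemma cform_mono: "K \<le> m \<Longrightarrow> cform K u u \<le> cform m u u"
  using cform_diff_G[of K m u] cform_nonneg[of m "\<lambda>x. u x + (- 1) * G K u x"] by simp

end

section \<open>Neighbouring points\<close>

lemma int_sum_eq_1:
  fixes f :: "'b \<Rightarrow> int"
  assumes "finite K" "\<And>k. k \<in> K \<Longrightarrow> 0 \<le> f k" "sum f K = 1"
  obtains l where "l \<in> K" "f l = 1" "\<And>k. k \<in> K \<Longrightarrow> k \<noteq> l \<Longrightarrow> f k = 0"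
proof -
  have "\<exists>l\<in>K. f l \<noteq> 0" using assms(3) by (metis sum.neutral zero_neq_one)
  then obtain l where l: "l \<in> K" "f l \<noteq> 0" by blast
  have sp: "f l + sum f (K - {l}) = 1" using assms(1,3) l(1) by (simp add: sum.remove)
  have nn: "0 \<le> sum f (K - {l})" by (intro sum_nonneg) (use assms(2) in auto)
  have "f l \<ge> 1" using assms(2)[OF l(1)] l(2) by linarith
  then have "f l = 1" "sum f (K - {l}) = 0" using sp nn by linarith+
  moreover have "f k = 0" if "k \<in> K" "k \<noteq> l" for k
  proof -
    have "\<forall>k\<in>K - {l}. f k = 0"
      using \<open>sum f (K - {l}) = 0\<close> assms(1,2) by (subst (asm) sum_nonneg_eq_0_iff) auto
    then show ?thesis using that by blast
  qed
  ultimately show ?thesis using that l(1) by blast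
qed

context simplex
begin

lemma level_bary_int:
  "x \<in> L m \<Longrightarrow> j \<in> J \<Longrightarrow> \<exists>k::int. 2 ^ m * bary j x = of_int k"
proof (induction m arbitrary: x)
  case 0
  then obtain i where i: "i \<in> J" "x = p i" by auto
  then show ?case using 0 by (intro exI[of _ "if i = j then 1 else 0"]) (simp add: bary_vertex)
next
  case (Suc m)
  then obtain i y where i: "i \<in> J" "y \<in> L m" "x = S i y" by auto
  obtain k :: int where k: "2 ^ m * bary j y = of_int k" using Suc.IH[OF i(2) Suc.prems(2)] by blast
  have "2 ^ Suc m * bary j x = 2 ^ m * bary j y + (if i = j then 2 ^ m else 0)"
    using i Suc.prems(2) by (simp add: bary_S' algebra_simps)
  then show ?case by (intro exI[of _ "k + (if i = j then 2 ^ m else 0)"]) (simp add: k)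
qed

lemma S_power: "(S j ^^ m) x = (1 / 2 ^ m) *\<^sub>R x + (1 - 1 / 2 ^ m) *\<^sub>R p j"
proof (induction m)
  case (Suc m)
  have "(S j ^^ Suc m) x = (1 / 2 ^ Suc m) *\<^sub>R x + ((1 / 2) * (1 - 1 / 2 ^ m) + 1 / 2) *\<^sub>R p j"
    unfolding scaleR_add_left by (simp add: Suc contr_def scaleR_add_right)
  also have "(1 / 2) * (1 - 1 / 2 ^ m) + 1 / 2 = 1 - 1 / (2 :: real) ^ Suc m" by (simp add: field_simps)
  finally show ?case .
qed simp

lemma bary_S_power: "j \<in> J \<Longrightarrow> k \<in> J \<Longrightarrow> bary k ((S j ^^ m) x) = bary k x / 2 ^ m + (if j = k then 1 - 1 / 2 ^ m else 0)"
  by (induction m) (auto simp: bary_S' field_simps)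

lemma S_power_level: "j \<in> J \<Longrightarrow> l \<in> J \<Longrightarrow> (S j ^^ m) (p l) \<in> L m"
  by (induction m) auto

lemma S_power_V: "j \<in> J \<Longrightarrow> x \<in> V \<Longrightarrow> (S j ^^ m) x \<in> V"
  by (induction m) (auto intro: S_V)

text \<open>In cell i, the point at distance \<open>1 / 2 ^ (m + 1)\<close> from the junction S i (p
  j) on the edge towards S i (p l).\<close>

definition xp :: "nat \<Rightarrow> nat \<Rightarrow> nat \<Rightarrow> nat \<Rightarrow> 'a" where
  "xp m i j l = S i ((S j ^^ m) (p l))"

text \<open>With l = i or l = j one of the two points facing each other would be the junction itself
  and the pair would lie in a single cell.\<close>

definition triples :: "(nat \<times> nat \<times> nat) set" where
  "triples = {(i, j, l). i \<in> J \<and> j \<in> J \<and> l \<in> J \<and> i \<noteq> j \<and> l \<noteq> i \<and> l \<noteq> j}"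

lemma finite_triples: "finite triples"
  by (rule finite_subset[of _ "J \<times> J \<times> J"]) (auto simp: triples_def)

lemma bary_xp:
  assumes "(i, j, l) \<in> triples" "k \<in> J"
  shows "bary k (xp m i j l) =
    (if k = i then 1 / 2 else if k = j then 1 / 2 - 1 / 2 ^ Suc m else if k = l then 1 / 2 ^ Suc m else 0)"
  using assms by (auto simp: triples_def xp_def bary_S' bary_S_power bary_vertex field_simps)

lemma xp_level: "i \<in> J \<Longrightarrow> j \<in> J \<Longrightarrow> l \<in> J \<Longrightarrow> xp m i j l \<in> L (Suc m)"
  unfolding xp_def level_Suc using S_power_level by blast

lemma xp_span: "(i, j, l) \<in> triples \<Longrightarrow> xp m i j l \<in> affine_span"
proof -
  assume t: "(i, j, l) \<in> triples"
  then have "xp m i j l \<in> L (Suc m)" by (auto simp: triples_def xp_level simp del: level_Suc)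
  then show ?thesis using level_hull[of "Suc m"] by (auto simp: simplex_hull_def)
qed

lemma level_span: "x \<in> L m \<Longrightarrow> x \<in> affine_span"
  using level_hull[of m] by (auto simp: simplex_hull_def)

text \<open>Neighbouring points of level \<open>m + 1\<close> need not lie in a common cell: at every junction
  \<open>S i (p j) = S j (p i)\<close> the points \<open>xp m i j l\<close> and \<open>xp m j i l\<close> of different
  cells are also at distance \<open>2 ^ - (m + 1)\<close>.\<close>

lemma neighbours_across:
  assumes x: "x \<in> L m" and y: "y \<in> L m" and ij: "i \<in> J" "j \<in> J" "i \<noteq> j"
    and d: "norm (S i x - S j y) = 1 / 2 ^ Suc m"
    and nx: "S i x \<notin> S j ` L m" and ny: "S j y \<notin> S i ` L m"
  shows "\<exists>l. (i, j, l) \<in> triples \<and> S i x = xp m i j l \<and> S j y = xp m j i l"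
proof -
  have Lx: "S i x \<in> L (Suc m)" and Ly: "S j y \<in> L (Suc m)" using x y ij by auto
  obtain a where a: "\<And>k. k \<in> J \<Longrightarrow> 2 ^ Suc m * bary k (S i x) = of_int (a k)"
    using level_bary_int[OF Lx] by metis
  obtain b where b: "\<And>k. k \<in> J \<Longrightarrow> 2 ^ Suc m * bary k (S j y) = of_int (b k)"
    using level_bary_int[OF Ly] by metis
  have nn: "0 \<le> bary k z" if "z \<in> L n" "k \<in> J" for z k n
    using level_hull[of n] that by (auto simp: simplex_hull_def)
  have a0: "0 \<le> a k" and b0: "0 \<le> b k" if "k \<in> J" for k
    using a[OF that] b[OF that] nn[OF Lx that] nn[OF Ly that]
    by (metis mult_nonneg_nonneg of_int_0_le_iff zero_le_numeral zero_le_power)+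
  have sums: "(\<Sum>k\<in>J. a k) = 2 ^ Suc m" "(\<Sum>k\<in>J. b k) = 2 ^ Suc m"
  proof -
    have "real_of_int (\<Sum>k\<in>J. a k) = 2 ^ Suc m * (\<Sum>k\<in>J. bary k (S i x))"
      by (simp only: of_int_sum sum_distrib_left) (intro sum.cong refl, simp add: a[symmetric])
    then show "(\<Sum>k\<in>J. a k) = 2 ^ Suc m" unfolding bary_sum by (metis mult.right_neutral of_int_eq_iff of_int_numeral of_int_power)
    have "real_of_int (\<Sum>k\<in>J. b k) = 2 ^ Suc m * (\<Sum>k\<in>J. bary k (S j y))"
      by (simp only: of_int_sum sum_distrib_left) (intro sum.cong refl, simp add: b[symmetric])
    then show "(\<Sum>k\<in>J. b k) = 2 ^ Suc m" unfolding bary_sum by (metis mult.right_neutral of_int_eq_iff of_int_numeral of_int_power)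
  qed
  \<comment> \<open>Scaled by \<open>2 ^ Suc m\<close>, the coordinates are integers, and neighbours
    are integer vectors at squared distance 2, because of the 1/2 in
    \<open>norm_diff_bary\<close>.\<close>
  have sq: "(\<Sum>k\<in>J. (a k - b k)\<^sup>2) = 2"
  proof -
    have eqn: "(1 / 2 ^ Suc m)\<^sup>2 = (\<Sum>k\<in>J. (bary k (S i x) - bary k (S j y))\<^sup>2) / 2"
      using norm_diff_bary[OF level_span[OF Lx] level_span[OF Ly]] d by simp
    have gen: "2 = c\<^sup>2 * s" if "(1 / c)\<^sup>2 = s / 2" "c > 0" for c s :: real
      using that by (simp add: power_divide field_simps)
    have "2 = (2 ^ Suc m)\<^sup>2 * (\<Sum>k\<in>J. (bary k (S i x) - bary k (S j y))\<^sup>2)"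
      by (rule gen[OF eqn]) simp
    also have "\<dots> = (\<Sum>k\<in>J. (2 ^ Suc m * bary k (S i x) - 2 ^ Suc m * bary k (S j y))\<^sup>2)"
      by (simp only: sum_distrib_left right_diff_distrib[symmetric] power_mult_distrib)
    also have "\<dots> = (\<Sum>k\<in>J. (real_of_int (a k) - real_of_int (b k))\<^sup>2)"
      by (intro sum.cong refl) (simp only: a b)
    finally have "real_of_int 2 = real_of_int (\<Sum>k\<in>J. (a k - b k)\<^sup>2)" by simp
    then show ?thesis by (simp only: of_int_eq_iff)
  qed
  have half: "2 ^ Suc m * (t / 2) = 2 ^ m * t" for t :: real by simp
  have lt1: "bary j x < 1" if "S i x \<notin> S j ` L m" "x \<in> L m" "i \<in> J" "j \<in> J" for i j x
  proof (rule ccontr)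
    assume "\<not> bary j x < 1"
    then have "x = p j" using simplex_hull_vertex_eq[of x j] level_hull[of m] that by auto
    then have "S i x = S j (p i)" by (simp add: S_junction)
    then show False using that vertex_level[OF that(3), of m] by auto
  qed
  have ai: "2 ^ m \<le> a i"
  proof -
    have "real_of_int (a i) = 2 ^ m * (bary i x + 1)" using a[OF ij(1)] ij by (simp add: bary_S' algebra_simps)
    also have "\<dots> \<ge> 2 ^ m * 1" by (intro mult_left_mono) (use nn[OF x ij(1)] in auto)
    finally have "real_of_int (2 ^ m) \<le> real_of_int (a i)" by simp
    then show ?thesis by (simp only: of_int_le_iff)
  qed
  have bj: "2 ^ m \<le> b j"
  proof -
    have "real_of_int (b j) = 2 ^ m * (bary j y + 1)" using b[OF ij(2)] ij by (simp add: bary_S' algebra_simps)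
    also have "\<dots> \<ge> 2 ^ m * 1" by (intro mult_left_mono) (use nn[OF y ij(2)] in auto)
    finally have "real_of_int (2 ^ m) \<le> real_of_int (b j)" by simp
    then show ?thesis by (simp only: of_int_le_iff)
  qed
  have aj: "a j < 2 ^ m"
  proof -
    have "real_of_int (a j) = 2 ^ m * bary j x" using a[OF ij(2)] ij by (simp add: bary_S')
    also have "\<dots> < 2 ^ m * 1" by (intro mult_strict_left_mono lt1[OF nx x ij(1,2)]) auto
    finally have "real_of_int (a j) < real_of_int (2 ^ m)" by simp
    then show ?thesis by (simp only: of_int_less_iff)
  qed
  have bi: "b i < 2 ^ m"
  proof -
    have "real_of_int (b i) = 2 ^ m * bary i y" using b[OF ij(1)] ij by (simp add: bary_S')
    also have "\<dots> < 2 ^ m * 1" by (intro mult_strict_left_mono lt1[OF ny y ij(2,1)]) auto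
    finally have "real_of_int (b i) < real_of_int (2 ^ m)" by simp
    then show ?thesis by (simp only: of_int_less_iff)
  qed
  let ?R = "J - {i} - {j}"
  have split: "(\<Sum>k\<in>J. f k) = f i + (f j + (\<Sum>k\<in>?R. f k))" for f :: "nat \<Rightarrow> int"
    using ij by (simp add: sum.remove)
  have one: "z \<ge> 1 \<Longrightarrow> z\<^sup>2 \<ge> 1" for z :: int by (simp add: one_le_power)
  \<comment> \<open>Coordinates i and j lie on opposite sides of the threshold \<open>2 ^ m\<close>;
    being integers they differ by at least 1 each. This exhausts the total 2, so all other
    coordinates agree.\<close>
  have pi: "(a i - b i)\<^sup>2 \<ge> 1" using ai bi by (intro one) simp
  have pj: "(a j - b j)\<^sup>2 \<ge> 1" using one[of "b j - a j"] aj bj by (simp add: power2_commute)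
  have r0: "(\<Sum>k\<in>?R. (a k - b k)\<^sup>2) \<ge> 0" by (intro sum_nonneg) simp
  have e: "(a i - b i)\<^sup>2 = 1" "(a j - b j)\<^sup>2 = 1" "(\<Sum>k\<in>?R. (a k - b k)\<^sup>2) = 0"
    using sq pi pj r0 unfolding split by linarith+
  have "a i - b i = 1" using e(1) ai bi by (simp add: power2_eq_1_iff)
  then have ai': "a i = 2 ^ m" and bi': "b i = 2 ^ m - 1" using ai bi by linarith+
  have "b j - a j = 1" using e(2) aj bj by (auto simp: power2_eq_1_iff)
  then have aj': "a j = 2 ^ m - 1" and bj': "b j = 2 ^ m" using aj bj by linarith+
  have ab: "a k = b k" if "k \<in> ?R" for k
  proof -
    have "\<forall>k\<in>?R. (a k - b k)\<^sup>2 = 0" using e(3) by (subst (asm) sum_nonneg_eq_0_iff) auto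
    then show ?thesis using that by auto
  qed
  have "(\<Sum>k\<in>?R. a k) = 1" using sums(1) unfolding split ai' aj' by simp
  then obtain l where l: "l \<in> ?R" "a l = 1" and l0: "\<And>k. k \<in> ?R \<Longrightarrow> k \<noteq> l \<Longrightarrow> a k = 0"
    using int_sum_eq_1[of ?R a] a0 by auto
  have t: "(i, j, l) \<in> triples" "(j, i, l) \<in> triples" using ij l by (auto simp: triples_def)
  have raj: "real_of_int (a j) = 2 ^ m - 1" and rbi: "real_of_int (b i) = 2 ^ m - 1"
    by (simp_all add: aj' bi')
  have ge: "bary k z = of_int c / 2 ^ Suc m" if "2 ^ Suc m * bary k z = of_int c" for k z c
    using that by (simp add: field_simps)
  have "S i x = xp m i j l"
  proof (rule span_eqI[OF level_span[OF Lx] xp_span[OF t(1)]])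
    fix k assume k: "k \<in> J"
    have "bary k (S i x) = of_int (a k) / 2 ^ Suc m" by (rule ge[OF a[OF k]])
    then show "bary k (S i x) = bary k (xp m i j l)"
      unfolding bary_xp[OF t(1) k] using k ai' raj l l0[of k] by (auto simp: field_simps)
  qed
  moreover have "S j y = xp m j i l"
  proof (rule span_eqI[OF level_span[OF Ly] xp_span[OF t(2)]])
    fix k assume k: "k \<in> J"
    have "bary k (S j y) = of_int (b k) / 2 ^ Suc m" by (rule ge[OF b[OF k]])
    then show "bary k (S j y) = bary k (xp m j i l)"
      unfolding bary_xp[OF t(2) k] using k rbi bj' l l0[of k] ab[of k] by (auto simp: field_simps)
  qed
  ultimately show ?thesis using t by blast
qed

section \<open>Recursion for the neighbour pairs\<close>

abbreviation nb :: "nat \<Rightarrow> ('a \<times> 'a) set" where "nb \<equiv> neighbours N p"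

lemma nb_finite: "finite (nb m)"
  by (rule finite_subset[of _ "L m \<times> L m"]) (auto simp: neighbours_def level_finite)

definition across :: "nat \<Rightarrow> nat \<times> nat \<times> nat \<Rightarrow> 'a \<times> 'a" where
  "across m = (\<lambda>(i, j, l). (xp m i j l, xp m j i l))"

lemma norm_contr_diff: "norm (S i x - S i y) = norm (x - y) / 2"
  using dist_contr[of p i x y] by (simp add: dist_norm)

lemma nb_Suc: "nb (Suc m) = (\<Union>i\<in>J. map_prod (S i) (S i) ` nb m) \<union> across m ` triples"
proof (intro equalityI subsetI)
  fix z assume "z \<in> nb (Suc m)"
  then obtain x y where z: "z = (x, y)" "x \<in> L (Suc m)" "y \<in> L (Suc m)" "norm (x - y) = 1 / 2 ^ Suc m"
    by (auto simp: neighbours_def simp del: level_Suc)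
  then obtain i x' j y' where x: "i \<in> J" "x' \<in> L m" "x = S i x'" and y: "j \<in> J" "y' \<in> L m" "y = S j y'"
    by auto
  have same: "z \<in> (\<Union>i\<in>J. map_prod (S i) (S i) ` nb m)" if "k \<in> J" "x \<in> S k ` L m" "y \<in> S k ` L m" for k
  proof -
    from that(2) obtain a where a: "x = S k a" "a \<in> L m" by (rule imageE)
    from that(3) obtain b where b: "y = S k b" "b \<in> L m" by (rule imageE)
    note ab = a(2) b(2) a(1) b(1)
    then have "(a, b) \<in> nb m" using z(4) by (simp add: neighbours_def norm_contr_diff)
    then show ?thesis using ab z(1) that(1) by (auto intro!: bexI[of _ k] image_eqI[of _ _ "(a, b)"])
  qed
  consider "x \<in> S j ` L m" | "y \<in> S i ` L m" | "x \<notin> S j ` L m" "y \<notin> S i ` L m" by blast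
  then show "z \<in> (\<Union>i\<in>J. map_prod (S i) (S i) ` nb m) \<union> across m ` triples"
  proof cases
    case 1
    then show ?thesis using same[OF y(1)] y by blast
  next
    case 2
    then show ?thesis using same[OF x(1)] x by blast
  next
    case 3
    have "i \<noteq> j" using 3 x y by blast
    then obtain l where "(i, j, l) \<in> triples" "S i x' = xp m i j l" "S j y' = xp m j i l"
      using neighbours_across[OF x(2) y(2) x(1) y(1)] 3 z(4) x(3) y(3) by blast
    then have "z \<in> across m ` triples"
      unfolding z(1) x(3) y(3) across_def by (intro image_eqI[of _ _ "(i, j, l)"]) auto
    then show ?thesis by blast
  qed
next
  fix z assume "z \<in> (\<Union>i\<in>J. map_prod (S i) (S i) ` nb m) \<union> across m ` triples"
  then show "z \<in> nb (Suc m)"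
  proof
    assume "z \<in> (\<Union>i\<in>J. map_prod (S i) (S i) ` nb m)"
    then show ?thesis by (auto simp: neighbours_def norm_contr_diff)
  next
    assume "z \<in> across m ` triples"
    then obtain i j l where t: "i \<in> J" "j \<in> J" "l \<in> J" "i \<noteq> j" and z: "z = (xp m i j l, xp m j i l)"
      by (auto simp: across_def triples_def)
    define c where "c = 1 / (2 :: real) ^ m"
    have "xp m i j l - xp m j i l = (c / 2) *\<^sub>R (p i - p j)"
      by (simp add: xp_def S_power contr_def c_def[symmetric] scaleR_add_right scaleR_diff_left scaleR_diff_right)
    moreover have "norm (p i - p j) = 1" using vertices t by (simp add: simplex_vertices_def J_def)
    ultimately have "norm (xp m i j l - xp m j i l) = 1 / 2 ^ Suc m" by (simp add: c_def)
    moreover have "xp m i j l \<in> L (Suc m)" "xp m j i l \<in> L (Suc m)" using t by (simp_all only: xp_level)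
    ultimately show ?thesis unfolding z by (simp add: neighbours_def del: level_Suc)
  qed
qed

lemma nb_ne: "(x, y) \<in> nb m \<Longrightarrow> x \<noteq> y" by (auto simp: neighbours_def)

lemma nb_V: "(x, y) \<in> nb m \<Longrightarrow> x \<in> V \<and> y \<in> V" using level_V by (auto simp: neighbours_def)

text \<open>Two cells share only one point, and a pair consists of two different ones.\<close>

lemma nb_cells_disjoint:
  assumes "i \<in> J" "j \<in> J" "i \<noteq> j"
  shows "map_prod (S i) (S i) ` nb m \<inter> map_prod (S j) (S j) ` nb m = {}"
proof (rule ccontr)
  assume "\<not> ?thesis"
  then obtain a b c d where ab: "(a, b) \<in> nb m" and cd: "(c, d) \<in> nb m" and eq: "S i a = S j c" "S i b = S j d"
    by fastforce
  have "a = p j" "b = p j"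
    using V_overlap(1)[OF eq(1) assms(3,1,2)] V_overlap(1)[OF eq(2) assms(3,1,2)] nb_V[OF ab] nb_V[OF cd] by auto
  then show False using nb_ne[OF ab] by simp
qed

text \<open>For m > 0 the only coordinate of \<open>xp m i j l\<close> that reaches 1/2 is i, so a
  cell containing the point must be cell i; the partner lies in cell j. At m = 0 coordinate l equals
  1/2 as well and this fails.\<close>

lemma across_cells_disjoint:
  assumes m: "m \<noteq> 0" and k: "k \<in> J"
  shows "map_prod (S k) (S k) ` nb m \<inter> across m ` triples = {}"
proof (rule ccontr)
  assume "\<not> ?thesis"
  then obtain a b i j l where ab: "(a, b) \<in> nb m" and t: "(i, j, l) \<in> triples"
    and eq: "S k a = xp m i j l" "S k b = xp m j i l"
    unfolding across_def by fastforce
  have t': "(j, i, l) \<in> triples" using t by (auto simp: triples_def)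
  have "(1::real) < 2 ^ m" using m by simp
  then have lt: "1 / 2 ^ Suc m < (1 / 2 :: real)" by (simp add: field_simps)
  have c0: "(0::real) < 1 / 2 ^ Suc m" by simp
  have half: "bary k (S k x) \<ge> 1 / 2" if "x \<in> V" for x
    using that V_hull k by (auto simp: bary_S' simplex_hull_def)
  have "k = i"
    using half[of a] nb_V[OF ab] lt c0 unfolding eq bary_xp[OF t k] by (auto split: if_splits)
  moreover have "k = j"
    using half[of b] nb_V[OF ab] lt c0 unfolding eq bary_xp[OF t' k] by (auto split: if_splits)
  ultimately show False using t by (simp add: triples_def)
qed

lemma p_inj: "i \<in> J \<Longrightarrow> j \<in> J \<Longrightarrow> p i = p j \<Longrightarrow> i = j"
  using dist_vertices[of i j] by (auto split: if_splits)

lemma across_inj: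
  assumes m: "m \<noteq> 0"
  shows "inj_on (across m) triples"
proof (rule inj_onI)
  fix z z' assume z: "z \<in> triples" "z' \<in> triples" "across m z = across m z'"
  obtain i j l i' j' l' where zz: "z = (i, j, l)" "z' = (i', j', l')" by (cases z; cases z') auto
  have t: "(i, j, l) \<in> triples" "(i', j', l') \<in> triples" using z zz by auto
  then have t2: "(j, i, l) \<in> triples" "(j', i', l') \<in> triples" by (auto simp: triples_def)
  have eq: "xp m i j l = xp m i' j' l'" "xp m j i l = xp m j' i' l'"
    using z(3) unfolding zz across_def by auto
  have "(1::real) < 2 ^ m" using m by simp
  then have lt: "1 / 2 ^ Suc m < (1 / 2 :: real)" by (simp add: field_simps)
  have c0: "(0::real) < 1 / 2 ^ Suc m" by simp
  have *: "i = i'" if "(i, j, l) \<in> triples" "(i', j', l') \<in> triples" "xp m i j l = xp m i' j' l'" for i j l i' j' l'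
  proof (rule ccontr)
    assume ne: "i \<noteq> i'"
    have "i \<in> J" using that by (simp add: triples_def)
    then have "1 / 2 = bary i (xp m i' j' l')" using bary_xp[OF that(1), of i m] that(3) by simp
    then show False using bary_xp[OF that(2) \<open>i \<in> J\<close>, of m] ne lt c0 by (auto split: if_splits)
  qed
  have i: "i = i'" by (rule *[OF t eq(1)])
  have j: "j = j'" by (rule *[OF t2 eq(2)])
  have "(S j ^^ m) (p l) = (S j ^^ m) (p l')"
    using eq(1) i j by (simp add: xp_def contr_inj)
  moreover have "inj (S j)" by (auto simp: inj_def contr_inj)
  ultimately have "p l = p l'" using injD[OF inj_fn] by metis
  then have "l = l'" using t by (auto simp: triples_def intro: p_inj)
  then show "z = z'" using i j zz by simp
qed

definition nsum :: "nat \<Rightarrow> ('a \<Rightarrow> real) \<Rightarrow> real" where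
  "nsum m u = (\<Sum>(x, y)\<in>nb m. (u x - u y)\<^sup>2)"

definition extra :: "nat \<Rightarrow> ('a \<Rightarrow> real) \<Rightarrow> real" where
  "extra m u = (\<Sum>(i, j, l)\<in>triples. (u (xp m i j l) - u (xp m j i l))\<^sup>2)"

lemma map_prod_S_inj: "inj_on (map_prod (S i) (S i)) A"
  by (auto simp: inj_on_def contr_inj)

lemma nsum_cells: "(\<Sum>(x, y)\<in>(\<Union>i\<in>J. map_prod (S i) (S i) ` nb m). (u x - u y)\<^sup>2) = (\<Sum>i\<in>J. nsum m (\<lambda>x. u (S i x)))"
  by (subst sum.UNION_disjoint)
    (auto simp: nb_finite nb_cells_disjoint nsum_def sum.reindex[OF map_prod_S_inj] split_def)

lemma nsum_Suc:
  "nsum (Suc m) u = (\<Sum>i\<in>J. nsum m (\<lambda>x. u (S i x))) + (if m = 0 then 0 else extra m u)"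
proof (cases "m = 0")
  case True
  \<comment> \<open>At m = 0 the points facing each other are S i (p l) = S l (p i) and S j (p l) =
    S l (p j), a pair in cell l that is already counted; hence no extra term.\<close>
  have "across 0 ` triples \<subseteq> (\<Union>i\<in>J. map_prod (S i) (S i) ` nb 0)"
  proof
    fix z assume "z \<in> across 0 ` triples"
    then obtain i j l where t: "i \<in> J" "j \<in> J" "l \<in> J" "i \<noteq> j" and z: "z = (S i (p l), S j (p l))"
      by (auto simp: across_def triples_def xp_def)
    have "(p i, p j) \<in> nb 0" using t vertices by (auto simp: neighbours_def simplex_vertices_def J_def)
    then show "z \<in> (\<Union>i\<in>J. map_prod (S i) (S i) ` nb 0)"
      unfolding z using t(3) by (auto simp: S_junction[of _ l] intro!: bexI[of _ l] image_eqI[of _ _ "(p i, p j)"])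
  qed
  then have "nb (Suc m) = (\<Union>i\<in>J. map_prod (S i) (S i) ` nb m)" unfolding nb_Suc using True by blast
  then show ?thesis using True nsum_cells[of u m] by (simp add: nsum_def)
next
  case False
  have "nsum (Suc m) u = (\<Sum>(x, y)\<in>(\<Union>i\<in>J. map_prod (S i) (S i) ` nb m). (u x - u y)\<^sup>2) +
      (\<Sum>(x, y)\<in>across m ` triples. (u x - u y)\<^sup>2)"
    unfolding nsum_def nb_Suc
    by (rule sum.union_disjoint) (use across_cells_disjoint[OF False] in \<open>auto simp: nb_finite finite_triples\<close>)
  also have "(\<Sum>(x, y)\<in>across m ` triples. (u x - u y)\<^sup>2) = extra m u"
    by (subst sum.reindex[OF across_inj[OF False]]) (simp add: extra_def across_def split_def)
  finally show ?thesis using False by (simp add: nsum_cells)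
qed

lemma energy_level_eq: "energy_level N p m u = rn ^ m * nsum m u"
  by (simp add: energy_level_def nsum_def rn_def)

lemma energy_level_0: "energy_level N p 0 u = cform 0 u u"
proof -
  let ?P = "{(i, j). i \<in> J \<and> j \<in> J \<and> i \<noteq> j}"
  have inj: "inj_on (map_prod p p) (J \<times> J)" by (auto simp: inj_on_def intro: p_inj)
  have nb0: "nb 0 = map_prod p p ` ?P"
  proof (intro equalityI subsetI)
    fix z assume "z \<in> nb 0"
    then obtain i j where ij: "i \<in> J" "j \<in> J" "z = (p i, p j)" "norm (p i - p j) = 1"
      by (auto simp: neighbours_def)
    then have "i \<noteq> j" by auto
    then show "z \<in> map_prod p p ` ?P" using ij by (intro image_eqI[of _ _ "(i, j)"]) auto
  next
    fix z assume "z \<in> map_prod p p ` ?P"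
    then show "z \<in> nb 0" using vertices by (auto simp: neighbours_def simplex_vertices_def J_def)
  qed
  have "energy_level N p 0 u = (\<Sum>(i, j)\<in>?P. (u (p i) - u (p j))\<^sup>2)"
    unfolding energy_level_eq nsum_def nb0
    by (subst sum.reindex[OF inj_on_subset[OF inj]]) (auto simp: split_def)
  also have "\<dots> = (\<Sum>(i, j)\<in>J \<times> J. (u (p i) - u (p j))\<^sup>2)"
    by (rule sum.mono_neutral_left) (auto intro: finite_subset[of _ "J \<times> J"])
  also have "\<dots> = cform 0 u u"
    by (simp add: sum.cartesian_product[symmetric] vform_def power2_eq_square)
  finally show ?thesis .
qed

lemma energy_level_Suc:
  "energy_level N p (Suc m) u = rn * (\<Sum>i\<in>J. energy_level N p m (\<lambda>x. u (S i x))) +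
     (if m = 0 then 0 else rn ^ Suc m * extra m u)"
  unfolding energy_level_eq nsum_Suc by (simp add: algebra_simps sum_distrib_left)

end

section \<open>Convergence of the energy\<close>

context simplex
begin

abbreviation EL :: "nat \<Rightarrow> ('a \<Rightarrow> real) \<Rightarrow> real" where "EL \<equiv> energy_level N p"

definition ex :: "nat \<Rightarrow> ('a \<Rightarrow> real) \<Rightarrow> real" where
  "ex m u = EL m u - cform m u u"

lemma ex_0: "ex 0 u = 0"
  by (simp add: ex_def energy_level_0)

lemma ex_Suc: "ex (Suc m) u = rn * (\<Sum>i\<in>J. ex m (\<lambda>x. u (S i x))) + (if m = 0 then 0 else rn ^ Suc m * extra m u)"
  by (simp add: ex_def energy_level_Suc sum_subtractf right_diff_distrib)

lemma extra_nonneg: "0 \<le> extra m u"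
  unfolding extra_def by (intro sum_nonneg) auto

lemma ex_nonneg: "0 \<le> ex m u"
proof (induction m arbitrary: u)
  case (Suc m)
  show ?case unfolding ex_Suc using rn_pos extra_nonneg
    by (intro add_nonneg_nonneg mult_nonneg_nonneg sum_nonneg Suc) auto
qed (simp add: ex_0)

lemma EL_ge: "cform m u u \<le> EL m u"
  using ex_nonneg[of m u] by (simp add: ex_def)

lemma EL_cong: "(\<And>x. x \<in> V \<Longrightarrow> u x = v x) \<Longrightarrow> EL m u = EL m v"
  unfolding energy_level_eq nsum_def using nb_V by (intro arg_cong[where f = "(*) _"] sum.cong) auto

lemma ex_cong: "(\<And>x. x \<in> V \<Longrightarrow> u x = v x) \<Longrightarrow> ex m u = ex m v"
  unfolding ex_def using EL_cong[of u v m] cform_cong[of u v u v m] by simp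

text \<open>Vertex energy, not renormalized, of the m-cell that contains p j.\<close>

definition corner :: "nat \<Rightarrow> nat \<Rightarrow> ('a \<Rightarrow> real) \<Rightarrow> real" where
  "corner m j u = vform (\<lambda>l. u ((S j ^^ m) (p l))) (\<lambda>l. u ((S j ^^ m) (p l)))"

lemma corner_nonneg: "0 \<le> corner m j u"
  unfolding corner_def by (rule vform_nonneg)

lemma corner_Suc: "corner (Suc m) j u = corner m j (\<lambda>x. u (S j x))"
  by (simp add: corner_def funpow_swap1)

lemma extra_eq_sum: "extra m u = (\<Sum>i\<in>J. \<Sum>j\<in>J-{i}. \<Sum>l\<in>J-{i,j}. (u (xp m i j l) - u (xp m j i l))\<^sup>2)"
proof -
  have "triples = (SIGMA i:J. SIGMA j:J-{i}. J-{i,j})" by (auto simp: triples_def)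
  then show ?thesis unfolding extra_def by (simp add: sum.Sigma)
qed

lemma S_power_fix: "(S j ^^ m) (p j) = p j"
  by (induction m) (auto simp: S_fix)

lemma sum_off_diag_swap:
  fixes f :: "nat \<Rightarrow> nat \<Rightarrow> real"
  shows "(\<Sum>i\<in>J. \<Sum>j\<in>J-{i}. f i j) = (\<Sum>i\<in>J. \<Sum>j\<in>J-{i}. f j i)"
proof -
  have *: "(\<Sum>j\<in>J-{i}. f j) = (\<Sum>j\<in>J. f j) - f i" if "i \<in> J" for f :: "nat \<Rightarrow> real" and i
    using that by (simp add: sum.remove)
  have "(\<Sum>i\<in>J. \<Sum>j\<in>J-{i}. f i j) = (\<Sum>i\<in>J. (\<Sum>j\<in>J. f i j) - f i i)"
    by (intro sum.cong refl) (rule *)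
  also have "\<dots> = (\<Sum>i\<in>J. (\<Sum>j\<in>J. f j i) - f i i)"
    using sum.swap[of f J J] by (simp add: sum_subtractf)
  also have "\<dots> = (\<Sum>i\<in>J. \<Sum>j\<in>J-{i}. f j i)"
    by (intro sum.cong refl) (rule *[symmetric])
  finally show ?thesis .
qed

text \<open>Both points of an extra pair are compared with the junction S i (p j) between them,
  which is a vertex of the two cells of level m + 1 in question. Squaring costs a factor 2, and
  summing over ordered pairs uses every corner twice.\<close>

lemma extra_le: "extra m u \<le> 4 * (\<Sum>i\<in>J. \<Sum>j\<in>J-{i}. corner m j (\<lambda>x. u (S i x)))"
proof -
  define A where "A i j = (\<Sum>l\<in>J-{i,j}. (u (xp m i j l) - u (S i (p j)))\<^sup>2)" for i j
  have A: "A i j \<le> corner m j (\<lambda>x. u (S i x))" if "i \<in> J" "j \<in> J" for i j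
  proof -
    have "A i j = (\<Sum>l\<in>J-{i,j}. (u (S i ((S j ^^ m) (p j))) - u (S i ((S j ^^ m) (p l))))\<^sup>2)"
      by (simp add: A_def xp_def S_power_fix power2_commute)
    also have "\<dots> \<le> (\<Sum>l\<in>J. (u (S i ((S j ^^ m) (p j))) - u (S i ((S j ^^ m) (p l))))\<^sup>2)"
      by (rule sum_mono2) auto
    also have "\<dots> \<le> corner m j (\<lambda>x. u (S i x))"
      unfolding corner_def by (rule vform_ge[OF that(2)])
    finally show ?thesis .
  qed
  have sq: "(a - b)\<^sup>2 \<le> 2 * (a - c)\<^sup>2 + 2 * (b - c)\<^sup>2" for a b c :: real
  proof -
    have "2 * (a - c)\<^sup>2 + 2 * (b - c)\<^sup>2 - (a - b)\<^sup>2 = (a + b - 2 * c)\<^sup>2"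
      by (simp add: power2_eq_square algebra_simps)
    then show ?thesis using zero_le_power2[of "a + b - 2 * c"] by linarith
  qed
  have "extra m u \<le> (\<Sum>i\<in>J. \<Sum>j\<in>J-{i}. 2 * A i j + 2 * A j i)"
    unfolding extra_eq_sum
  proof (intro sum_mono)
    fix i j assume "i \<in> J" "j \<in> J - {i}"
    have "(\<Sum>l\<in>J-{i,j}. (u (xp m i j l) - u (xp m j i l))\<^sup>2) \<le>
      (\<Sum>l\<in>J-{i,j}. 2 * (u (xp m i j l) - u (S i (p j)))\<^sup>2 + 2 * (u (xp m j i l) - u (S i (p j)))\<^sup>2)"
      by (intro sum_mono sq)
    also have "\<dots> = 2 * A i j + 2 * A j i"
      unfolding A_def S_junction[of j i] by (simp add: sum.distrib sum_distrib_left insert_commute)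
    finally show "(\<Sum>l\<in>J-{i,j}. (u (xp m i j l) - u (xp m j i l))\<^sup>2) \<le> 2 * A i j + 2 * A j i" .
  qed
  also have "\<dots> = 2 * (\<Sum>i\<in>J. \<Sum>j\<in>J-{i}. A i j) + 2 * (\<Sum>i\<in>J. \<Sum>j\<in>J-{i}. A j i)"
    by (simp add: sum.distrib sum_distrib_left)
  also have "(\<Sum>i\<in>J. \<Sum>j\<in>J-{i}. A j i) = (\<Sum>i\<in>J. \<Sum>j\<in>J-{i}. A i j)"
    by (rule sum_off_diag_swap)
  also have "2 * (\<Sum>i\<in>J. \<Sum>j\<in>J-{i}. A i j) + 2 * (\<Sum>i\<in>J. \<Sum>j\<in>J-{i}. A i j) =
      4 * (\<Sum>i\<in>J. \<Sum>j\<in>J-{i}. A i j)" by simp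
  also have "\<dots> \<le> 4 * (\<Sum>i\<in>J. \<Sum>j\<in>J-{i}. corner m j (\<lambda>x. u (S i x)))"
    by (intro mult_left_mono sum_mono A) auto
  finally show ?thesis .
qed

text \<open>Every cell contributes to the extra edges only at its own corners, which lie on
  junctions of strictly lower level; carrying the corner energies along makes the induction close.\<close>

lemma ex_corner_le:
  "m \<noteq> 0 \<Longrightarrow> ex m u + 4 * (\<Sum>j\<in>J. rn ^ m * corner m j u) \<le> 4 * cform m u u"
proof (induction m arbitrary: u)
  case (Suc m)
  show ?case
  proof (cases "m = 0")
    case True
    have "corner (Suc 0) j u = cform 0 (\<lambda>x. u (S j x)) (\<lambda>x. u (S j x))" for j
      by (simp add: corner_def)
    then show ?thesis using True by (simp add: ex_Suc ex_0 sum_distrib_left)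
  next
    case False
    let ?C = "\<lambda>i j. rn ^ m * corner m j (\<lambda>x. u (S i x))"
    have "(\<Sum>i\<in>J. ex m (\<lambda>x. u (S i x)) + 4 * (\<Sum>j\<in>J. ?C i j)) \<le> (\<Sum>i\<in>J. 4 * cform m (\<lambda>x. u (S i x)) (\<lambda>x. u (S i x)))"
      by (intro sum_mono Suc.IH[OF False])
    then have "rn * (\<Sum>i\<in>J. ex m (\<lambda>x. u (S i x)) + 4 * (\<Sum>j\<in>J. ?C i j)) \<le> rn * (\<Sum>i\<in>J. 4 * cform m (\<lambda>x. u (S i x)) (\<lambda>x. u (S i x)))"
      using rn_pos by (intro mult_left_mono) auto
    also have "\<dots> = 4 * cform (Suc m) u u" by (simp add: sum_distrib_left mult.left_commute)
    finally have 1: "rn * (\<Sum>i\<in>J. ex m (\<lambda>x. u (S i x))) + 4 * (rn * (\<Sum>i\<in>J. \<Sum>j\<in>J. ?C i j)) \<le> 4 * cform (Suc m) u u"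
      by (simp add: sum.distrib sum_distrib_left[symmetric] distrib_left)
    \<comment> \<open>The diagonal corners are those of the whole gasket and are carried to the next
      level; the off-diagonal ones sit at the new junctions and pay for the new extra pairs through
      \<open>extra_le\<close>.\<close>
    have "(\<Sum>i\<in>J. \<Sum>j\<in>J. ?C i j) = (\<Sum>i\<in>J. ?C i i + (\<Sum>j\<in>J-{i}. ?C i j))"
      by (intro sum.cong refl) (simp add: sum.remove)
    then have 2: "rn * (\<Sum>i\<in>J. \<Sum>j\<in>J. ?C i j) = rn * (\<Sum>i\<in>J. ?C i i) + rn * (\<Sum>i\<in>J. \<Sum>j\<in>J-{i}. ?C i j)"
      by (simp add: sum.distrib distrib_left)
    have 3: "rn * (\<Sum>i\<in>J. ?C i i) = (\<Sum>j\<in>J. rn ^ Suc m * corner (Suc m) j u)"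
      by (simp add: corner_Suc sum_distrib_left mult.assoc)
    have "rn ^ Suc m * extra m u \<le> rn ^ Suc m * (4 * (\<Sum>i\<in>J. \<Sum>j\<in>J-{i}. corner m j (\<lambda>x. u (S i x))))"
      using rn_pos by (intro mult_left_mono extra_le) auto
    also have "\<dots> = 4 * (rn * (\<Sum>i\<in>J. \<Sum>j\<in>J-{i}. ?C i j))"
      by (simp add: sum_distrib_left mult_ac)
    finally show ?thesis using 1 2 3 False unfolding ex_Suc by simp
  qed
qed simp

lemma ex_le: "ex m u \<le> 4 * cform m u u"
proof (cases "m = 0")
  case False
  have "0 \<le> 4 * (\<Sum>j\<in>J. rn ^ m * corner m j u)"
    using rn_pos by (intro mult_nonneg_nonneg sum_nonneg corner_nonneg) auto
  then show ?thesis using ex_corner_le[OF False, of u] by linarith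
qed (simp add: ex_0 vform_nonneg)

lemma EL_le: "EL m u \<le> 5 * cform m u u"
  using ex_le[of m u] by (simp add: ex_def)

lemma EL_nonneg: "0 \<le> EL m u"
  using EL_ge[of m u] cform_nonneg[of m u] by linarith

section \<open>Harmonic functions and the factor \<open>chi\<close>\<close>

definition vit :: "nat \<Rightarrow> nat \<Rightarrow> (nat \<Rightarrow> real) \<Rightarrow> nat \<Rightarrow> real" where
  "vit j m f = ((\<lambda>f. vmap f j) ^^ m) f"

lemma vit_Suc: "vit j (Suc m) f = vit j m (vmap f j)"
  by (simp add: vit_def funpow_Suc_right del: funpow.simps)

lemma H_S_power: "j \<in> J \<Longrightarrow> l \<in> J \<Longrightarrow> H f ((S j ^^ m) (p l)) = vit j m f l"
proof (induction m arbitrary: f)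
  case 0
  then show ?case by (simp add: vit_def H_vertex)
next
  case (Suc m)
  have "(S j ^^ m) (p l) \<in> V" using Suc.prems by (intro S_power_V vertex_V)
  then show ?case using Suc by (simp add: H_S vit_Suc)
qed

lemma vmap_diff:
  assumes "l \<noteq> j"
  shows "vmap g j l - g j = ((g l - g j) + ((\<Sum>k\<in>J. g k) - real N * g j)) / (real N + 2)"
  using assms by (simp add: vmap_def field_simps)

lemma sum_vmap_diff:
  assumes "j \<in> J"
  shows "(\<Sum>k\<in>J. vmap g j k) - real N * g j = ((\<Sum>k\<in>J. g k) - real N * g j) / rn"
  unfolding sum_vmap[OF assms] rn_def using N_pos by (simp add: field_simps)

text \<open>The extension rule at corner j maps the span of g j, g l - g j and the total deviation
  from g j into itself. That the coefficients depend on m alone is what makes the constant in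
  \<open>extra_H\<close> independent of the indices.\<close>

lemma vit_formula:
  "\<exists>\<alpha> \<beta>. \<forall>j\<in>J. \<forall>l\<in>J. \<forall>g. l \<noteq> j \<longrightarrow>
    vit j m g l = g j + \<alpha> * ((\<Sum>k\<in>J. g k) - real N * g j) + \<beta> * (g l - g j)"
proof (induction m)
  case 0
  show ?case by (intro exI[of _ 0] exI[of _ 1]) (simp add: vit_def)
next
  case (Suc m)
  then obtain \<alpha> \<beta> where IH: "\<And>j l g. j \<in> J \<Longrightarrow> l \<in> J \<Longrightarrow> l \<noteq> j \<Longrightarrow>
    vit j m g l = g j + \<alpha> * ((\<Sum>k\<in>J. g k) - real N * g j) + \<beta> * (g l - g j)" by blast
  have "vit j (Suc m) g l = g j + (\<alpha> / rn + \<beta> / (real N + 2)) * ((\<Sum>k\<in>J. g k) - real N * g j)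
      + \<beta> / (real N + 2) * (g l - g j)" if "j \<in> J" "l \<in> J" "l \<noteq> j" for j l g
  proof -
    have gen: "a + \<alpha> * (d / y) + \<beta> * ((x + d) / z) = a + (\<alpha> / y + \<beta> / z) * d + \<beta> / z * x" for a d x y z
      by (simp add: divide_inverse algebra_simps)
    have jj: "vmap g j j = g j" by (simp add: vmap_def)
    have "vit j (Suc m) g l = g j + \<alpha> * ((\<Sum>k\<in>J. vmap g j k) - real N * g j) + \<beta> * (vmap g j l - g j)"
      unfolding vit_Suc using IH[OF that, of "vmap g j"] by (simp only: jj)
    then show ?thesis
      unfolding sum_vmap_diff[OF that(1)] vmap_diff[OF that(3)] by (simp only: gen)
  qed
  then show ?case by blast
qed

text \<open>In the difference of the two facing values the junction value and the term with f l
  cancel, which leaves \<gamma> (f i - f j). Each ordered pair i, j occurs for N - 2 choices of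
  l.\<close>

lemma extra_H: "\<exists>c\<ge>0. \<forall>f. extra m (H f) = c * vform f f"
proof -
  obtain \<alpha> \<beta> where vit: "\<And>j l g. j \<in> J \<Longrightarrow> l \<in> J \<Longrightarrow> l \<noteq> j \<Longrightarrow>
    vit j m g l = g j + \<alpha> * ((\<Sum>k\<in>J. g k) - real N * g j) + \<beta> * (g l - g j)" using vit_formula by blast
  define \<gamma> where "\<gamma> = (2 * real N * \<alpha> + \<beta>) / (real N + 2)"
  have diff: "H f (xp m i j l) - H f (xp m j i l) = \<gamma> * (f i - f j)"
    if "i \<in> J" "j \<in> J" "l \<in> J" "i \<noteq> j" "l \<noteq> i" "l \<noteq> j" for f i j l
  proof -
    define s where "s = (\<Sum>l\<in>J. f l)"
    have val: "H f (xp m i j l) = vmap f i j + \<alpha> * (real N * (2 * f i + s) / (real N + 2) - real N * vmap f i j)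
        + \<beta> * ((f l - f j) / (real N + 2))"
      if "i \<in> J" "j \<in> J" "l \<in> J" "i \<noteq> j" "l \<noteq> i" "l \<noteq> j" for i j
    proof -
      have "vmap f i l - vmap f i j = (f l - f j) / (real N + 2)"
        using that by (simp add: vmap_def diff_divide_distrib[symmetric])
      moreover have "(S j ^^ m) (p l) \<in> V" using that by (intro S_power_V vertex_V)
      ultimately show ?thesis
        using that vit[of j l "vmap f i"] by (simp add: xp_def H_S H_S_power sum_vmap s_def)
    qed
    have "H f (xp m i j l) - H f (xp m j i l) =
        \<alpha> * (real N * (2 * f i + s) / (real N + 2) - real N * (2 * f j + s) / (real N + 2)) +
        \<beta> * ((f l - f j) / (real N + 2) - (f l - f i) / (real N + 2))"
      using val[OF that] val[of j i] that by (simp add: vmap_sym[of f j i] right_diff_distrib)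
    also have "\<dots> = \<gamma> * (f i - f j)"
      unfolding \<gamma>_def by (simp add: divide_inverse algebra_simps)
    finally show ?thesis .
  qed
  have "extra m (H f) = ((real N - 2) * \<gamma>\<^sup>2) * vform f f" for f
  proof -
    have "extra m (H f) = (\<Sum>i\<in>J. \<Sum>j\<in>J-{i}. \<Sum>l\<in>J-{i,j}. (\<gamma> * (f i - f j))\<^sup>2)"
      unfolding extra_eq_sum by (intro sum.cong refl) (simp add: diff)
    also have "\<dots> = (\<Sum>i\<in>J. \<Sum>j\<in>J-{i}. (real N - 2) * (\<gamma> * (f i - f j))\<^sup>2)"
    proof (intro sum.cong refl)
      fix i j assume ij: "i \<in> J" "j \<in> J - {i}"
      then have "card (J - {i,j}) = N - 2" by (subst card_Diff_subset) auto
      then show "(\<Sum>l\<in>J-{i,j}. (\<gamma> * (f i - f j))\<^sup>2) = (real N - 2) * (\<gamma> * (f i - f j))\<^sup>2"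
        using N2 by (simp add: of_nat_diff)
    qed
    also have "\<dots> = (\<Sum>i\<in>J. \<Sum>j\<in>J. (real N - 2) * (\<gamma> * (f i - f j))\<^sup>2)"
      by (intro sum.cong refl sum.mono_neutral_left) auto
    also have "\<dots> = ((real N - 2) * \<gamma>\<^sup>2) * vform f f"
      unfolding vform_def by (simp add: sum_distrib_left power2_eq_square mult_ac)
    finally show ?thesis .
  qed
  moreover have "(real N - 2) * \<gamma>\<^sup>2 \<ge> 0" using N2 by simp
  ultimately show ?thesis by blast
qed

lemma ex_H: "\<exists>c. \<forall>f. ex m (H f) = c * vform f f"
proof (induction m)
  case 0
  show ?case by (intro exI[of _ 0]) (simp add: ex_0)
next
  case (Suc m)
  then obtain c where c: "\<And>f. ex m (H f) = c * vform f f" by blast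
  obtain d where d: "\<And>f. extra m (H f) = d * vform f f" using extra_H by blast
  have "ex (Suc m) (H f) = (c + (if m = 0 then 0 else rn ^ Suc m * d)) * vform f f" for f
  proof -
    have "ex m (\<lambda>x. H f (S i x)) = c * vform (vmap f i) (vmap f i)" if "i \<in> J" for i
      using ex_cong[of "\<lambda>x. H f (S i x)" "H (vmap f i)" m] c that by (simp add: H_S)
    then have "rn * (\<Sum>i\<in>J. ex m (\<lambda>x. H f (S i x))) = c * (rn * (\<Sum>i\<in>J. vform (vmap f i) (vmap f i)))"
      by (simp add: sum_distrib_left mult.left_commute)
    also have "rn * (\<Sum>i\<in>J. vform (vmap f i) (vmap f i)) = vform f f"
      using vform_vmap[of "vmap f" f] vmap_sym by (simp add: vmap_def)
    finally show ?thesis unfolding ex_Suc d by (simp add: distrib_right)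
  qed
  then show ?case by blast
qed

definition chi_level :: "nat \<Rightarrow> real" where
  "chi_level m = (SOME c. \<forall>f. ex m (H f) = c * vform f f)"

lemma ex_H_eq: "ex m (H f) = chi_level m * vform f f"
  using someI_ex[OF ex_H, of m] unfolding chi_level_def by blast

lemma vform_pos_exists: "\<exists>f. vform f f > 0"
proof -
  obtain i j where ij: "i \<in> J" "j \<in> J" "i \<noteq> j"
    using N2 by (auto simp: J_def intro: that[of 1 2])
  have "(((\<lambda>k. if k = i then 1 else 0) i - (\<lambda>k. if k = i then 1 else (0::real)) j)\<^sup>2) \<le>
     vform (\<lambda>k. if k = i then 1 else 0) (\<lambda>k. if k = i then 1 else 0)"
    by (rule vform_ge1[OF ij(1,2)])
  then show ?thesis using ij(3) by (intro exI[of _ "\<lambda>k. if k = i then 1 else 0"]) simp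
qed

lemma chi_level_bounds: "0 \<le> chi_level m" "chi_level m \<le> 4" "chi_level m \<le> chi_level (Suc m)"
proof -
  obtain f where f: "vform f f > 0" using vform_pos_exists by blast
  have v: "cform m (H f) (H f) = vform f f" for m
    unfolding cform_H by (rule vform_cong) (simp_all add: H_vertex)
  show "0 \<le> chi_level m" using ex_nonneg[of m "H f"] f by (simp add: ex_H_eq zero_le_mult_iff)
  have "chi_level m * vform f f \<le> 4 * vform f f" using ex_le[of m "H f"] by (simp add: ex_H_eq v)
  then show "chi_level m \<le> 4" using f by simp
  have "rn * (\<Sum>i\<in>J. ex m (\<lambda>x. H f (S i x))) = chi_level m * (rn * (\<Sum>i\<in>J. vform (vmap f i) (vmap f i)))"
  proof -
    have "ex m (\<lambda>x. H f (S i x)) = chi_level m * vform (vmap f i) (vmap f i)" if "i \<in> J" for i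
      using ex_cong[of "\<lambda>x. H f (S i x)" "H (vmap f i)" m] that by (simp add: H_S ex_H_eq)
    then show ?thesis by (simp add: sum_distrib_left mult.left_commute)
  qed
  also have "rn * (\<Sum>i\<in>J. vform (vmap f i) (vmap f i)) = vform f f"
    using vform_vmap[of "vmap f" f] vmap_sym by (simp add: vmap_def)
  finally have "chi_level m * vform f f \<le> ex (Suc m) (H f)"
    unfolding ex_Suc using extra_nonneg[of m "H f"] rn_pos by simp
  then show "chi_level m \<le> chi_level (Suc m)" using f by (simp add: ex_H_eq)
qed

definition chi :: real where "chi = lim chi_level"

lemma chi_tendsto: "chi_level \<longlonglongrightarrow> chi"
proof -
  have "incseq chi_level" by (rule incseq_SucI) (rule chi_level_bounds)
  moreover have "\<forall>n. chi_level n \<le> 4" using chi_level_bounds(2) by blast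
  ultimately obtain c where "chi_level \<longlonglongrightarrow> c" using incseq_convergent[of chi_level 4] by blast
  then show ?thesis unfolding chi_def by (simp add: limI)
qed

lemma chi_nonneg: "chi \<ge> 0"
  by (rule LIMSEQ_le_const[OF chi_tendsto]) (use chi_level_bounds in auto)

section \<open>Piecewise harmonic functions\<close>

lemma spread_vit: "spread f K \<Longrightarrow> j \<in> J \<Longrightarrow> spread (vit j m f) (K / rn ^ m)"
proof (induction m arbitrary: f K)
  case 0
  then show ?case by (simp add: vit_def)
next
  case (Suc m)
  show ?case using Suc.IH[OF spread_vmap[OF Suc.prems] Suc.prems(2)] by (simp add: vit_Suc)
qed

lemma vform_spread:
  assumes "spread f K"
  shows "vform f f \<le> (real N)\<^sup>2 * K\<^sup>2"
proof -
  have "vform f f \<le> (\<Sum>i\<in>J. \<Sum>j\<in>J. K\<^sup>2)"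
    unfolding vform_def power2_eq_square[symmetric]
  proof (intro sum_mono)
    fix i j assume "i \<in> J" "j \<in> J"
    then have "\<bar>f i - f j\<bar> \<le> \<bar>K\<bar>" using assms by (fastforce simp: spread_def)
    then show "(f i - f j)\<^sup>2 \<le> K\<^sup>2" by (simp only: abs_le_square_iff)
  qed
  then show ?thesis by (simp add: power2_eq_square)
qed

text \<open>The values at a corner spread by at most \<open>K / rn ^ m\<close>; squared, this decays
  twice as fast as the factor \<open>rn ^ m\<close> grows.\<close>

lemma corner_H_tendsto:
  assumes j: "j \<in> J"
  shows "(\<lambda>m. rn ^ m * corner m j (H f)) \<longlonglongrightarrow> 0"
proof -
  obtain K where K: "spread f K" using spread_exists by blast
  have eq: "corner m j (H f) = vform (vit j m f) (vit j m f)" for m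
    unfolding corner_def by (rule vform_cong) (simp_all add: H_S_power j)
  have le: "rn ^ m * corner m j (H f) \<le> (real N)\<^sup>2 * K\<^sup>2 * (1 / rn) ^ m" for m
  proof -
    have "rn ^ m * corner m j (H f) \<le> rn ^ m * ((real N)\<^sup>2 * (K / rn ^ m)\<^sup>2)"
      unfolding eq using rn_pos by (intro mult_left_mono vform_spread spread_vit K j) auto
    also have "\<dots> = (real N)\<^sup>2 * K\<^sup>2 * (1 / rn) ^ m"
      using rn_pos by (simp add: power_divide power2_eq_square)
    finally show ?thesis .
  qed
  have "(\<lambda>m. (real N)\<^sup>2 * K\<^sup>2 * (1 / rn) ^ m) \<longlonglongrightarrow> (real N)\<^sup>2 * K\<^sup>2 * 0"
    using rn_gt1 by (intro tendsto_mult tendsto_const LIMSEQ_realpow_zero) auto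
  then have z: "(\<lambda>m. (real N)\<^sup>2 * K\<^sup>2 * (1 / rn) ^ m) \<longlonglongrightarrow> 0" by simp
  show ?thesis
    by (rule tendsto_sandwich[OF always_eventually always_eventually tendsto_const z])
      (use le rn_pos corner_nonneg in \<open>auto intro: mult_nonneg_nonneg\<close>)
qed

lemma corner_cong: "j \<in> J \<Longrightarrow> (\<And>x. x \<in> V \<Longrightarrow> u x = v x) \<Longrightarrow> corner m j u = corner m j v"
  unfolding corner_def by (rule vform_cong) (auto intro: S_power_V vertex_V)

lemma corner_G_tendsto:
  assumes j: "j \<in> J"
  shows "(\<lambda>m. rn ^ m * corner m j (G K u)) \<longlonglongrightarrow> 0"
proof (induction K arbitrary: u)
  case 0
  show ?case by (simp add: corner_H_tendsto[OF j])
next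
  case (Suc K)
  have "corner (Suc m) j (G (Suc K) u) = corner m j (G K (\<lambda>x. u (S j x)))" for m
    unfolding corner_Suc by (rule corner_cong[OF j]) (rule G_S[OF j])
  then have "(\<lambda>m. rn * (rn ^ m * corner m j (G K (\<lambda>x. u (S j x))))) = (\<lambda>m. rn ^ Suc m * corner (Suc m) j (G (Suc K) u))"
    by (simp add: mult.assoc)
  moreover have "(\<lambda>m. rn * (rn ^ m * corner m j (G K (\<lambda>x. u (S j x))))) \<longlonglongrightarrow> rn * 0"
    by (intro tendsto_mult tendsto_const Suc)
  ultimately have "(\<lambda>m. rn ^ Suc m * corner (Suc m) j (G (Suc K) u)) \<longlonglongrightarrow> 0" by simp
  then show ?case by (rule LIMSEQ_imp_Suc)
qed

lemma extra_G_tendsto: "(\<lambda>m. rn ^ Suc m * extra m (G (Suc K) u)) \<longlonglongrightarrow> 0"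
proof -
  let ?b = "\<lambda>m. 4 * rn * (\<Sum>i\<in>J. \<Sum>j\<in>J-{i}. rn ^ m * corner m j (G K (\<lambda>x. u (S i x))))"
  have le: "rn ^ Suc m * extra m (G (Suc K) u) \<le> ?b m" for m
  proof -
    have "corner m j (\<lambda>x. G (Suc K) u (S i x)) = corner m j (G K (\<lambda>x. u (S i x)))" if "i \<in> J" "j \<in> J" for i j
      by (rule corner_cong[OF that(2)]) (rule G_S[OF that(1)])
    then have "extra m (G (Suc K) u) \<le> 4 * (\<Sum>i\<in>J. \<Sum>j\<in>J-{i}. corner m j (G K (\<lambda>x. u (S i x))))"
      using extra_le[of m "G (Suc K) u"] by simp
    then have "rn ^ Suc m * extra m (G (Suc K) u) \<le> rn ^ Suc m * (4 * (\<Sum>i\<in>J. \<Sum>j\<in>J-{i}. corner m j (G K (\<lambda>x. u (S i x)))))"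
      using rn_pos by (intro mult_left_mono) auto
    also have "\<dots> = ?b m" by (simp add: sum_distrib_left mult_ac)
    finally show ?thesis .
  qed
  have "?b \<longlonglongrightarrow> 4 * rn * (\<Sum>i\<in>J. \<Sum>j\<in>J-{i}. 0)"
    by (intro tendsto_mult tendsto_const tendsto_sum corner_G_tendsto) auto
  then have z: "?b \<longlonglongrightarrow> 0" by simp
  show ?thesis
    by (rule tendsto_sandwich[OF always_eventually always_eventually tendsto_const z])
      (use le rn_pos extra_nonneg in \<open>auto intro: mult_nonneg_nonneg\<close>)
qed

text \<open>Inside each K-cell the function is harmonic and contributes \<open>chi_level\<close>
  times its energy. The pairs across the fixed junctions of the spline involve only corner cells and
  disappear in the limit.\<close>

lemma ex_G_tendsto: "(\<lambda>m. ex m (G K u)) \<longlonglongrightarrow> chi * cform K u u"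
proof (induction K arbitrary: u)
  case 0
  show ?case unfolding G.simps cform.simps ex_H_eq by (intro tendsto_mult tendsto_const chi_tendsto)
next
  case (Suc K)
  have eq: "ex (Suc m) (G (Suc K) u) = rn * (\<Sum>i\<in>J. ex m (G K (\<lambda>x. u (S i x)))) +
      (if m = 0 then 0 else rn ^ Suc m * extra m (G (Suc K) u))" for m
  proof -
    have "ex m (\<lambda>x. G (Suc K) u (S i x)) = ex m (G K (\<lambda>x. u (S i x)))" if "i \<in> J" for i
      by (rule ex_cong) (rule G_S[OF that])
    then show ?thesis unfolding ex_Suc by simp
  qed
  have "(\<lambda>m. if m = 0 then 0 else rn ^ Suc m * extra m (G (Suc K) u)) \<longlonglongrightarrow> 0"
  proof (rule Lim_transform_eventually[OF extra_G_tendsto[of K u]])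
    show "eventually (\<lambda>m. rn ^ Suc m * extra m (G (Suc K) u) = (if m = 0 then 0 else rn ^ Suc m * extra m (G (Suc K) u))) sequentially"
      using eventually_gt_at_top[of 0] by eventually_elim simp
  qed
  then have "(\<lambda>m. ex (Suc m) (G (Suc K) u)) \<longlonglongrightarrow> rn * (\<Sum>i\<in>J. chi * cform K (\<lambda>x. u (S i x)) (\<lambda>x. u (S i x))) + 0"
    unfolding eq by (intro tendsto_add tendsto_mult tendsto_const tendsto_sum Suc)
  also have "rn * (\<Sum>i\<in>J. chi * cform K (\<lambda>x. u (S i x)) (\<lambda>x. u (S i x))) + 0 = chi * cform (Suc K) u u"
    by (simp add: sum_distrib_left mult.left_commute)
  finally show ?case by (rule LIMSEQ_imp_Suc)
qed

lemma EL_G_tendsto: "(\<lambda>m. EL m (G K u)) \<longlonglongrightarrow> (1 + chi) * cform K u u"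
proof -
  have "(\<lambda>m. cform K u u + ex m (G K u)) \<longlonglongrightarrow> cform K u u + chi * cform K u u"
    by (intro tendsto_add tendsto_const ex_G_tendsto)
  moreover have "eventually (\<lambda>m. cform K u u + ex m (G K u) = EL m (G K u)) sequentially"
    using eventually_ge_at_top[of K] by eventually_elim (simp add: ex_def cform_G_G)
  ultimately show ?thesis by (auto intro: Lim_transform_eventually simp: distrib_right)
qed

section \<open>The energy limit for arbitrary functions\<close>

lemma sqrt_EL_triangle: "sqrt (EL m (\<lambda>x. u x + v x)) \<le> sqrt (EL m u) + sqrt (EL m v)"
proof -
  have L2: "sqrt (nsum m u) = L2_set (\<lambda>(x, y). u x - u y) (nb m)" for u
    unfolding nsum_def L2_set_def by (simp add: split_def)
  have "sqrt (nsum m (\<lambda>x. u x + v x)) = L2_set (\<lambda>z. (case z of (x, y) \<Rightarrow> u x - u y) + (case z of (x, y) \<Rightarrow> v x - v y)) (nb m)"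
    unfolding L2 by (rule arg_cong[where f = "\<lambda>f. L2_set f (nb m)"]) (auto simp: fun_eq_iff)
  also have "\<dots> \<le> sqrt (nsum m u) + sqrt (nsum m v)" unfolding L2 by (rule L2_set_triangle_ineq)
  finally have "sqrt (rn ^ m) * sqrt (nsum m (\<lambda>x. u x + v x)) \<le> sqrt (rn ^ m) * (sqrt (nsum m u) + sqrt (nsum m v))"
    using rn_pos by (intro mult_left_mono) auto
  then show ?thesis by (simp add: energy_level_eq real_sqrt_mult distrib_left)
qed

lemma EL_uminus: "EL m (\<lambda>x. - 1 * u x) = EL m u"
  unfolding energy_level_eq nsum_def by (simp add: power2_commute)

lemma sqrt_EL_diff:
  assumes "\<And>x. d x = u x + (- 1) * g x"
  shows "\<bar>sqrt (EL m u) - sqrt (EL m g)\<bar> \<le> sqrt (EL m d)"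
proof -
  have 1: "sqrt (EL m u) \<le> sqrt (EL m d) + sqrt (EL m g)"
    using sqrt_EL_triangle[of m d g] assms by simp
  have "sqrt (EL m g) \<le> sqrt (EL m u) + sqrt (EL m (\<lambda>x. - 1 * d x))"
    using sqrt_EL_triangle[of m u "\<lambda>x. - 1 * d x"] assms by simp
  then show ?thesis using 1 unfolding EL_uminus by linarith
qed

definition finite_energy :: "('a \<Rightarrow> real) \<Rightarrow> bool" where
  "finite_energy u \<longleftrightarrow> (\<exists>c. \<forall>m. cform m u u \<le> c)"

definition E :: "('a \<Rightarrow> real) \<Rightarrow> real" where "E u = lim (\<lambda>m. cform m u u)"

lemma cform_tendsto_E: "finite_energy u \<Longrightarrow> (\<lambda>m. cform m u u) \<longlonglongrightarrow> E u"
proof -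
  assume "finite_energy u"
  then obtain c where c: "\<forall>m. cform m u u \<le> c" by (auto simp: finite_energy_def)
  have "incseq (\<lambda>m. cform m u u)" by (auto simp: incseq_def cform_mono)
  then obtain e where "(\<lambda>m. cform m u u) \<longlonglongrightarrow> e" using incseq_convergent[of _ c] c by blast
  then show ?thesis unfolding E_def by (simp add: limI)
qed

lemma cform_le_E: "finite_energy u \<Longrightarrow> cform m u u \<le> E u"
  by (rule incseq_le[OF _ cform_tendsto_E]) (auto simp: incseq_def cform_mono)

text \<open>The root of \<open>EL m\<close> is a seminorm, and \<open>EL_le\<close> with
  \<open>cform_diff_G\<close> bounds it at u - G K u by the root of 5 (E u - cform K u), uniformly
  in m \<ge> K. So the limits in m and K can be exchanged without any monotonicity of
  \<open>EL\<close>.\<close>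

lemma EL_tendsto:
  assumes u: "finite_energy u"
  shows "(\<lambda>m. EL m u) \<longlonglongrightarrow> (1 + chi) * E u"
proof -
  have "(\<lambda>m. sqrt (EL m u)) \<longlonglongrightarrow> sqrt ((1 + chi) * E u)"
  proof (rule LIMSEQ_I)
    fix e :: real assume e: "e > 0"
    have "(\<lambda>K. sqrt (5 * (E u - cform K u u))) \<longlonglongrightarrow> sqrt (5 * (E u - E u))"
      by (intro tendsto_intros cform_tendsto_E u)
    then have ev1: "eventually (\<lambda>K. sqrt (5 * (E u - cform K u u)) < e / 3) sequentially"
      using e by (intro order_tendstoD(2)) auto
    have "(\<lambda>K. sqrt ((1 + chi) * cform K u u)) \<longlonglongrightarrow> sqrt ((1 + chi) * E u)"
      by (intro tendsto_intros cform_tendsto_E u)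
    then have ev2: "eventually (\<lambda>K. \<bar>sqrt ((1 + chi) * cform K u u) - sqrt ((1 + chi) * E u)\<bar> < e / 3) sequentially"
      using e tendstoD[of _ _ _ "e / 3"] by (fastforce simp: dist_real_def)
    obtain K where K: "sqrt (5 * (E u - cform K u u)) < e / 3"
        "\<bar>sqrt ((1 + chi) * cform K u u) - sqrt ((1 + chi) * E u)\<bar> < e / 3"
      using eventually_happens'[OF sequentially_bot eventually_conj[OF ev1 ev2]] by blast
    have "(\<lambda>m. sqrt (EL m (G K u))) \<longlonglongrightarrow> sqrt ((1 + chi) * cform K u u)"
      by (intro tendsto_intros EL_G_tendsto)
    then have "eventually (\<lambda>m. \<bar>sqrt (EL m (G K u)) - sqrt ((1 + chi) * cform K u u)\<bar> < e / 3) sequentially"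
      using e tendstoD[of _ _ _ "e / 3"] by (fastforce simp: dist_real_def)
    then obtain m0 where m0: "\<And>m. m \<ge> m0 \<Longrightarrow> \<bar>sqrt (EL m (G K u)) - sqrt ((1 + chi) * cform K u u)\<bar> < e / 3"
      unfolding eventually_sequentially by blast
    have "norm (sqrt (EL m u) - sqrt ((1 + chi) * E u)) < e" if m: "m \<ge> max m0 K" for m
    proof -
      have "\<bar>sqrt (EL m u) - sqrt (EL m (G K u))\<bar> \<le> sqrt (EL m (\<lambda>x. u x + (- 1) * G K u x))"
        by (rule sqrt_EL_diff) simp
      also have "\<dots> \<le> sqrt (5 * (cform m u u - cform K u u))"
        using EL_le[of m "\<lambda>x. u x + (- 1) * G K u x"] cform_diff_G[of K m u] m by simp
      also have "\<dots> \<le> sqrt (5 * (E u - cform K u u))"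
        using cform_le_E[OF u, of m] by simp
      finally show ?thesis using K m0[of m] m unfolding real_norm_def by linarith
    qed
    then show "\<exists>no. \<forall>m\<ge>no. norm (sqrt (EL m u) - sqrt ((1 + chi) * E u)) < e" by blast
  qed
  then have "(\<lambda>m. (sqrt (EL m u))\<^sup>2) \<longlonglongrightarrow> (sqrt ((1 + chi) * E u))\<^sup>2" by (rule tendsto_power)
  moreover have "0 \<le> (1 + chi) * E u"
    using chi_nonneg order_trans[OF cform_nonneg cform_le_E[OF u, of 0]] by simp
  ultimately show ?thesis by (simp add: EL_nonneg)
qed

end

section \<open>Hausdorff measure of the gasket\<close>

context simplex
begin

definition dm :: real where "dm = ln (real N) / ln 2"

lemma dm_pos: "dm > 0" using N2 by (simp add: dm_def)

lemma two_powr_dm: "2 powr dm = real N"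
  using N2 by (simp add: dm_def powr_def)

lemma half_power_powr_dm: "(1 / 2 ^ k) powr dm = 1 / real N ^ k"
proof -
  have "(1 / 2 ^ k) powr dm = 1 / (2 powr real k) powr dm"
    by (simp add: powr_divide powr_realpow)
  also have "(2 powr real k) powr dm = (2 powr dm) powr real k" by (simp add: powr_powr mult.commute)
  also have "\<dots> = real N ^ k" using N_pos by (simp add: two_powr_dm powr_realpow)
  finally show ?thesis .
qed

text \<open>V consists of N copies of itself at half scale, and the dimension is chosen so that
  halving multiplies by 1/N. Iteration carries one crude covering bound to all scales, which gives
  finite measure.\<close>

lemma hausdorff_pre_halve:
  assumes "\<delta> > 0"
  shows "hausdorff_pre dm (\<delta> / 2) V \<le> hausdorff_pre dm \<delta> V"
proof -
  define A where "A n = (if n \<in> J then S n ` V else {})" for n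
  have "V = (\<Union>n. A n)" using V_eq by (auto simp: A_def)
  then have "hausdorff_pre dm (\<delta> / 2) V \<le> (\<Sum>n. hausdorff_pre dm (\<delta> / 2) (A n))"
    using hausdorff_pre_UN[of dm "\<delta> / 2" A] by simp
  also have "\<dots> = (\<Sum>n\<in>J. hausdorff_pre dm (\<delta> / 2) (A n))"
    by (rule suminf_finite) (use assms in \<open>auto simp: A_def\<close>)
  also have "\<dots> \<le> (\<Sum>n\<in>J. ennreal (1 / real N) * hausdorff_pre dm \<delta> V)"
  proof (rule sum_mono)
    fix n assume n: "n \<in> J"
    have "hausdorff_pre dm (1 / 2 * \<delta>) (S n ` V) \<le> ennreal ((1 / 2) powr dm) * hausdorff_pre dm \<delta> V"
      by (rule hausdorff_pre_Lipschitz_image) (simp_all add: dist_contr dm_pos)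
    moreover have "(1 / 2) powr dm = 1 / real N" using half_power_powr_dm[of 1] by simp
    ultimately show "hausdorff_pre dm (\<delta> / 2) (A n) \<le> ennreal (1 / real N) * hausdorff_pre dm \<delta> V"
      using n by (simp add: A_def)
  qed
  also have "\<dots> = (ennreal (real N) * ennreal (1 / real N)) * hausdorff_pre dm \<delta> V"
    by (simp add: ennreal_of_nat_eq_real_of_nat mult.assoc)
  also have "ennreal (real N) * ennreal (1 / real N) = 1"
    using N_pos by (simp add: ennreal_mult[symmetric])
  finally show ?thesis by simp
qed

lemma hausdorff_outer_V_finite: "hausdorff_outer dm V < \<infinity>"
proof -
  define R where "R = max 1 (diameter V)"
  have R: "R > 0" "diameter V \<le> R" by (auto simp: R_def)
  have bV: "bounded V" by (rule compact_imp_bounded[OF V_compact])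
  have base: "hausdorff_pre dm R V \<le> ennreal (R powr dm)"
  proof -
    define U where "U n = (if n = 0 then V else {})" for n :: nat
    have "hausdorff_pre dm R V \<le> (\<Sum>n. ennreal (diameter (U n) powr dm))"
      by (rule hausdorff_pre_lower) (use R bV in \<open>auto simp: U_def split: if_splits\<close>)
    also have "\<dots> = (\<Sum>n\<in>{0}. ennreal (diameter (U n) powr dm))"
      by (rule suminf_finite) (auto simp: U_def)
    also have "\<dots> \<le> ennreal (R powr dm)"
      using R dm_pos diameter_ge_0[OF bV] by (auto simp: U_def intro!: ennreal_leI powr_mono2)
    finally show ?thesis .
  qed
  have pow: "hausdorff_pre dm (R / 2 ^ k) V \<le> ennreal (R powr dm)" for k
  proof (induction k)
    case (Suc k)
    have "hausdorff_pre dm (R / 2 ^ k / 2) V \<le> hausdorff_pre dm (R / 2 ^ k) V"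
      using R by (intro hausdorff_pre_halve) simp
    then show ?case using Suc by (simp add: mult.commute)
  qed (use base in simp)
  have "hausdorff_outer dm V \<le> ennreal (R powr dm)"
    unfolding hausdorff_outer_def
  proof (rule SUP_least)
    fix \<delta> :: real assume "\<delta> \<in> {0<..}"
    then obtain k where "(1 / 2) ^ k < \<delta> / R"
      using real_arch_pow_inv[of "\<delta> / R" "1 / 2"] R by auto
    then have "R / 2 ^ k \<le> \<delta>" using R by (simp add: field_simps)
    then show "hausdorff_pre dm \<delta> V \<le> ennreal (R powr dm)"
      by (rule order_trans[OF hausdorff_pre_mono[OF order_refl] pow])
  qed
  then show ?thesis by (simp add: order_le_less_trans)
qed

section \<open>Counting cells: positivity of the measure\<close>

definition words :: "nat \<Rightarrow> nat list set" where
  "words k = {w. set w \<subseteq> J \<and> length w = k}"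

lemma card_words: "finite (words k)" "card (words k) = N ^ k"
  unfolding words_def by (simp_all add: finite_lists_length_eq card_lists_length_eq)

definition cell :: "nat list \<Rightarrow> 'a set" where "cell w = foldr S w ` V"

lemma foldr_V: "set w \<subseteq> J \<Longrightarrow> x \<in> V \<Longrightarrow> foldr S w x \<in> V"
  by (induction w) (auto intro: S_V)

lemma cell_V: "set w \<subseteq> J \<Longrightarrow> cell w \<subseteq> V" by (auto simp: cell_def foldr_V)

lemma cell_append: "set v \<subseteq> J \<Longrightarrow> cell (w @ v) \<subseteq> cell w"
  by (auto simp: cell_def foldr_V)

lemma V_nonempty: "V \<noteq> {}" using J_nonempty vertex_V by blast

text \<open>The number whose binary digits mark the occurrences of j in the word. On a cell of level
  k the coordinate j, times \<open>2 ^ k\<close>, ranges between this number and its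
  successor.\<close>

primrec addr :: "nat list \<Rightarrow> nat \<Rightarrow> nat" where
  "addr [] j = 0"
| "addr (i # w) j = addr w j + (if i = j then 2 ^ length w else 0)"

lemma addr_less: "addr w j < 2 ^ length w"
  by (induction w) auto

lemma addr_bary:
  "set w \<subseteq> J \<Longrightarrow> j \<in> J \<Longrightarrow> 2 ^ length w * bary j (foldr S w y) = real (addr w j) + bary j y"
proof (induction w)
  case (Cons i w)
  then show ?case by (simp add: bary_S' algebra_simps)
qed simp

lemma addr_inj:
  "length w = length w' \<Longrightarrow> set w \<subseteq> J \<Longrightarrow> set w' \<subseteq> J \<Longrightarrow> (\<And>j. j \<in> J \<Longrightarrow> addr w j = addr w' j) \<Longrightarrow> w = w'"
proof (induction w w' rule: list_induct2)
  case (Cons i w i' w')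
  have "i = i'"
  proof (rule ccontr)
    assume ne: "i \<noteq> i'"
    have "i \<in> J" using Cons.prems(1) by simp
    from Cons.prems(3)[OF this] ne have "addr w' i \<ge> 2 ^ length w" by (simp split: if_splits)
    then show False using addr_less[of w' i] Cons.hyps by simp
  qed
  moreover have "w = w'"
  proof (rule Cons.IH)
    fix j assume "j \<in> J"
    then show "addr w j = addr w' j" using Cons.prems(3)[of j] Cons.hyps \<open>i = i'\<close> by (cases "i' = j") simp_all
  qed (use Cons.prems in auto)
  ultimately show ?case by simp
qed simp

definition hits :: "nat \<Rightarrow> 'a set \<Rightarrow> nat list set" where
  "hits k U = {w \<in> words k. cell w \<inter> U \<noteq> {}}"

lemma finite_hits: "finite (hits k U)"
  unfolding hits_def using card_words(1) by simp

text \<open>By \<open>bary_Lipschitz\<close> the coordinates scaled by \<open>2 ^ k\<close> vary by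
  at most 1 on U, so the addresses of two cells that meet U differ by at most 2 in every coordinate:
  5 choices for each of the N coordinates.\<close>

lemma card_hits_le:
  assumes U: "\<And>x y. x \<in> U \<Longrightarrow> y \<in> U \<Longrightarrow> 2 ^ Suc k * dist x y \<le> 1"
  shows "card (hits k U) \<le> 5 ^ N"
proof (cases "hits k U = {}")
  case False
  have bounds: "\<exists>x\<in>U. \<forall>j\<in>J. real (addr w j) \<le> 2 ^ k * bary j x \<and> 2 ^ k * bary j x \<le> real (addr w j) + 1"
    if "w \<in> hits k U" for w
  proof -
    from that obtain y where w: "set w \<subseteq> J" "length w = k" "y \<in> V" "foldr S w y \<in> U"
      by (auto simp: hits_def words_def cell_def)
    have "real (addr w j) \<le> 2 ^ k * bary j (foldr S w y) \<and> 2 ^ k * bary j (foldr S w y) \<le> real (addr w j) + 1"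
      if j: "j \<in> J" for j
    proof -
      have "y \<in> simplex_hull" using V_hull w(3) by blast
      then have "0 \<le> bary j y" "bary j y \<le> 1" using bary_le_1[OF _ j] j by (auto simp: simplex_hull_def)
      then show ?thesis using addr_bary[OF w(1) j, of y] w(2) by simp
    qed
    then show ?thesis using w(4) by blast
  qed
  obtain w0 where w0: "w0 \<in> hits k U" using False by blast
  obtain x0 where x0: "x0 \<in> U" "\<And>j. j \<in> J \<Longrightarrow> real (addr w0 j) \<le> 2 ^ k * bary j x0"
     "\<And>j. j \<in> J \<Longrightarrow> 2 ^ k * bary j x0 \<le> real (addr w0 j) + 1"
    using bounds[OF w0] by blast
  define P where "P = PiE J (\<lambda>j. {addr w0 j - 2..addr w0 j + 2})"
  have "inj_on (\<lambda>w. restrict (addr w) J) (hits k U)"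
  proof (rule inj_onI)
    fix w w' assume ww: "w \<in> hits k U" "w' \<in> hits k U" and eq: "restrict (addr w) J = restrict (addr w') J"
    have "addr w j = addr w' j" if "j \<in> J" for j using fun_cong[OF eq, of j] that by simp
    then show "w = w'" using ww by (intro addr_inj) (auto simp: hits_def words_def)
  qed
  moreover have "(\<lambda>w. restrict (addr w) J) ` hits k U \<subseteq> P"
  proof (rule image_subsetI)
    fix w assume w: "w \<in> hits k U"
    obtain x where x: "x \<in> U" "\<And>j. j \<in> J \<Longrightarrow> real (addr w j) \<le> 2 ^ k * bary j x"
       "\<And>j. j \<in> J \<Longrightarrow> 2 ^ k * bary j x \<le> real (addr w j) + 1"
      using bounds[OF w] by blast
    have "addr w j \<in> {addr w0 j - 2..addr w0 j + 2}" if j: "j \<in> J" for j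
    proof -
      have "\<bar>2 ^ k * bary j x - 2 ^ k * bary j x0\<bar> = 2 ^ k * \<bar>bary j x - bary j x0\<bar>"
        by (simp add: right_diff_distrib[symmetric] abs_mult)
      also have "\<dots> \<le> 2 ^ k * (2 * dist x x0)" by (intro mult_left_mono bary_Lipschitz j) simp
      also have "\<dots> \<le> 1" using U[OF x(1) x0(1)] by simp
      finally have "real (addr w j) \<le> real (addr w0 j) + 2" "real (addr w0 j) \<le> real (addr w j) + 2"
        using x(2,3)[OF j] x0(2,3)[OF j] by linarith+
      then show ?thesis by simp
    qed
    then show "restrict (addr w) J \<in> P" by (auto simp: P_def)
  qed
  moreover have "finite P" unfolding P_def by (intro finite_PiE) auto
  ultimately have "card (hits k U) \<le> card P" by (rule card_inj_on_le)
  also have "card P = (\<Prod>j\<in>J. card {addr w0 j - 2..addr w0 j + 2})" unfolding P_def by (simp add: card_PiE)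
  also have "\<dots> \<le> (\<Prod>j\<in>J. 5)" by (intro prod_mono) auto
  also have "\<dots> = 5 ^ N" by simp
  finally show ?thesis .
qed simp

lemma card_hits_refine: "card (hits (k + j) U) \<le> card (hits k U) * N ^ j"
proof -
  have "inj_on (\<lambda>w. (take k w, drop k w)) (hits (k + j) U)"
    by (rule inj_onI) (metis append_take_drop_id prod.inject)
  moreover have "(\<lambda>w. (take k w, drop k w)) ` hits (k + j) U \<subseteq> hits k U \<times> words j"
  proof (rule image_subsetI)
    fix w assume w: "w \<in> hits (k + j) U"
    then have w': "set w \<subseteq> J" "length w = k + j" "cell w \<inter> U \<noteq> {}" by (auto simp: hits_def words_def)
    have s: "set (take k w) \<subseteq> J" "set (drop k w) \<subseteq> J"
      using w'(1) set_take_subset[of k w] set_drop_subset[of k w] by auto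
    have "cell w \<subseteq> cell (take k w)" using cell_append[OF s(2), of "take k w"] by simp
    then show "(take k w, drop k w) \<in> hits k U \<times> words j"
      using s w' by (auto simp: hits_def words_def)
  qed
  ultimately have "card (hits (k + j) U) \<le> card (hits k U \<times> words j)"
    by (rule card_inj_on_le) (simp add: finite_hits card_words)
  then show ?thesis by (simp add: card_cartesian_product card_words)
qed

text \<open>Openness prepares for compactness of V. The level k is chosen with
  \<open>2 ^ - k\<close> comparable to the diameter t, namely between 4 t and 8 t; the slack
  \<open>e\<close> pays for sets of diameter 0.\<close>

lemma open_enlargement:
  fixes U :: "'a set"
  assumes "bounded U" and e: "e > 0"
  obtains k W where "open W" "U \<subseteq> W" "card (hits k W) \<le> 5 ^ N"
    "1 / real N ^ k \<le> 8 powr dm * diameter U powr dm + e"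
proof -
  define t where "t = diameter U"
  have t0: "t \<ge> 0" using diameter_ge_0[OF assms(1)] by (simp add: t_def)
  have enlarge: "\<exists>W. open W \<and> U \<subseteq> W \<and> card (hits k W) \<le> 5 ^ N"
    if \<eta>: "\<eta> > 0" "2 ^ Suc k * (t + 2 * \<eta>) \<le> 1" for \<eta> k
  proof (intro exI conjI)
    let ?W = "\<Union>x\<in>U. ball x \<eta>"
    show "open ?W" "U \<subseteq> ?W" using \<eta>(1) by auto
    show "card (hits k ?W) \<le> 5 ^ N"
    proof (rule card_hits_le)
      fix x y assume "x \<in> ?W" "y \<in> ?W"
      then obtain a b where ab: "a \<in> U" "b \<in> U" "dist a x < \<eta>" "dist b y < \<eta>" by auto
      have "dist x y \<le> dist a x + dist a b + dist b y"
        using dist_triangle[of x y a] dist_triangle[of a y b] by (simp add: dist_commute)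
      also have "dist a b \<le> t" unfolding t_def by (rule diameter_bounded_bound[OF assms(1) ab(1,2)])
      finally have "dist x y \<le> t + 2 * \<eta>" using ab by simp
      then have "2 ^ Suc k * dist x y \<le> 2 ^ Suc k * (t + 2 * \<eta>)" by (intro mult_left_mono) auto
      then show "2 ^ Suc k * dist x y \<le> 1" using \<eta>(2) by linarith
    qed
  qed
  have eight: "8 powr dm * t powr dm = (8 * t) powr dm" using t0 by (simp add: powr_mult)
  \<comment> \<open>For large t level 0 suffices, since 8 t \<ge> 1; for t = 0 any level with small
    \<open>1 / N ^ k\<close> does; otherwise k is the last level with 4 t \<le>
    \<open>1 / 2 ^ k\<close>.\<close>
  consider "4 * t > 1" | "t = 0" | "0 < t" "4 * t \<le> 1" using t0 by linarith
  then show ?thesis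
  proof cases
    case 1
    have "card (hits 0 UNIV) \<le> card (words 0)" unfolding hits_def by (intro card_mono card_words) auto
    also have "\<dots> \<le> 5 ^ N" by (simp add: card_words)
    finally have "card (hits 0 UNIV) \<le> 5 ^ N" .
    moreover have "1 \<le> (8 * t) powr dm" using 1 dm_pos by (intro ge_one_powr_ge_zero) auto
    ultimately show ?thesis using that[of UNIV 0] e eight by (simp add: t_def)
  next
    case 2
    obtain k where k: "(1 / real N) ^ k < e"
      using real_arch_pow_inv[of e "1 / real N"] e N2 by auto
    have "2 ^ Suc k * (t + 2 * (1 / 2 ^ (k + 3))) \<le> 1" using 2 by (simp add: field_simps power_add)
    then obtain W where "open W" "U \<subseteq> W" "card (hits k W) \<le> 5 ^ N" using enlarge[of "1 / 2 ^ (k + 3)" k] by auto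
    moreover have "1 / real N ^ k \<le> 8 powr dm * diameter U powr dm + e"
      using k by (simp add: power_divide add_increasing)
    ultimately show ?thesis using that by blast
  next
    case 3
    have "\<exists>n. (1 / 2 :: real) ^ n < 4 * t" using 3 by (intro real_arch_pow_inv) auto
    define n where "n = (LEAST n. (1 / 2 :: real) ^ n < 4 * t)"
    have n: "(1 / 2) ^ n < 4 * t" unfolding n_def using \<open>\<exists>n. _\<close> by (rule LeastI_ex)
    have "n \<noteq> 0" using n 3 by (cases n) auto
    then obtain k where k: "n = Suc k" by (cases n) auto
    have "\<not> (1 / 2) ^ k < 4 * t" using not_less_Least[of k "\<lambda>n. (1 / 2 :: real) ^ n < 4 * t"] k by (simp add: n_def)
    then have lo: "4 * t \<le> 1 / 2 ^ k" by (simp add: power_divide)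
    have hi: "1 / 2 ^ k \<le> 8 * t" using n unfolding k by (simp add: power_divide field_simps)
    have "2 ^ Suc k * (t + 2 * (t / 2)) = 2 ^ k * (4 * t)" by simp
    also have "\<dots> \<le> 2 ^ k * (1 / 2 ^ k)" by (intro mult_left_mono lo) simp
    also have "\<dots> = 1" by simp
    finally obtain W where "open W" "U \<subseteq> W" "card (hits k W) \<le> 5 ^ N" using enlarge[of "t / 2" k] 3 by auto
    moreover have "1 / real N ^ k \<le> (8 * t) powr dm"
      unfolding half_power_powr_dm[symmetric] by (intro powr_mono2 hi) (use dm_pos in auto)
    then have "1 / real N ^ k \<le> 8 powr dm * diameter U powr dm + e"
      using e eight by (simp add: t_def)
    ultimately show ?thesis using that by blast
  qed
qed

text \<open>Mass distribution by counting: a set of diameter about \<open>2 ^ - k\<close> meets boundedly many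
  of the \<open>N ^ k\<close> cells of level \<open>k\<close>, and compactness reduces to finitely many open sets.\<close>

lemma hausdorff_outer_V_pos: "hausdorff_outer dm V > 0"
proof -
  define C where "C = real (5 ^ N)"
  have C: "C > 0" by (simp add: C_def)
  \<comment> \<open>Comes from solving 1 \<le> C * 8 powr dm * s + 1/2 for the covering sum s; the
    1/2 bounds C times the sum of the errors \<open>e i\<close>.\<close>
  define c where "c = 1 / (2 * C * 8 powr dm)"
  have c: "c > 0" using C by (simp add: c_def)
  have "ennreal c \<le> hausdorff_pre dm 1 V"
  proof (rule hausdorff_pre_greatest)
    fix U :: "nat \<Rightarrow> 'a set"
    assume U: "\<And>i. bounded (U i)" "V \<subseteq> (\<Union>i. U i)"
    define e where "e i = (1 / 2) ^ Suc i / (2 * C)" for i :: nat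
    have e: "e i > 0" for i using C by (simp add: e_def)
    have "\<exists>k W. open W \<and> U i \<subseteq> W \<and> card (hits k W) \<le> 5 ^ N \<and>
        1 / real N ^ k \<le> 8 powr dm * diameter (U i) powr dm + e i" for i
      using open_enlargement[OF U(1) e] by metis
    then obtain k W where W: "\<And>i. open (W i)" "\<And>i. U i \<subseteq> W i" "\<And>i. card (hits (k i) (W i)) \<le> 5 ^ N"
        "\<And>i. 1 / real N ^ k i \<le> 8 powr dm * diameter (U i) powr dm + e i"
      by metis
    have "V \<subseteq> (\<Union>i\<in>UNIV. W i)" using U(2) W(2) by blast
    then obtain I where I: "finite I" "V \<subseteq> (\<Union>i\<in>I. W i)"
      using compactE_image[OF V_compact, of UNIV W] W(1) by metis
    \<comment> \<open>A common refinement level: the sum is just a convenient bound for the finitely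
      many k i.\<close>
    define m where "m = (\<Sum>i\<in>I. k i)"
    have km: "k i \<le> m" if "i \<in> I" for i unfolding m_def using I(1) that by (intro member_le_sum) auto
    have "words m \<subseteq> (\<Union>i\<in>I. hits m (W i))"
    proof
      fix w assume w: "w \<in> words m"
      then have "cell w \<subseteq> V" "cell w \<noteq> {}" using cell_V V_nonempty by (auto simp: words_def cell_def)
      then have "\<exists>i\<in>I. cell w \<inter> W i \<noteq> {}" using I(2) by blast
      then show "w \<in> (\<Union>i\<in>I. hits m (W i))" using w by (auto simp: hits_def)
    qed
    then have "card (words m) \<le> card (\<Union>i\<in>I. hits m (W i))"
      using I(1) finite_hits by (intro card_mono) auto
    also have "\<dots> \<le> (\<Sum>i\<in>I. card (hits m (W i)))" by (rule card_UN_le[OF I(1)])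
    also have "\<dots> \<le> (\<Sum>i\<in>I. 5 ^ N * N ^ (m - k i))"
    proof (rule sum_mono)
      fix i assume "i \<in> I"
      then have "card (hits m (W i)) \<le> card (hits (k i) (W i)) * N ^ (m - k i)"
        using card_hits_refine[of "k i" "m - k i" "W i"] km by simp
      also have "\<dots> \<le> 5 ^ N * N ^ (m - k i)" by (intro mult_right_mono W(3)) simp
      finally show "card (hits m (W i)) \<le> 5 ^ N * N ^ (m - k i)" .
    qed
    finally have "real (card (words m)) \<le> real (\<Sum>i\<in>I. 5 ^ N * N ^ (m - k i))" by (simp only: of_nat_le_iff)
    also have "\<dots> = (\<Sum>i\<in>I. C * (real N ^ m * (1 / real N ^ k i)))"
      unfolding of_nat_sum
    proof (rule sum.cong)
      fix i assume "i \<in> I"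
      then show "real (5 ^ N * N ^ (m - k i)) = C * (real N ^ m * (1 / real N ^ k i))"
        using N_pos power_diff[of "real N" "k i" m] km by (simp add: C_def)
    qed simp
    finally have "real N ^ m \<le> (\<Sum>i\<in>I. C * (real N ^ m * (1 / real N ^ k i)))"
      by (simp add: card_words)
    also have "\<dots> = real N ^ m * (C * (\<Sum>i\<in>I. 1 / real N ^ k i))"
      by (simp add: sum_distrib_left mult_ac)
    finally have "real N ^ m * 1 \<le> real N ^ m * (C * (\<Sum>i\<in>I. 1 / real N ^ k i))" by simp
    then have "1 \<le> C * (\<Sum>i\<in>I. 1 / real N ^ k i)"
      using N_pos by (subst (asm) mult_le_cancel_left_pos) auto
    also have "\<dots> \<le> C * (\<Sum>i\<in>I. 8 powr dm * diameter (U i) powr dm + e i)"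
      using C by (intro mult_left_mono sum_mono W(4)) auto
    also have "\<dots> = C * (8 powr dm * (\<Sum>i\<in>I. diameter (U i) powr dm)) + C * (\<Sum>i\<in>I. e i)"
      by (simp add: sum.distrib sum_distrib_left distrib_left)
    also have "C * (\<Sum>i\<in>I. e i) \<le> 1 / 2"
    proof -
      have s: "summable (\<lambda>i. (1 / 2 :: real) ^ Suc i)" using power_half_series by (rule sums_summable)
      have "(\<Sum>i\<in>I. (1 / 2 :: real) ^ Suc i) \<le> (\<Sum>i. (1 / 2) ^ Suc i)"
        by (rule sum_le_suminf[OF s I(1)]) auto
      also have "\<dots> = 1" using power_half_series by (rule sums_unique[symmetric])
      finally show ?thesis using C unfolding e_def by (simp add: sum_divide_distrib[symmetric])
    qed
    finally have "c \<le> (\<Sum>i\<in>I. diameter (U i) powr dm)"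
      using C unfolding c_def by (simp add: field_simps)
    then have "ennreal c \<le> ennreal (\<Sum>i\<in>I. diameter (U i) powr dm)" by (rule ennreal_leI)
    also have "\<dots> = (\<Sum>i\<in>I. ennreal (diameter (U i) powr dm))" by (simp add: sum_ennreal)
    also have "\<dots> \<le> (\<Sum>i. ennreal (diameter (U i) powr dm))"
      by (rule sum_le_suminf) (use I(1) in auto)
    finally show "ennreal c \<le> (\<Sum>i. ennreal (diameter (U i) powr dm))" .
  qed
  also have "\<dots> \<le> hausdorff_outer dm V" by (rule hausdorff_pre_le_outer) simp
  finally show ?thesis using c by (metis ennreal_less_zero_iff order_less_le_trans)
qed

lemma hausdorff_outer_S_pos:
  assumes "hausdorff_outer dm A > 0"
  shows "hausdorff_outer dm (S i ` A) > 0"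
proof -
  let ?g = "\<lambda>x. 2 *\<^sub>R x - p i"
  have "dist (?g x) (?g y) \<le> 2 * dist x y" for x y
  proof -
    have "?g x - ?g y = 2 *\<^sub>R (x - y)" by (simp add: scaleR_diff_right)
    then show ?thesis by (simp add: dist_norm)
  qed
  then have "hausdorff_outer dm (?g ` S i ` A) \<le> ennreal (2 powr dm) * hausdorff_outer dm (S i ` A)"
    by (rule hausdorff_outer_Lipschitz_image) (simp_all add: dm_pos)
  moreover have "?g ` S i ` A = A" by (simp add: image_image contr_def scaleR_add_right)
  ultimately show ?thesis using assms by (cases "hausdorff_outer dm (S i ` A) = 0") (auto simp: zero_less_iff_neq_zero)
qed

text \<open>Repeated contraction shrinks pieces around any point of V, and their measure stays
  positive because the contractions have Lipschitz inverses. This makes every relatively open set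
  charged.\<close>

lemma small_piece:
  "x \<in> V \<Longrightarrow> \<exists>A. compact A \<and> x \<in> A \<and> A \<subseteq> V \<and> (\<forall>y\<in>A. dist x y \<le> diameter V / 2 ^ n) \<and> hausdorff_outer dm A > 0"
proof (induction n arbitrary: x)
  case 0
  then show ?case
    using V_compact hausdorff_outer_V_pos diameter_bounded_bound[OF compact_imp_bounded[OF V_compact] 0]
    by (intro exI[of _ V]) auto
next
  case (Suc n)
  obtain i y where i: "i \<in> J" "y \<in> V" "x = S i y" using V_cases[OF Suc.prems] by blast
  obtain A where A: "compact A" "y \<in> A" "A \<subseteq> V" "\<forall>z\<in>A. dist y z \<le> diameter V / 2 ^ n" "hausdorff_outer dm A > 0"
    using Suc.IH[OF i(2)] by blast
  have "compact (S i ` A)"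
    by (intro compact_continuous_image A(1) continuous_intros)
  moreover have "\<forall>z\<in>S i ` A. dist x z \<le> diameter V / 2 ^ Suc n"
    using A(4) by (auto simp: i(3) dist_contr field_simps)
  moreover have "S i ` A \<subseteq> V" using A(3) i(1) S_V by blast
  ultimately show ?case
    using A(2) i(3) hausdorff_outer_S_pos[OF A(5)] by (intro exI[of _ "S i ` A"]) auto
qed

section \<open>The normalized measure\<close>

abbreviation \<mu> :: "'a measure" where "\<mu> \<equiv> gasket_measure N p"

lemma V_borel: "V \<in> sets borel" using compact_imp_closed[OF V_compact] by simp

lemma \<mu>_eq: "\<mu> = scale_measure (1 / emeasure (hausdorff_measure dm) V) (restrict_space (hausdorff_measure dm) V)"
  by (simp add: gasket_measure_def dm_def Let_def)

lemma space_\<mu>: "space \<mu> = V"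
  by (simp add: \<mu>_eq space_restrict_space space_scale_measure)

lemma sets_\<mu>: "sets \<mu> = sets (restrict_space borel V)"
  by (simp add: \<mu>_eq sets_restrict_space)

lemma emeasure_\<mu>:
  assumes "A \<in> sets borel" "A \<subseteq> V"
  shows "emeasure \<mu> A = hausdorff_outer dm A / hausdorff_outer dm V"
proof -
  have "emeasure (restrict_space (hausdorff_measure dm) V) A = emeasure (hausdorff_measure dm) A"
    by (rule emeasure_restrict_space) (use assms V_borel in auto)
  then show ?thesis
    using assms V_borel by (simp add: \<mu>_eq emeasure_hausdorff_measure divide_ennreal_def mult.commute)
qed

lemma emeasure_\<mu>_V: "emeasure \<mu> V = 1"
  using hausdorff_outer_V_pos hausdorff_outer_V_finite V_borel by (simp add: emeasure_\<mu> ennreal_divide_self)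

lemma \<mu>_support:
  assumes "open T" "T \<inter> V \<noteq> {}"
  shows "emeasure \<mu> (T \<inter> V) > 0"
proof -
  obtain x where x: "x \<in> T" "x \<in> V" using assms by blast
  obtain e where e: "e > 0" "ball x e \<subseteq> T" using assms(1) x(1) open_contains_ball by blast
  define R where "R = max 1 (diameter V)"
  have R: "R > 0" "diameter V \<le> R" by (auto simp: R_def)
  obtain n where n: "(1 / 2) ^ n < e / R"
    using real_arch_pow_inv[of "e / R" "1 / 2"] R e by auto
  have "diameter V / 2 ^ n \<le> R / 2 ^ n" using R by (intro divide_right_mono) auto
  also have "\<dots> < e" using n R by (simp add: field_simps)
  finally have small: "diameter V / 2 ^ n < e" .
  obtain A where A: "compact A" "A \<subseteq> V" "\<forall>y\<in>A. dist x y \<le> diameter V / 2 ^ n" "hausdorff_outer dm A > 0"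
    using small_piece[OF x(2), of n] by blast
  have "A \<subseteq> T \<inter> V" using A(2,3) small e(2) by (force simp: subset_eq)
  then have "hausdorff_outer dm (T \<inter> V) > 0" using A(4) hausdorff_outer_mono[of A "T \<inter> V" dm] by simp
  moreover have "T \<inter> V \<in> sets borel" using assms(1) V_borel by auto
  ultimately show ?thesis
    using hausdorff_outer_V_finite by (simp add: emeasure_\<mu> ennreal_zero_less_divide)
qed

end

section \<open>The space of finite energy functions\<close>

context simplex
begin

text \<open>The geometric series with ratio \<open>1 / sqrt rn\<close>, hence the solution of the
  recursion \<open>osc_eq\<close>.\<close>

definition osc :: real where "osc = 1 / (1 - 1 / sqrt rn)"

lemma osc_pos: "osc > 0" using rn_gt1 by (simp add: osc_def)

lemma osc_eq: "osc = osc / sqrt rn + 1"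
proof -
  have "1 / (1 - 1 / t) = 1 / (1 - 1 / t) / t + 1" if "t > 1" for t :: real
    using that by (simp add: field_simps)
  then show ?thesis unfolding osc_def using rn_gt1 real_sqrt_gt_1_iff by blast
qed

lemma cform_Suc_ge: "j \<in> J \<Longrightarrow> rn * cform m (\<lambda>x. u (S j x)) (\<lambda>x. u (S j x)) \<le> cform (Suc m) u u"
  unfolding cform.simps using rn_pos
  by (intro mult_left_mono member_le_sum[of j J "\<lambda>i. cform m (\<lambda>x. u (S i x)) (\<lambda>x. u (S i x))"]) (auto intro: cform_nonneg)

text \<open>Inside cell j the energy is at most \<open>1 / rn\<close> of the total, which bounds the
  way from y to p j by induction; the step from p j to p i costs one root of the energy.
  \<open>osc_eq\<close> closes the induction.\<close>

lemma level_osc: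
  "y \<in> L m \<Longrightarrow> i \<in> J \<Longrightarrow> \<bar>u y - u (p i)\<bar> \<le> osc * sqrt (cform m u u)"
proof (induction m arbitrary: y u i)
  case 0
  then obtain j where j: "j \<in> J" "y = p j" by auto
  have "(u (p j) - u (p i))\<^sup>2 \<le> cform 0 u u" unfolding cform.simps by (rule vform_ge1[OF j(1) 0(2)])
  then have "\<bar>u y - u (p i)\<bar> \<le> sqrt (cform 0 u u)" using j(2) real_sqrt_le_mono by fastforce
  also have "\<dots> \<le> osc * sqrt (cform 0 u u)"
  proof -
    have "osc / sqrt rn \<ge> 0" using osc_pos rn_pos by simp
    then have "osc \<ge> 1" using osc_eq by linarith
    then show ?thesis using mult_right_mono[of 1 osc "sqrt (cform 0 u u)"] cform_nonneg[of 0 u] by simp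
  qed
  finally show ?case .
next
  case (Suc m)
  then obtain j z where z: "j \<in> J" "z \<in> L m" "y = S j z" by auto
  let ?c = "cform (Suc m) u u"
  have c0: "0 \<le> ?c" by (rule cform_nonneg)
  have "cform m (\<lambda>x. u (S j x)) (\<lambda>x. u (S j x)) \<le> ?c / rn"
    using cform_Suc_ge[OF z(1), of m u] rn_pos by (simp add: pos_le_divide_eq mult.commute)
  then have "sqrt (cform m (\<lambda>x. u (S j x)) (\<lambda>x. u (S j x))) \<le> sqrt ?c / sqrt rn"
    by (metis real_sqrt_divide real_sqrt_le_mono)
  then have "osc * sqrt (cform m (\<lambda>x. u (S j x)) (\<lambda>x. u (S j x))) \<le> osc * (sqrt ?c / sqrt rn)"
    using osc_pos by (intro mult_left_mono) auto
  then have 1: "\<bar>u (S j z) - u (S j (p j))\<bar> \<le> osc / sqrt rn * sqrt ?c"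
    using Suc.IH[OF z(2,1), of "\<lambda>x. u (S j x)"] by simp
  have "(u (p j) - u (p i))\<^sup>2 \<le> cform 0 u u" unfolding cform.simps by (rule vform_ge1[OF z(1) Suc.prems(2)])
  also have "\<dots> \<le> ?c" by (rule cform_mono) simp
  finally have 2: "\<bar>u (p j) - u (p i)\<bar> \<le> sqrt ?c" using real_sqrt_le_mono by fastforce
  have "\<bar>u y - u (p i)\<bar> \<le> (osc / sqrt rn + 1) * sqrt ?c"
    using 1 2 unfolding z(3) S_fix by (simp add: distrib_right)
  then show ?case using osc_eq by simp
qed

lemma V_osc:
  assumes u: "continuous_on V u" and c: "\<And>m. cform m u u \<le> c" and "x \<in> V" "i \<in> J"
  shows "\<bar>u x - u (p i)\<bar> \<le> osc * sqrt c"
proof (rule V_bound_of_levels[OF _ _ assms(3)])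
  show "continuous_on V (\<lambda>x. u x - u (p i))" by (intro continuous_intros u)
  fix m y assume "y \<in> L m"
  then have "\<bar>u y - u (p i)\<bar> \<le> osc * sqrt (cform m u u)" by (rule level_osc[OF _ assms(4)])
  also have "\<dots> \<le> osc * sqrt c" using osc_pos c by (intro mult_left_mono) auto
  finally show "\<bar>u y - u (p i)\<bar> \<le> osc * sqrt c" .
qed

text \<open>In one n-cell the energy is at most \<open>c / rn ^ n\<close>, and two points are
  compared through a vertex. A junction lies in several cells, so each cell has its own open set:
  the complement of the cell if it misses x, else a pulled back neighbourhood. T serves all u and c
  at once.\<close>

lemma equicontinuous_nhd:
  "x \<in> V \<Longrightarrow> \<exists>T. open T \<and> x \<in> T \<and> (\<forall>u c y. continuous_on V u \<longrightarrow> (\<forall>m. cform m u u \<le> c) \<longrightarrow> y \<in> T \<inter> V \<longrightarrow>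
      \<bar>u x - u y\<bar> \<le> 2 * osc * sqrt (c / rn ^ n))"
proof (induction n arbitrary: x)
  case 0
  have "\<bar>u x - u y\<bar> \<le> 2 * osc * sqrt c" if "continuous_on V u" "\<forall>m. cform m u u \<le> c" "y \<in> V" for u c y
  proof -
    obtain i where i: "i \<in> J" using J_nonempty by blast
    show ?thesis
      using V_osc[OF that(1) _ 0 i, of c] V_osc[OF that(1) _ that(3) i, of c] that(2) by auto
  qed
  then show ?case by (intro exI[of _ UNIV]) auto
next
  case (Suc n)
  define Q where "Q i T \<longleftrightarrow> open T \<and> x \<in> T \<and> (\<forall>u c y. continuous_on V u \<longrightarrow> (\<forall>m. cform m u u \<le> c) \<longrightarrow>
      y \<in> T \<inter> S i ` V \<longrightarrow> \<bar>u x - u y\<bar> \<le> 2 * osc * sqrt (c / rn ^ Suc n))" for i T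
  have "\<exists>T. Q i T" if i: "i \<in> J" for i
  proof (cases "x \<in> S i ` V")
    case False
    have "closed (S i ` V)"
      by (intro compact_imp_closed compact_continuous_image V_compact continuous_intros)
    then have "Q i (- (S i ` V))" using False unfolding Q_def by auto
    then show ?thesis by blast
  next
    case True
    then obtain x' where x': "x' \<in> V" "x = S i x'" by blast
    obtain T where T: "open T" "x' \<in> T" and est: "\<And>u c y. continuous_on V u \<Longrightarrow> (\<forall>m. cform m u u \<le> c) \<Longrightarrow> y \<in> T \<inter> V \<Longrightarrow>
      \<bar>u x' - u y\<bar> \<le> 2 * osc * sqrt (c / rn ^ n)" using Suc.IH[OF x'(1)] by blast
    let ?g = "\<lambda>x. 2 *\<^sub>R x - p i"
    have inv: "?g (S i z) = z" for z by (simp add: contr_def scaleR_add_right)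
    have "open (?g -` T)" by (intro open_vimage T continuous_intros)
    moreover have "x \<in> ?g -` T" using T(2) x'(2) inv by simp
    moreover have "\<bar>u x - u y\<bar> \<le> 2 * osc * sqrt (c / rn ^ Suc n)"
      if u: "continuous_on V u" "\<forall>m. cform m u u \<le> c" "y \<in> ?g -` T \<inter> S i ` V" for u c y
    proof -
      obtain y' where y': "y' \<in> V" "y = S i y'" using u(3) by blast
      have yT: "y' \<in> T \<inter> V" using u(3) y' inv by simp
      have cont: "continuous_on V (\<lambda>x. u (S i x))"
        by (rule continuous_on_compose2[OF u(1)]) (auto intro!: continuous_intros S_V i)
      have "cform m (\<lambda>x. u (S i x)) (\<lambda>x. u (S i x)) \<le> c / rn" for m
      proof -
        have "rn * cform m (\<lambda>x. u (S i x)) (\<lambda>x. u (S i x)) \<le> c"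
          using cform_Suc_ge[OF i, of m u] u(2) order_trans by blast
        then show ?thesis using rn_pos by (simp add: pos_le_divide_eq mult.commute)
      qed
      then have "\<bar>u (S i x') - u (S i y')\<bar> \<le> 2 * osc * sqrt (c / rn / rn ^ n)"
        using est[OF cont _ yT] by blast
      then show ?thesis using x'(2) y'(2) by (simp add: mult.commute)
    qed
    ultimately have "Q i (?g -` T)" unfolding Q_def by blast
    then show ?thesis by blast
  qed
  then obtain T where TQ: "\<And>i. i \<in> J \<Longrightarrow> Q i (T i)" by metis
  then have T: "\<And>i. i \<in> J \<Longrightarrow> open (T i)" "\<And>i. i \<in> J \<Longrightarrow> x \<in> T i"
    and est: "\<And>i u c y. i \<in> J \<Longrightarrow> continuous_on V u \<Longrightarrow> (\<forall>m. cform m u u \<le> c) \<Longrightarrow> y \<in> T i \<inter> S i ` V \<Longrightarrow>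
      \<bar>u x - u y\<bar> \<le> 2 * osc * sqrt (c / rn ^ Suc n)"
    unfolding Q_def by blast+
  have "open (\<Inter>i\<in>J. T i)" using T(1) by (intro open_INT) auto
  moreover have "x \<in> (\<Inter>i\<in>J. T i)" using T(2) by blast
  moreover have "\<bar>u x - u y\<bar> \<le> 2 * osc * sqrt (c / rn ^ Suc n)"
    if u: "continuous_on V u" "\<forall>m. cform m u u \<le> c" "y \<in> (\<Inter>i\<in>J. T i) \<inter> V" for u c y
  proof -
    have "y \<in> V" using u(3) by blast
    then obtain i z where i: "i \<in> J" "z \<in> V" "y = S i z" by (rule V_cases)
    then show ?thesis using est[OF i(1) u(1,2), of y] u(3) by blast
  qed
  ultimately show ?case by blast
qed

text \<open>No extensionality here, so that pointwise sums and multiples stay in the space;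
  \<open>H01_iff\<close> links it to \<open>H01\<close>.\<close>

definition FE :: "('a \<Rightarrow> real) set" where
  "FE = {u. continuous_on V u \<and> (\<forall>i\<in>J. u (p i) = 0) \<and> finite_energy u}"

section \<open>The energy form as an abstract energy space\<close>

abbreviation EF :: "('a \<Rightarrow> real) \<Rightarrow> ('a \<Rightarrow> real) \<Rightarrow> real" where "EF \<equiv> energy_form N p"

definition bform :: "('a \<Rightarrow> real) \<Rightarrow> ('a \<Rightarrow> real) \<Rightarrow> real" where "bform u v = lim (\<lambda>m. cform m u v)"

lemma finite_energy_lin: "finite_energy u \<Longrightarrow> finite_energy v \<Longrightarrow> finite_energy (\<lambda>x. u x + c * v x)"
proof -
  assume "finite_energy u" "finite_energy v"
  then obtain a b where ab: "\<And>m. cform m u u \<le> a" "\<And>m. cform m v v \<le> b" by (auto simp: finite_energy_def)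
  have "cform m (\<lambda>x. u x + c * v x) (\<lambda>x. u x + c * v x) \<le> 2 * a + 2 * c\<^sup>2 * b" for m
  proof -
    have "0 \<le> cform m (\<lambda>x. u x + (- c) * v x) (\<lambda>x. u x + (- c) * v x)" by (rule cform_nonneg)
    then have "cform m (\<lambda>x. u x + c * v x) (\<lambda>x. u x + c * v x) \<le> 2 * cform m u u + 2 * c\<^sup>2 * cform m v v"
      unfolding cform_expand by simp
    also have "\<dots> \<le> 2 * a + 2 * c\<^sup>2 * b" by (intro add_mono mult_left_mono ab) auto
    finally show ?thesis .
  qed
  then show ?thesis unfolding finite_energy_def by blast
qed

lemma cform_polar: "cform m u v = (cform m (\<lambda>x. u x + 1 * v x) (\<lambda>x. u x + 1 * v x) - cform m (\<lambda>x. u x + (-1) * v x) (\<lambda>x. u x + (-1) * v x)) / 4"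
  unfolding cform_expand by simp

lemma bform_polar:
  assumes "finite_energy u" "finite_energy v"
  shows "(\<lambda>m. cform m u v) \<longlonglongrightarrow> (E (\<lambda>x. u x + 1 * v x) - E (\<lambda>x. u x + (-1) * v x)) / 4"
  by (subst cform_polar) (intro tendsto_intros cform_tendsto_E finite_energy_lin assms, simp)

lemma bform_tendsto: "finite_energy u \<Longrightarrow> finite_energy v \<Longrightarrow> (\<lambda>m. cform m u v) \<longlonglongrightarrow> bform u v"
  using bform_polar[of u v] unfolding bform_def by (simp add: limI)

text \<open>Convergence is known for squares only; polarization transfers it, with the same factor,
  to the mixed sums.\<close>

lemma EF_eq:
  assumes "finite_energy u" "finite_energy v"
  shows "EF u v = (1 + chi) * bform u v"
proof -
  have pol: "((real N + 2) / real N) ^ m * (\<Sum>(x, y)\<in>nb m. (u x - u y) * (v x - v y)) =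
      (EL m (\<lambda>x. u x + 1 * v x) - EL m (\<lambda>x. u x + (-1) * v x)) / 4" for m
  proof -
    have "nsum m (\<lambda>x. u x + 1 * v x) - nsum m (\<lambda>x. u x + (-1) * v x) = 4 * (\<Sum>(x, y)\<in>nb m. (u x - u y) * (v x - v y))"
      unfolding nsum_def sum_subtractf[symmetric] sum_distrib_left
      by (intro sum.cong) (auto simp: power2_eq_square algebra_simps)
    then show ?thesis by (simp add: energy_level_eq rn_def right_diff_distrib[symmetric])
  qed
  have "(\<lambda>m. (EL m (\<lambda>x. u x + 1 * v x) - EL m (\<lambda>x. u x + (-1) * v x)) / 4) \<longlonglongrightarrow>
     ((1 + chi) * E (\<lambda>x. u x + 1 * v x) - (1 + chi) * E (\<lambda>x. u x + (-1) * v x)) / 4"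
    by (intro tendsto_intros EL_tendsto finite_energy_lin assms) simp
  then have "EF u v = ((1 + chi) * E (\<lambda>x. u x + 1 * v x) - (1 + chi) * E (\<lambda>x. u x + (-1) * v x)) / 4"
    unfolding energy_form_def pol by (rule limI)
  also have "\<dots> = (1 + chi) * bform u v"
    using LIMSEQ_unique[OF bform_polar[OF assms] bform_tendsto[OF assms]]
    by (simp add: right_diff_distrib[symmetric])
  finally show ?thesis .
qed

lemma bform_self: "bform u u = E u" by (simp add: bform_def E_def)

lemma EF_self: "finite_energy u \<Longrightarrow> EF u u = (1 + chi) * E u"
  by (simp add: EF_eq bform_self)

lemma E_nonneg: "finite_energy u \<Longrightarrow> 0 \<le> E u"
  using order_trans[OF cform_nonneg cform_le_E] .

lemma cform_le_EF: "finite_energy u \<Longrightarrow> cform m u u \<le> EF u u"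
  using cform_le_E[of u m] mult_nonneg_nonneg[OF chi_nonneg E_nonneg, of u]
  by (simp add: EF_self distrib_right)

lemma E_le: "finite_energy u \<Longrightarrow> (\<And>m. cform m u u \<le> c) \<Longrightarrow> E u \<le> c"
  by (rule LIMSEQ_le_const2[OF cform_tendsto_E]) auto

lemma EF_cong: "(\<And>x. x \<in> V \<Longrightarrow> u x = u' x) \<Longrightarrow> (\<And>x. x \<in> V \<Longrightarrow> v x = v' x) \<Longrightarrow> EF u v = EF u' v'"
proof -
  assume *: "\<And>x. x \<in> V \<Longrightarrow> u x = u' x" "\<And>x. x \<in> V \<Longrightarrow> v x = v' x"
  have "(\<Sum>(x, y)\<in>nb m. (u x - u y) * (v x - v y)) = (\<Sum>(x, y)\<in>nb m. (u' x - u' y) * (v' x - v' y))" for m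
    by (intro sum.cong) (use * nb_V in auto)
  then show ?thesis unfolding energy_form_def by simp
qed

lemma FE_sup:
  assumes "u \<in> FE" "\<And>m. cform m u u \<le> c" "x \<in> V"
  shows "\<bar>u x\<bar> \<le> osc * sqrt c"
proof -
  obtain i where i: "i \<in> J" using J_nonempty by blast
  then show ?thesis using V_osc[of u c x i] assms by (simp add: FE_def)
qed

lemma finite_energy_zero: "finite_energy (\<lambda>x. 0)"
  unfolding finite_energy_def
  using cform_lin[of _ "\<lambda>x. 0" "-1" "\<lambda>x. 0" "\<lambda>x. 0"] by (intro exI[of _ 0]) auto

lemma FE_lin: "u \<in> FE \<Longrightarrow> v \<in> FE \<Longrightarrow> (\<lambda>x. u x + c * v x) \<in> FE"
  by (auto simp: FE_def intro!: continuous_intros finite_energy_lin)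

lemma FE_zero: "(\<lambda>x. 0) \<in> FE"
  by (auto simp: FE_def finite_energy_zero)

lemma FE_subseq:
  assumes z: "\<And>n::nat. z n \<in> FE" "\<And>n. EF (z n) (z n) \<le> c"
  shows "\<exists>w k. strict_mono k \<and> continuous_on V w \<and> (\<forall>x\<in>V. (\<lambda>n. z (k n :: nat) x) \<longlonglongrightarrow> w x)"
proof -
  have fe: "finite_energy (z n)" and cont: "continuous_on V (z n)" for n using z(1) by (auto simp: FE_def)
  have c: "cform m (z n) (z n) \<le> c" for m n using cform_le_EF[OF fe, of m n] z(2)[of n] by simp
  have bd: "norm (z n x) \<le> osc * sqrt c" if "x \<in> V" for n x
    using FE_sup[OF z(1) c that] by simp
  have eq: "\<exists>d>0. \<forall>n y. y \<in> V \<and> norm (x - y) < d \<longrightarrow> norm (z n x - z n y) < e" if x: "x \<in> V" and e: "e > 0" for x e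
  proof -
    have "(\<lambda>n. 2 * osc * sqrt (c * (1 / rn) ^ n)) \<longlonglongrightarrow> 2 * osc * sqrt (c * 0)"
      using rn_gt1 by (intro tendsto_intros LIMSEQ_realpow_zero) auto
    then have "eventually (\<lambda>n. 2 * osc * sqrt (c * (1 / rn) ^ n) < e) sequentially"
      using e by (intro order_tendstoD(2)) auto
    then obtain n0 where n0: "2 * osc * sqrt (c / rn ^ n0) < e"
      unfolding eventually_sequentially by (auto simp: power_divide)
    obtain T where T: "open T" "x \<in> T" and est: "\<And>u c y. continuous_on V u \<Longrightarrow> (\<forall>m. cform m u u \<le> c) \<Longrightarrow> y \<in> T \<inter> V \<Longrightarrow>
      \<bar>u x - u y\<bar> \<le> 2 * osc * sqrt (c / rn ^ n0)" using equicontinuous_nhd[OF x, of n0] by blast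
    obtain d where d: "d > 0" "ball x d \<subseteq> T" using T open_contains_ball by blast
    have "norm (z n x - z n y) < e" if "y \<in> V" "norm (x - y) < d" for n y
    proof -
      have "y \<in> T \<inter> V" using d(2) that by (auto simp: dist_norm)
      then have "\<bar>z n x - z n y\<bar> \<le> 2 * osc * sqrt (c / rn ^ n0)" using est[OF cont] c by blast
      then show ?thesis using n0 by simp
    qed
    then show ?thesis using d(1) by blast
  qed
  obtain w k where w: "continuous_on V w" "strict_mono (k :: nat \<Rightarrow> nat)"
    and conv: "\<And>e. 0 < e \<Longrightarrow> \<exists>M. \<forall>n x. n \<ge> M \<and> x \<in> V \<longrightarrow> norm (z (k n) x - w x) < e"
    using Arzela_Ascoli[OF V_compact bd eq] by blast
  have "(\<lambda>n. z (k n) x) \<longlonglongrightarrow> w x" if "x \<in> V" for x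
    by (rule LIMSEQ_I) (use conv that in blast)
  then show ?thesis using w by blast
qed

text \<open>Each \<open>cform m\<close> depends on finitely many values and passes to the pointwise
  limit. The bound is first divided by 1 + chi, so that exactly c comes back at the end.\<close>

lemma FE_closed:
  assumes z: "\<And>n::nat. z n \<in> FE" "\<And>n. EF (z n) (z n) \<le> c"
    and w: "continuous_on V w" "\<And>x. x \<in> V \<Longrightarrow> (\<lambda>n. z n x) \<longlonglongrightarrow> w x"
  shows "w \<in> FE \<and> EF w w \<le> c"
proof -
  have chi1: "1 + chi > 0" using chi_nonneg by simp
  have fe: "finite_energy (z n)" for n using z(1) by (auto simp: FE_def)
  have le: "cform m (z n) (z n) \<le> c / (1 + chi)" for m n
  proof -
    have "(1 + chi) * E (z n) \<le> c" using z(2)[of n] by (simp add: EF_self fe)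
    then have "E (z n) \<le> c / (1 + chi)" using chi1 by (simp add: pos_le_divide_eq mult.commute)
    then show ?thesis using cform_le_E[OF fe, of m n] by simp
  qed
  have wle: "cform m w w \<le> c / (1 + chi)" for m
    by (rule LIMSEQ_le_const2[OF cform_tendsto[of z w m]]) (use w le in auto)
  then have few: "finite_energy w" unfolding finite_energy_def by blast
  have "w (p i) = 0" if "i \<in> J" for i
  proof -
    have "(\<lambda>n. z n (p i)) \<longlonglongrightarrow> w (p i)" by (rule w(2)[OF vertex_V[OF that]])
    moreover have "z n (p i) = 0" for n using z(1) that by (auto simp: FE_def)
    ultimately show ?thesis by (simp add: LIMSEQ_const_iff)
  qed
  moreover have "EF w w \<le> c"
    using E_le[OF few wle] chi1 by (simp add: EF_self few pos_le_divide_eq mult.commute)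
  ultimately show ?thesis using w few by (auto simp: FE_def)
qed

text \<open>The spline of level 1 of the indicator of the junction S 1 (p 2), which is no vertex
  since its first coordinate is 1/2.\<close>

lemma FE_nontrivial: "\<exists>u\<in>FE. \<exists>x\<in>V. u x \<noteq> 0"
proof -
  have J12: "1 \<in> J" "2 \<in> J" "(1::nat) \<noteq> 2" using N2 by (auto simp: J_def)
  define z where "z = S 1 (p 2)"
  have zV: "z \<in> V" unfolding z_def by (intro S_V vertex_V J12)
  have nz: "p i \<noteq> z" if i: "i \<in> J" for i
  proof
    assume eq: "p i = z"
    have "bary 1 z = 1 / 2" unfolding z_def using J12 by (simp add: bary_S' bary_vertex)
    then show False using bary_vertex[OF i J12(1)] eq by (simp split: if_splits)
  qed
  define f where "f x = (if x = z then 1 else 0 :: real)" for x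
  have "G 1 f z = G 0 (\<lambda>x. f (S 1 x)) (p 2)"
    using G_S[OF J12(1) vertex_V[OF J12(2)], of 0 f] by (simp add: z_def One_nat_def)
  also have "\<dots> = 1" using G_vertex[OF J12(2), of 0 "\<lambda>x. f (S 1 x)"] by (simp add: f_def z_def)
  finally have "G 1 f z \<noteq> 0" by simp
  moreover have "G 1 f \<in> FE"
  proof -
    have "cform m (G 1 f) (G 1 f) \<le> cform 1 f f" for m
      using cform_mono[of m "max m 1" "G 1 f"] cform_G_G[of 1 "max m 1" f] by simp
    then have "finite_energy (G 1 f)" unfolding finite_energy_def by blast
    then show ?thesis using nz by (auto simp: FE_def G_cont G_vertex f_def)
  qed
  ultimately show ?thesis using zV by blast
qed

sublocale ES: energy_space \<mu> V FE EF osc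
proof
  fix u v w :: "'a \<Rightarrow> real" and c :: real
  have fe: "finite_energy u" if "u \<in> FE" for u using that by (simp add: FE_def)
  show "compact V" by (rule V_compact)
  show "space \<mu> = V" by (rule space_\<mu>)
  show "sets \<mu> = sets (restrict_space borel V)" by (rule sets_\<mu>)
  show "emeasure \<mu> V = 1" by (rule emeasure_\<mu>_V)
  show "0 < emeasure \<mu> (T \<inter> V)" if "open T" "T \<inter> V \<noteq> {}" for T using \<mu>_support[OF that] .
  show "(\<lambda>x. u x + v x) \<in> FE" if "u \<in> FE" "v \<in> FE" using FE_lin[OF that, of 1] by simp
  show "(\<lambda>x. c * u x) \<in> FE" if "u \<in> FE" using FE_lin[OF FE_zero that, of c] by simp
  show "continuous_on V u" if "u \<in> FE" using that by (simp add: FE_def)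
  show "EF u v = EF v u" unfolding energy_form_def by (simp add: mult.commute)
  have lin: "EF (\<lambda>x. u x + c * v x) w = EF u w + c * EF v w"
    if "u \<in> FE" "v \<in> FE" "w \<in> FE" for u v w c
  proof -
    note f = fe[OF that(1)] fe[OF that(2)] fe[OF that(3)]
    have "(\<lambda>m. cform m (\<lambda>x. u x + c * v x) w) \<longlonglongrightarrow> bform (\<lambda>x. u x + c * v x) w"
      by (intro bform_tendsto finite_energy_lin f)
    moreover have "(\<lambda>m. cform m (\<lambda>x. u x + c * v x) w) \<longlonglongrightarrow> bform u w + c * bform v w"
      unfolding cform_lin by (intro tendsto_intros bform_tendsto f)
    ultimately have "bform (\<lambda>x. u x + c * v x) w = bform u w + c * bform v w" by (rule LIMSEQ_unique)
    then show ?thesis by (simp add: EF_eq f finite_energy_lin algebra_simps)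
  qed
  show "EF (\<lambda>x. u x + v x) w = EF u w + EF v w" if "u \<in> FE" "v \<in> FE" "w \<in> FE" using lin[OF that, of 1] by simp
  show "EF (\<lambda>x. c * u x) w = c * EF u w" if "u \<in> FE" "w \<in> FE"
  proof -
    have "EF (\<lambda>x. 0) w = 0" unfolding energy_form_def by (simp add: limI)
    then show ?thesis using lin[OF FE_zero that, of c] by simp
  qed
  show "0 \<le> EF u u" if "u \<in> FE" using E_nonneg[OF fe[OF that]] chi_nonneg by (simp add: EF_self fe that)
  show "0 < osc" by (rule osc_pos)
  show "\<bar>u x\<bar> \<le> osc * sqrt (EF u u)" if "u \<in> FE" "x \<in> V" for x
    using FE_sup[OF that(1) cform_le_EF[OF fe[OF that(1)]] that(2)] .
  show "w \<in> FE \<and> EF w w \<le> c" if "\<And>n::nat. z n \<in> FE" "\<And>n. EF (z n) (z n) \<le> c" "continuous_on V w"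
      "\<And>x. x \<in> V \<Longrightarrow> (\<lambda>n. z n x) \<longlonglongrightarrow> w x" for z :: "nat \<Rightarrow> 'a \<Rightarrow> real"
    using FE_closed[OF that] .
  show "\<exists>w k. strict_mono k \<and> continuous_on V w \<and> (\<forall>x\<in>V. (\<lambda>n. z (k n :: nat) x) \<longlonglongrightarrow> w x)"
    if "\<And>n::nat. z n \<in> FE" "\<And>n. EF (z n) (z n) \<le> c" for z :: "nat \<Rightarrow> 'a \<Rightarrow> real"
    using FE_subseq[OF that] .
qed

section \<open>Return to \<open>H01\<close> and weak solutions\<close>

lemma energy_eq: "finite_energy u \<Longrightarrow> energy N p u = ennreal ((1 + chi) * E u)"
  unfolding energy_def by (intro limI tendsto_ennrealI EL_tendsto)

text \<open>The levels dominate the increasing, unbounded cell energies, so the \<open>lim\<close>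
  in \<open>energy\<close> is a genuine limit in this case as well.\<close>

lemma energy_infinite:
  assumes "\<not> finite_energy u"
  shows "energy N p u = \<infinity>"
proof -
  have "filterlim (\<lambda>m. EL m u) at_top sequentially"
    unfolding filterlim_at_top
  proof
    fix Z
    obtain m0 where m0: "Z < cform m0 u u" using assms by (auto simp: finite_energy_def not_le)
    show "eventually (\<lambda>m. Z \<le> EL m u) sequentially"
      using eventually_ge_at_top[of m0]
    proof eventually_elim
      case (elim m)
      then show ?case using m0 cform_mono[OF elim, of u] EL_ge[of m u] by linarith
    qed
  qed
  then have "(\<lambda>m. ennreal (EL m u)) \<longlonglongrightarrow> \<infinity>"
    by (simp add: ennreal_tendsto_top_eq_at_top)
  then show ?thesis unfolding energy_def by (rule limI)
qed

lemma H01_iff: "u \<in> H01 N p \<longleftrightarrow> u \<in> extensional V \<and> u \<in> FE"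
proof -
  have "energy N p u < \<infinity> \<longleftrightarrow> finite_energy u"
    using energy_eq[of u] energy_infinite[of u] by (cases "finite_energy u") auto
  then show ?thesis by (auto simp: H01_def C0_def FE_def)
qed

lemma FE_cong: "u \<in> FE \<Longrightarrow> (\<And>x. x \<in> V \<Longrightarrow> u x = v x) \<Longrightarrow> v \<in> FE"
proof -
  assume u: "u \<in> FE" and eq: "\<And>x. x \<in> V \<Longrightarrow> u x = v x"
  have "continuous_on V v" using u eq by (auto simp: FE_def cong: continuous_on_cong)
  moreover have "cform m v v = cform m u u" for m by (rule cform_cong) (simp_all add: eq)
  ultimately show ?thesis using u eq vertex_V by (auto simp: FE_def finite_energy_def)
qed

lemma weak_solution_restrict:
  assumes u: "u \<in> FE" and sol: "\<And>v. v \<in> FE \<Longrightarrow> EF u v = (\<integral>x. h x (u x) * v x \<partial>\<mu>)"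
  shows "weak_solution N p h (restrict u V)"
  unfolding weak_solution_def
proof (intro conjI ballI)
  show "restrict u V \<in> H01 N p" using FE_cong[OF u, of "restrict u V"] by (simp add: H01_iff)
  fix v assume "v \<in> H01 N p"
  then have v: "v \<in> FE" by (simp add: H01_iff)
  have "EF (restrict u V) v = EF u v" by (rule EF_cong) auto
  moreover have "(\<integral>x. h x (restrict u V x) * v x \<partial>\<mu>) = (\<integral>x. h x (u x) * v x \<partial>\<mu>)"
    by (rule Bochner_Integration.integral_cong) (simp_all add: space_\<mu>)
  ultimately show "EF (restrict u V) v - (\<integral>x. h x (restrict u V x) * v x \<partial>\<mu>) = 0" using sol[OF v] by simp
qed

lemma three_solutions:
  assumes u: "u \<in> FE" "0 < EF u u" and w: "w \<in> FE" "EF u u < EF w w"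
    and sol: "\<And>v. v \<in> FE \<Longrightarrow> EF u v = (\<integral>x. rhs r s q lam eta x (u x) * v x \<partial>\<mu>)"
       "\<And>v. v \<in> FE \<Longrightarrow> EF w v = (\<integral>x. rhs r s q lam eta x (w x) * v x \<partial>\<mu>)"
  shows "\<exists>U. card U = 3 \<and> (\<forall>u\<in>U. weak_solution N p (rhs r s q lam eta) u \<and> (\<exists>x\<in>V. u x \<noteq> 0))"
proof -
  let ?m = "\<lambda>x. - 1 * u x"
  have m: "?m \<in> FE" by (rule ES.X_scale[OF u(1)])
  have mm: "EF ?m ?m = EF u u" using ES.B_scale2[OF u(1), of "- 1"] by simp
  have sol_m: "EF ?m v = (\<integral>x. rhs r s q lam eta x (?m x) * v x \<partial>\<mu>)" if v: "v \<in> FE" for v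
  proof -
    have "rhs r s q lam eta x (?m x) * v x = - (rhs r s q lam eta x (u x) * v x)" for x
      by (simp add: rhs_def algebra_simps)
    then show ?thesis using sol(1)[OF v] ES.B_scale[OF u(1) v, of "- 1"] by simp
  qed
  obtain x where x: "x \<in> V" "u x \<noteq> 0" using ES.nonzero_on_V[OF u] by blast
  have wpos: "0 < EF w w" using u w by simp
  let ?U = "{restrict u V, restrict ?m V, restrict w V}"
  have "restrict u V x \<noteq> restrict ?m V x" using x by simp
  then have 1: "restrict u V \<noteq> restrict ?m V" by metis
  have 2: "restrict a V \<noteq> restrict w V" if "a \<in> FE" "EF a a = EF u u" for a
  proof
    assume "restrict a V = restrict w V"
    then have "a x = w x" if "x \<in> V" for x using that by (metis restrict_apply')
    then have "EF a a = EF w w" by (intro ES.B_cong_V that w(1)) auto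
    then show False using that(2) w(2) by simp
  qed
  have card: "card ?U = 3" using 1 2[OF u(1) refl] 2[OF m mm] by simp
  have "\<exists>x\<in>V. restrict a V x \<noteq> 0" if "a \<in> FE" "0 < EF a a" for a
    using ES.nonzero_on_V[OF that] by auto
  moreover note weak_solution_restrict[where h = "rhs r s q lam eta", OF u(1) sol(1)]
    weak_solution_restrict[where h = "rhs r s q lam eta", OF w(1) sol(2)]
    weak_solution_restrict[where h = "rhs r s q lam eta", OF m sol_m]
  ultimately have "\<forall>a\<in>?U. weak_solution N p (rhs r s q lam eta) a \<and> (\<exists>x\<in>V. a x \<noteq> 0)"
    using u m mm w(1) wpos by (simp del: restrict_apply)
  with card show ?thesis by blast
qed

end

theorem theorem6p8:
  fixes N :: nat and p :: "nat \<Rightarrow> real ^ 'n" and r s q :: real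
  assumes "N \<ge> 2" and "CARD('n) = N - 1" and "simplex_vertices N p"
    and "1 < r" and "r < s" and "s < 2" and "2 < q"
  shows "\<exists>\<Lambda>::real. \<Lambda> > 0 \<and> (\<forall>lam\<in>{0<..<\<Lambda>}. \<exists>eta_lam::real. eta_lam > 0 \<and>
           (\<forall>eta\<in>{0..<eta_lam}.
              \<exists>U. card U = 3 \<and>
                  (\<forall>u\<in>U. weak_solution N p (rhs r s q lam eta) u \<and>
                          (\<exists>x\<in>gasket N p. u x \<noteq> 0))))"
proof -
  interpret simplex N p by unfold_locales (use assms in auto)
  obtain \<phi> x0 where \<phi>: "\<phi> \<in> FE" "x0 \<in> gasket N p" "\<phi> x0 \<noteq> 0" using FE_nontrivial by blast
  obtain \<Lambda> where \<Lambda>: "\<Lambda> > 0" and main: "\<And>lam. lam \<in> {0<..<\<Lambda>} \<Longrightarrow> \<exists>eta0>0. \<forall>eta\<in>{0..<eta0}. \<exists>u\<in>FE. \<exists>w\<in>FE.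
    0 < EF u u \<and> EF u u < EF w w \<and>
    (\<forall>v\<in>FE. EF u v = (\<integral>x. rhs r s q lam eta x (u x) * v x \<partial>\<mu>)) \<and>
    (\<forall>v\<in>FE. EF w v = (\<integral>x. rhs r s q lam eta x (w x) * v x \<partial>\<mu>))"
    using ES.two_critical_points[OF assms(4-7) \<phi>] by blast
  have "\<exists>eta_lam::real. eta_lam > 0 \<and> (\<forall>eta\<in>{0..<eta_lam}. \<exists>U. card U = 3 \<and>
      (\<forall>u\<in>U. weak_solution N p (rhs r s q lam eta) u \<and> (\<exists>x\<in>gasket N p. u x \<noteq> 0)))"
    if lam: "lam \<in> {0<..<\<Lambda>}" for lam
  proof -
    obtain eta0 where eta0: "eta0 > 0" and sol: "\<And>eta. eta \<in> {0..<eta0} \<Longrightarrow> \<exists>u\<in>FE. \<exists>w\<in>FE.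
      0 < EF u u \<and> EF u u < EF w w \<and>
      (\<forall>v\<in>FE. EF u v = (\<integral>x. rhs r s q lam eta x (u x) * v x \<partial>\<mu>)) \<and>
      (\<forall>v\<in>FE. EF w v = (\<integral>x. rhs r s q lam eta x (w x) * v x \<partial>\<mu>))"
      using main[OF lam] by blast
    have "\<exists>U. card U = 3 \<and> (\<forall>u\<in>U. weak_solution N p (rhs r s q lam eta) u \<and> (\<exists>x\<in>gasket N p. u x \<noteq> 0))"
      if eta: "eta \<in> {0..<eta0}" for eta
    proof -
      obtain u w where "u \<in> FE" "w \<in> FE" "0 < EF u u" "EF u u < EF w w"
        "\<And>v. v \<in> FE \<Longrightarrow> EF u v = (\<integral>x. rhs r s q lam eta x (u x) * v x \<partial>\<mu>)"
        "\<And>v. v \<in> FE \<Longrightarrow> EF w v = (\<integral>x. rhs r s q lam eta x (w x) * v x \<partial>\<mu>)"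
        using sol[OF eta] by blast
      then show ?thesis by (intro three_solutions)
    qed
    then show ?thesis using eta0 by blast
  qed
  then show ?thesis using \<Lambda> by blast
qed

end
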